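(* Let $m=m(n)\ge 1$ be integers with $m=o(n)$ as $n\to\infty$, and let $h_0,\dots,h_{n-1}:\mathbb{R}^m\to\mathbb{R}$ be measurable functions (which may depend on $n$) such that $E|h_k(X_k^m)|^3<\infty$ for $k=0,1,\dots,n-1$. Let $R_{n,m}=\sum_{k=0}^{n-1}h_k(nS_k,\dots,nS_{k+m-1})$. Put $$C_{n,m}=\frac1n\sum_{k=0}^{n-1}\sum_{j=k-m+1}^{k+m-1}\operatorname{cov}\big(h_k(X_k^m),h_j(X_j^m)\big),\qquad B_{n,m}=\frac1n\sum_{k=0}^{n-1}\operatorname{cov}\big(h_k(X_k^m),|X_k^m|\big),$$ and $\sigma_{n,m}^2=n\,(C_{n,m}-B_{n,m}^2)$, and assume $\sigma_{n,m}^2>0$. Then $$\operatorname{Var}R_{n,m}=\sigma_{n,m}^2\,(1+r_{2n}),$$ where, with a positive absolute constant $c$, $$|r_{2n}|\le\frac{c}{\sigma_{n,m}^2}\left[\frac mn\sum_{k=0}^{n-1}\sum_{j=k-m+1}^{k+m-1}\Big(E|\bar h_k(X_k^m)|^3\,E|\bar h_j(X_j^m)|^3\Big)^{1/3}+\frac{m^{3/2}}{n^{3/2}}\left(\sum_{k=0}^{n-1}\big(E|\bar h_k(X_k^m)|^3\big)^{1/3}\right)^2\right].$$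
   Context: Spacings: let $0\le U_1\le U_2\le\dots\le U_{n-1}\le 1$ be the order statistics of a sample of size $n-1$ from the uniform distribution on $[0,1]$. Put $U_0=0$, $U_n=1$, and $U_k=1+U_{k-n}$ for $k\ge n$. The simple spacings are $S_k=U_{k+1}-U_k$, $k\ge 0$ (so $S_{n+j}=S_j$). Exponentials: $X_0,X_1,\dots,X_{n-1}$ are independent random variables with the standard exponential distribution (mean 1), and $X_{n+j}=X_j$. Write $X_k^m=(X_k,\dots,X_{k+m-1})$, $|X_k^m|=X_k+\dots+X_{k+m-1}$, and $\bar h_k(X_k^m)=h_k(X_k^m)-E h_k(X_k^m)$. Indices $j$ outside $\{0,\dots,n-1\}$ (of both $h_j$ and $X_j$) are understood modulo $n$. *)

theory Defs
  imports "HOL-Probability.Probability" "HOL-Library.Landau_Symbols"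
begin

text \<open>A vector in \<open>\<real>\<^sup>m\<close> is an element of the space of \<open>PiM {..<m} (\<lambda>_. borel)\<close>, with \<open>m\<close> an ordinary
  natural number. All quantities below depend only on the laws of the uniform sample and of the
  exponential variables, so both are realised as coordinates on the canonical product spaces.\<close>

section \<open>Uniform spacings\<close>

definition unif_sample :: "nat \<Rightarrow> (nat \<Rightarrow> real) measure" where
  "unif_sample n = PiM {1..<n} (\<lambda>_. uniform_measure lborel {0..1})"

text \<open>For \<open>1 \<le> k < n\<close> the list entry is the \<open>k\<close>-th smallest of \<open>\<omega> 1, \<dots>, \<omega> (n - 1)\<close>, and the leading
  \<open>0\<close> is \<open>U\<^sub>0\<close>. The recursion is \<open>U\<^sub>k = 1 + U\<^sub>k\<^sub>-\<^sub>n\<close> for \<open>k \<ge> n\<close>, which gives \<open>U\<^sub>n = 1\<close>. The case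
  \<open>n = 0\<close> is irrelevant and only secures termination.\<close>

fun unif_order :: "nat \<Rightarrow> (nat \<Rightarrow> real) \<Rightarrow> nat \<Rightarrow> real" where
  "unif_order n \<omega> k =
     (if n = 0 then 0
      else if k < n then (0 # sort (map \<omega> [1..<n])) ! k
      else 1 + unif_order n \<omega> (k - n))"

declare unif_order.simps [simp del]

definition spacing :: "nat \<Rightarrow> (nat \<Rightarrow> real) \<Rightarrow> nat \<Rightarrow> real" where
  "spacing n \<omega> k = unif_order n \<omega> (Suc k) - unif_order n \<omega> k"

definition R_stat :: "nat \<Rightarrow> nat \<Rightarrow> (nat \<Rightarrow> (nat \<Rightarrow> real) \<Rightarrow> real) \<Rightarrow> (nat \<Rightarrow> real) \<Rightarrow> real" where
  "R_stat n m h \<omega> = (\<Sum>k<n. h k (\<lambda>i\<in>{..<m}. real n * spacing n \<omega> (k + i)))"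

section \<open>Exponential variables\<close>

definition exp_sample :: "nat \<Rightarrow> (nat \<Rightarrow> real) measure" where
  "exp_sample n = PiM {..<n} (\<lambda>_. density lborel (exponential_density 1))"

definition wrap :: "nat \<Rightarrow> int \<Rightarrow> nat" where
  "wrap n j = nat (j mod int n)"

definition X_block :: "nat \<Rightarrow> nat \<Rightarrow> int \<Rightarrow> (nat \<Rightarrow> real) \<Rightarrow> (nat \<Rightarrow> real)" where
  "X_block n m k x = (\<lambda>i\<in>{..<m}. x (wrap n (k + int i)))"

definition X_sum :: "nat \<Rightarrow> nat \<Rightarrow> int \<Rightarrow> (nat \<Rightarrow> real) \<Rightarrow> real" where
  "X_sum n m k x = (\<Sum>i<m. X_block n m k x i)"

definition h_exp ::
  "nat \<Rightarrow> nat \<Rightarrow> (nat \<Rightarrow> (nat \<Rightarrow> real) \<Rightarrow> real) \<Rightarrow> int \<Rightarrow> (nat \<Rightarrow> real) \<Rightarrow> real" where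
  "h_exp n m h k x = h (wrap n k) (X_block n m k x)"

definition covar :: "'a measure \<Rightarrow> ('a \<Rightarrow> real) \<Rightarrow> ('a \<Rightarrow> real) \<Rightarrow> real" where
  "covar M Y Z =
     (\<integral>x. (Y x - prob_space.expectation M Y) * (Z x - prob_space.expectation M Z) \<partial>M)"

definition C_stat :: "nat \<Rightarrow> nat \<Rightarrow> (nat \<Rightarrow> (nat \<Rightarrow> real) \<Rightarrow> real) \<Rightarrow> real" where
  "C_stat n m h = (1 / real n) * (\<Sum>k<n. \<Sum>j\<in>{int k - int m + 1..int k + int m - 1}.
     covar (exp_sample n) (h_exp n m h (int k)) (h_exp n m h j))"

definition B_stat :: "nat \<Rightarrow> nat \<Rightarrow> (nat \<Rightarrow> (nat \<Rightarrow> real) \<Rightarrow> real) \<Rightarrow> real" where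
  "B_stat n m h = (1 / real n) * (\<Sum>k<n.
     covar (exp_sample n) (h_exp n m h (int k)) (X_sum n m (int k)))"

definition sigma_sq :: "nat \<Rightarrow> nat \<Rightarrow> (nat \<Rightarrow> (nat \<Rightarrow> real) \<Rightarrow> real) \<Rightarrow> real" where
  "sigma_sq n m h = real n * (C_stat n m h - (B_stat n m h)\<^sup>2)"

text \<open>\<open>abs_mom3 n m h k\<close> is the third absolute moment of the centred variable
  \<open>h\<^sub>k(X\<^sub>k\<^sup>m) - E h\<^sub>k(X\<^sub>k\<^sup>m)\<close>.\<close>

definition abs_mom3 :: "nat \<Rightarrow> nat \<Rightarrow> (nat \<Rightarrow> (nat \<Rightarrow> real) \<Rightarrow> real) \<Rightarrow> int \<Rightarrow> real" where
  "abs_mom3 n m h k = prob_space.expectation (exp_sample n)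
     (\<lambda>x. \<bar>h_exp n m h k x - prob_space.expectation (exp_sample n) (h_exp n m h k)\<bar> ^ 3)"

end

theory Submission
  imports Defs
begin

text \<open>If \<open>I\<close> is a set of \<open>l < n\<close> indices, then the joint law of the scaled spacings \<open>n S\<^sub>i\<close>, \<open>i \<in> I\<close>, has
  a density \<open>\<rho>\<close> with respect to independent standard exponential variables, and \<open>\<rho>\<close> depends only on their
  sum \<open>s\<close>. With \<open>t = s - l\<close> and \<open>u = (l + t\<^sup>2) / n\<close> one has \<open>\<rho> = 1 + O(u)\<close>, and more precisely
  \<open>\<rho> = a + b t - t\<^sup>2 / (2 n) + O(u\<^sup>2)\<close>; both errors are controlled in \<open>L\<^sup>3\<close> by the moments of \<open>t\<close>.

  For centred \<open>h\<^sub>k\<close> and overlapping blocks the first expansion replaces \<open>E h\<^sub>k h\<^sub>j\<close> over the spacings by the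
  covariance over the exponentials. For disjoint blocks \<open>t = t\<^sub>k + t\<^sub>j\<close> splits, and by independence every term
  of the second expansion vanishes except the cross term \<open>- t\<^sub>k t\<^sub>j / n\<close> of \<open>- t\<^sup>2 / (2 n)\<close>. It contributes
  \<open>- cov(h\<^sub>k, |X\<^sub>k|) cov(h\<^sub>j, |X\<^sub>j|) / n\<close>, and these contributions sum up to \<open>- n B\<^sup>2\<close>. All errors are bounded
  by Hoelder's inequality with three exponents \<open>3\<close>.\<close>

section \<open>The law of the spacings\<close>

text \<open>The full vector of scaled spacings has the fixed sum \<open>n\<close>, so its law is
  singular to that of the exponentials and no change of measure applies to the statistic as a whole.
  Its variance, however, only involves pairs of blocks, hence at most \<open>2 m\<close> coordinates
  at a time. The growth condition enters as \<open>2000000 * kappa * m <= n\<close>, which keeps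
  such a pair a small proportion of all coordinates.

  The normalising factor of the density is not computed by Stirling's formula: the shape
  \<open>gap_profile\<close> is expanded, and since the density integrates to 1, the factor is the
  reciprocal of an expectation close to 1.

  Two contributions come on top of the errors for pairs. \<open>n B^2\<close> is a sum over all
  pairs of blocks, so the overlapping ones receive a product of covariances that must be counted as
  error. Moreover the centring is done under the exponentials, and the mean that remains under the
  spacings enters the variance as a square.

  The moments of \<open>t\<close> are uniform in \<open>l\<close> after dividing \<open>t^2\<close>
  by \<open>l\<close>; the square of this ratio in \<open>L^3\<close> leads to moments of order 12.
  The second error term comes out with \<open>(m / n)^2\<close>, stronger than the claimed exponent
  3/2.\<close>

text \<open>Each entry of the longer list is a min/max expression in the new element and two
  adjacent old entries; this form turns measurability of order statistics into an induction over the
  sample.\<close>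

lemma nth_insort:
  fixes y :: "'a::linorder"
  assumes "sorted zs" "k \<le> length zs"
  shows "insort y zs ! k =
    (if k < length zs then (if k = 0 then min y (zs ! 0) else max (zs ! (k - 1)) (min y (zs ! k)))
     else if k = 0 then y else max (zs ! (k - 1)) y)"
  using assms
proof (induction zs arbitrary: k)
  case (Cons z zs)
  show ?case
  proof (cases k)
    case 0
    then show ?thesis by (auto simp: min_def)
  next
    case (Suc j)
    have z: "\<And>i. i < length zs \<Longrightarrow> z \<le> zs ! i"
      using Cons.prems(1) by auto
    show ?thesis
    proof (cases "y \<le> z")
      case True
      have "j < length zs \<Longrightarrow> (z # zs) ! j \<le> zs ! j"
        using sorted_nth_mono[OF Cons.prems(1), of j "Suc j"] by simp
      moreover have "y \<le> (z # zs) ! j" if "j < Suc (length zs)"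
        using True z[of "j - 1"] that by (cases j) auto
      ultimately show ?thesis
        using True Suc Cons.prems by (auto simp: min_def max_def)
    next
      case False
      have "insort y zs ! j = 
        (if j < length zs then (if j = 0 then min y (zs ! 0) else max (zs ! (j - 1)) (min y (zs ! j)))
         else if j = 0 then y else max (zs ! (j - 1)) y)"
        using Cons.IH[of j] Cons.prems Suc by auto
      then show ?thesis
        using False Suc z[of 0] by (cases j) (auto simp: min_def max_def)
    qed
  qed
qed simp

lemma borel_measurable_sort_nth:
  fixes X :: "'i \<Rightarrow> 'a \<Rightarrow> real"
  assumes "\<And>i. i \<in> set xs \<Longrightarrow> X i \<in> borel_measurable M" "k < length xs"
  shows "(\<lambda>\<omega>. sort (map (\<lambda>i. X i \<omega>) xs) ! k) \<in> borel_measurable M"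
  using assms
proof (induction xs arbitrary: k)
  case (Cons x xs)
  have [measurable]: "X x \<in> borel_measurable M" 
    "\<And>j. j < length xs \<Longrightarrow> (\<lambda>\<omega>. sort (map (\<lambda>i. X i \<omega>) xs) ! j) \<in> borel_measurable M"
    using Cons by auto
  have "k \<le> length xs" using Cons.prems by simp
  then show ?case
    by (cases "k < length xs"; cases "k = 0") (simp_all add: nth_insort, measurable)
qed simp

text \<open>By uniqueness of product measures, comparing rectangles is enough. Both samples are
  carried to Lebesgue measure in this way, where linear substitutions are available.\<close>

lemma PiM_density_lborel:
  fixes I :: "'i set" and f :: "real \<Rightarrow> ennreal"
  assumes "finite I" and [measurable]: "f \<in> borel_measurable borel"
    and "prob_space (density lborel f)"
  shows "PiM I (\<lambda>_. density lborel f) = density (PiM I (\<lambda>_. lborel)) (\<lambda>x. \<Prod>i\<in>I. f (x i))"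
proof -
  interpret prob_space "density lborel f" by fact
  interpret D: product_sigma_finite "\<lambda>_. density lborel f"
    by standard
  interpret L: product_sigma_finite "\<lambda>_. lborel :: real measure"
    by standard
  show ?thesis
  proof (rule D.PiM_eqI[symmetric])
    show "finite I" by fact
    show "sets (density (Pi\<^sub>M I (\<lambda>_. lborel)) (\<lambda>x. \<Prod>i\<in>I. f (x i))) = sets (Pi\<^sub>M I (\<lambda>_. density lborel f))"
      unfolding sets_density by (rule sets_PiM_cong) auto
    fix A assume A: "\<And>i. i \<in> I \<Longrightarrow> A i \<in> sets (density lborel f)"
    then have [measurable]: "\<And>i. i \<in> I \<Longrightarrow> A i \<in> sets borel" by simp
    have "emeasure (density (Pi\<^sub>M I (\<lambda>_. lborel)) (\<lambda>x. \<Prod>i\<in>I. f (x i))) (Pi\<^sub>E I A)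
       = (\<integral>\<^sup>+x. (\<Prod>i\<in>I. f (x i)) * indicator (Pi\<^sub>E I A) x \<partial>Pi\<^sub>M I (\<lambda>_. lborel))"
      using \<open>finite I\<close> by (intro emeasure_density) (auto intro!: sets_PiM_I_finite)
    also have "\<dots> = (\<integral>\<^sup>+x. (\<Prod>i\<in>I. f (x i) * indicator (A i) (x i)) \<partial>Pi\<^sub>M I (\<lambda>_. lborel))"
    proof (rule nn_integral_cong)
      fix x :: "'i \<Rightarrow> real" assume "x \<in> space (Pi\<^sub>M I (\<lambda>_. lborel))"
      then have "indicator (Pi\<^sub>E I A) x = (\<Prod>i\<in>I. indicator (A i) (x i) :: ennreal)"
        using \<open>finite I\<close> by (auto simp: indicator_def space_PiM PiE_def Pi_def)
      then show "(\<Prod>i\<in>I. f (x i)) * indicator (Pi\<^sub>E I A) x = (\<Prod>i\<in>I. f (x i) * indicator (A i) (x i))"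
        by (simp add: prod.distrib)
    qed
    also have "\<dots> = (\<Prod>i\<in>I. \<integral>\<^sup>+y. f y * indicator (A i) y \<partial>lborel)"
      using \<open>finite I\<close> by (intro L.product_nn_integral_prod) auto
    also have "\<dots> = (\<Prod>i\<in>I. emeasure (density lborel f) (A i))"
      by (intro prod.cong refl) (subst emeasure_density, auto)
    finally show "emeasure (density (Pi\<^sub>M I (\<lambda>_. lborel)) (\<lambda>x. \<Prod>i\<in>I. f (x i))) (Pi\<^sub>E I A) = 
        (\<Prod>i\<in>I. emeasure (density lborel f) (A i))" .
  qed
qed

section \<open>Linear substitutions for Lebesgue integrals\<close>

interpretation lborels: product_sigma_finite "\<lambda>_. lborel :: real measure"
  by standard

text \<open>The map from increments to partial sums is triangular with determinant
  \<open>c ^ N\<close>. Induction on \<open>N\<close> replaces the Jacobian: the last variable is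
  substituted affinely and contributes one factor \<open>c\<close>.\<close>

lemma nn_integral_PiM_partial_sums:
  fixes F :: "(nat \<Rightarrow> real) \<Rightarrow> ennreal"
  assumes "c > 0" "F \<in> borel_measurable (PiM {1..<Suc N} (\<lambda>_. lborel))"
  shows "(\<integral>\<^sup>+u. F u \<partial>PiM {1..<Suc N} (\<lambda>_. lborel)) =
    ennreal c ^ N * (\<integral>\<^sup>+x. F (\<lambda>k\<in>{1..<Suc N}. c * (\<Sum>i<k. x i)) \<partial>PiM {..<N} (\<lambda>_. lborel))"
  using assms(2)
proof (induction N arbitrary: F)
  case 0
  then show ?case by (simp add: lborels.nn_integral_empty restrict_def PiM_empty nn_integral_count_space_finite)
next
  case (Suc N)
  let ?L = "\<lambda>_::nat. lborel :: real measure"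
  have ins: "insert (Suc N) {1..<Suc N} = {1..<Suc (Suc N)}" "insert N {..<N} = {..<Suc N}"
    by auto
  have F[measurable]: "F \<in> borel_measurable (PiM (insert (Suc N) {1..<Suc N}) ?L)"
    using Suc.prems by (simp only: ins)
  define F' where "F' = (\<lambda>u. \<integral>\<^sup>+y. F (u(Suc N := y)) \<partial>lborel)"
  have [measurable]: "F' \<in> borel_measurable (PiM {1..<Suc N} ?L)"
    unfolding F'_def by measurable
  have "(\<integral>\<^sup>+u. F u \<partial>PiM {1..<Suc (Suc N)} ?L) = (\<integral>\<^sup>+u. F' u \<partial>PiM {1..<Suc N} ?L)"
    unfolding F'_def ins(1)[symmetric] by (rule lborels.product_nn_integral_insert) (simp_all del: One_nat_def)
  also have "\<dots> = ennreal c ^ N * (\<integral>\<^sup>+x. F' (\<lambda>k\<in>{1..<Suc N}. c * (\<Sum>i<k. x i)) \<partial>PiM {..<N} ?L)"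
    by (rule Suc.IH) measurable
  also have "(\<integral>\<^sup>+x. F' (\<lambda>k\<in>{1..<Suc N}. c * (\<Sum>i<k. x i)) \<partial>PiM {..<N} ?L)
     = (\<integral>\<^sup>+x. c * (\<integral>\<^sup>+z. F (\<lambda>k\<in>{1..<Suc (Suc N)}. c * (\<Sum>i<k. (x(N := z)) i)) \<partial>lborel) \<partial>PiM {..<N} ?L)"
  proof (rule nn_integral_cong)
    fix x :: "nat \<Rightarrow> real"
    let ?u = "\<lambda>k\<in>{1..<Suc N}. c * (\<Sum>i<k. x i)"
    have u: "?u \<in> space (PiM {1..<Suc N} ?L)" by (auto simp: space_PiM)
    have m: "(\<lambda>y. F (?u(Suc N := y))) \<in> borel_measurable borel"
      using measurable_compose[OF measurable_component_update[OF u] F] by simp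
    \<comment> \<open>With the earlier coordinates fixed, the last one is written as
      \<open>c\<close> times the previous partial sum plus \<open>c * z\<close>.\<close>
    have "F' ?u = \<bar>c\<bar> * (\<integral>\<^sup>+z. F (?u(Suc N := c * (\<Sum>i<N. x i) + c * z)) \<partial>lborel)"
      unfolding F'_def using \<open>c > 0\<close> by (intro nn_integral_real_affine m) simp
    also have "(\<lambda>z. ?u(Suc N := c * (\<Sum>i<N. x i) + c * z)) = 
        (\<lambda>z. \<lambda>k\<in>{1..<Suc (Suc N)}. c * (\<Sum>i<k. (x(N := z)) i))"
      by (auto simp: fun_eq_iff restrict_def algebra_simps intro!: sum.cong)
    finally show "F' ?u = c * (\<integral>\<^sup>+z. F (\<lambda>k\<in>{1..<Suc (Suc N)}. c * (\<Sum>i<k. (x(N := z)) i)) \<partial>lborel)"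
      using \<open>c > 0\<close> by (metis abs_of_pos)
  qed
  also have "\<dots> = c * (\<integral>\<^sup>+x. (\<integral>\<^sup>+z. F (\<lambda>k\<in>{1..<Suc (Suc N)}. c * (\<Sum>i<k. (x(N := z)) i)) \<partial>lborel) \<partial>PiM {..<N} ?L)"
  proof (rule nn_integral_cmult)
    have "(\<lambda>x. F (\<lambda>k\<in>insert (Suc N) {1..<Suc N}. c * (\<Sum>i<k. x i))) \<in> borel_measurable (PiM (insert N {..<N}) ?L)"
      by (measurable, auto)
    then show "(\<lambda>x. \<integral>\<^sup>+z. F (\<lambda>k\<in>{1..<Suc (Suc N)}. c * (\<Sum>i<k. (x(N := z)) i)) \<partial>lborel)
        \<in> borel_measurable (PiM {..<N} ?L)"
      unfolding ins(1) by measurable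
  qed
  also have "(\<integral>\<^sup>+x. (\<integral>\<^sup>+z. F (\<lambda>k\<in>{1..<Suc (Suc N)}. c * (\<Sum>i<k. (x(N := z)) i)) \<partial>lborel) \<partial>PiM {..<N} ?L)
     = (\<integral>\<^sup>+x. F (\<lambda>k\<in>{1..<Suc (Suc N)}. c * (\<Sum>i<k. x i)) \<partial>PiM {..<Suc N} ?L)"
    unfolding ins(2)[symmetric] unfolding ins(1)[symmetric]
    by (rule lborels.product_nn_integral_insert[symmetric]) (simp, simp, measurable, auto)
  finally show ?case
    by (simp only: power_Suc ac_simps)
qed

text \<open>A cyclic block may contain the last spacing; this lets a coordinate outside the block be the one that
  is determined by the others.\<close>

lemma nn_integral_PiM_dependent_coordinate:
  fixes G :: "('i \<Rightarrow> real) \<Rightarrow> ennreal"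
  assumes "finite K" "i0 \<in> K" "i1 \<in> K"
    and G[measurable]: "G \<in> borel_measurable (PiM K (\<lambda>_. lborel))"
  shows "(\<integral>\<^sup>+x. G (x(i0 := a - sum x (K - {i0}))) \<partial>PiM (K - {i0}) (\<lambda>_. lborel)) =
         (\<integral>\<^sup>+x. G (x(i1 := a - sum x (K - {i1}))) \<partial>PiM (K - {i1}) (\<lambda>_. lborel))"
proof (cases "i0 = i1")
  case False
  define J where "J = K - {i0, i1}"
  let ?L = "\<lambda>_::'i. lborel :: real measure"
  have K: "K - {i0} = insert i1 J" "K - {i1} = insert i0 J" "insert i0 (insert i1 J) = K"
    "insert i1 (insert i0 J) = K"
    and J: "finite J" "i0 \<notin> J" "i1 \<notin> J"
    using assms False by (auto simp: J_def)
  have G0[measurable]: "G \<in> borel_measurable (PiM (insert i0 (insert i1 J)) (\<lambda>_. lborel))"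
    using G K by simp
  have G1[measurable]: "G \<in> borel_measurable (PiM (insert i1 (insert i0 J)) (\<lambda>_. lborel))"
    using G K by simp
  have s: "sum (x(i := y)) (insert i J) = y + sum x J" if "i \<notin> J" for x y i
  proof -
    have "sum (x(i := y)) J = sum x J"
      using that by (intro sum.cong) auto
    then show ?thesis
      using that J by (simp del: fun_upd_apply add: fun_upd_same)
  qed
  have "(\<integral>\<^sup>+x. G (x(i0 := a - sum x (insert i1 J))) \<partial>PiM (insert i1 J) ?L) =
     (\<integral>\<^sup>+x. \<integral>\<^sup>+y. G ((x(i1 := y))(i0 := a - sum (x(i1 := y)) (insert i1 J))) \<partial>lborel \<partial>PiM J ?L)"
    using J by (intro lborels.product_nn_integral_insert) auto
  also have "\<dots> = (\<integral>\<^sup>+x. \<integral>\<^sup>+y. G ((x(i1 := y))(i0 := a - (y + sum x J))) \<partial>lborel \<partial>PiM J ?L)"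
    by (simp only: s[OF J(3)])
  also have "\<dots> = (\<integral>\<^sup>+x. \<integral>\<^sup>+y. G ((x(i0 := y))(i1 := a - (y + sum x J))) \<partial>lborel \<partial>PiM J ?L)"
  \<comment> \<open>On each fibre the reflection of \<open>y\<close> to
    \<open>a - sum x J - y\<close> preserves Lebesgue measure and interchanges the free and the
    determined coordinate.\<close>
  proof (rule nn_integral_cong)
    fix x assume x[measurable]: "x \<in> space (PiM J ?L)"
    have x1: "(\<lambda>y. x(i1 := y)) \<in> measurable lborel (PiM (insert i1 J) ?L)"
      using J x by simp
    have [measurable]: "(\<lambda>y. G ((x(i1 := y))(i0 := a - (y + sum x J)))) \<in> borel_measurable borel"
      using x1 by measurable
    have "(\<integral>\<^sup>+y. G ((x(i1 := y))(i0 := a - (y + sum x J))) \<partial>lborel) = 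
       ennreal \<bar>-1\<bar> * (\<integral>\<^sup>+y. G ((x(i1 := (a - sum x J) + (-1) * y))(i0 := a - (((a - sum x J) + (-1) * y) + sum x J))) \<partial>lborel)"
      by (intro nn_integral_real_affine) auto
    also have "\<dots> = (\<integral>\<^sup>+y. G ((x(i0 := y))(i1 := a - (y + sum x J))) \<partial>lborel)"
      using False by (simp add: fun_upd_twist algebra_simps)
    finally show "(\<integral>\<^sup>+y. G ((x(i1 := y))(i0 := a - (y + sum x J))) \<partial>lborel) = 
       (\<integral>\<^sup>+y. G ((x(i0 := y))(i1 := a - (y + sum x J))) \<partial>lborel)" .
  qed
  also have "\<dots> = (\<integral>\<^sup>+x. \<integral>\<^sup>+y. G ((x(i0 := y))(i1 := a - sum (x(i0 := y)) (insert i0 J))) \<partial>lborel \<partial>PiM J ?L)"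
    by (simp only: s[OF J(2)])
  also have "\<dots> = (\<integral>\<^sup>+x. G (x(i1 := a - sum x (insert i0 J))) \<partial>PiM (insert i0 J) ?L)"
    using J by (intro lborels.product_nn_integral_insert[symmetric]) auto
  finally show ?thesis by (simp only: K)
qed simp

section \<open>Order statistics by symmetrisation over permutations\<close>

lemma AE_PiM_lborel_neq:
  fixes A :: "'i set"
  assumes "finite A" "i \<in> A" "j \<in> A" "i \<noteq> j"
  shows "AE x in PiM A (\<lambda>_. lborel :: real measure). x i \<noteq> x j"
proof -
  let ?L = "\<lambda>_::'i. lborel :: real measure"
  define B where "B = A - {i}"
  have B: "A = insert i B" "finite B" "i \<notin> B" "j \<in> B"
    using assms by (auto simp: B_def)
  have [measurable]: "(\<lambda>x. x i) \<in> borel_measurable (PiM A ?L)" "(\<lambda>x. x j) \<in> borel_measurable (PiM A ?L)"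
    using assms by auto
  have meas: "{x \<in> space (PiM A ?L). x i = x j} \<in> sets (PiM A ?L)"
    by measurable
  have "emeasure (PiM A ?L) {x \<in> space (PiM A ?L). x i = x j} = 
    (\<integral>\<^sup>+x. indicator {x \<in> space (PiM A ?L). x i = x j} x \<partial>PiM A ?L)"
    using meas by simp
  also have "\<dots> = (\<integral>\<^sup>+x. \<integral>\<^sup>+y. indicator {x \<in> space (PiM A ?L). x i = x j} (x(i := y)) \<partial>lborel \<partial>PiM B ?L)"
    unfolding B(1) using meas B by (intro lborels.product_nn_integral_insert) auto
  also have "\<dots> = (\<integral>\<^sup>+x. \<integral>\<^sup>+y. indicator {x j} y \<partial>lborel \<partial>PiM B ?L)"
    using B by (intro nn_integral_cong) (auto simp: indicator_def space_PiM PiE_def extensional_def)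
  also have "\<dots> = 0"
    by simp
  finally show ?thesis
    using meas by (subst AE_iff_measurable[of "{x \<in> space (PiM A ?L). x i = x j}"]) auto
qed

text \<open>Without ties exactly one permutation sorts the sample, so a single summand survives. The
  shift \<open>k - 1\<close> is due to list positions starting at 0 and order statistics at
  1.\<close>

lemma sum_permutations_sorted:
  fixes x :: "nat \<Rightarrow> real" and F :: "(nat \<Rightarrow> real) \<Rightarrow> ennreal"
  assumes inj: "inj_on x {1..<Suc N}"
  shows "(\<Sum>p | p permutes {1..<Suc N}. F (\<lambda>k\<in>{1..<Suc N}. x (p k)) *
            of_bool (\<forall>i\<in>{1..<Suc N}. \<forall>j\<in>{1..<Suc N}. i \<le> j \<longrightarrow> x (p i) \<le> x (p j)))
       = F (\<lambda>k\<in>{1..<Suc N}. sort (map x [1..<Suc N]) ! (k - 1))"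
proof -
  define A where "A = {1..<Suc N}"
  have finite_A: "finite A" by (simp add: A_def)
  define xs where "xs = [1..<Suc N]"
  define L where "L = sort (map x xs)"
  have xs: "set xs = A" "distinct xs" "length xs = N" "\<And>k. k < N \<Longrightarrow> xs ! k = Suc k"
    by (auto simp: xs_def A_def simp del: upt_Suc)
  have inj: "inj_on x A" using inj by (simp add: A_def)
  have L: "set L = x ` A" "distinct L" "sorted L" "length L = N"
    using xs inj by (auto simp: L_def distinct_map)
  \<comment> \<open>\<open>g k\<close> is the index at which the sample takes its
    \<open>k\<close>-th smallest value; extended by the identity it becomes the sorting permutation
    \<open>q\<close>.\<close>
  define g where "g k = inv_into A x (L ! (k - 1))" for k
  have LA: "L ! (k - 1) \<in> x ` A" if "k \<in> A" for k
  proof -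
    have "k - 1 < length L" using that L(4) by (auto simp: A_def)
    then show ?thesis using L(1) nth_mem by blast
  qed
  have xg: "x (g k) = L ! (k - 1)" "g k \<in> A" if "k \<in> A" for k
    using LA[OF that] by (auto simp: g_def f_inv_into_f inv_into_into)
  have "inj_on g A"
  proof (rule inj_onI)
    fix k k' assume k: "k \<in> A" "k' \<in> A" "g k = g k'"
    then have "L ! (k - 1) = L ! (k' - 1)" using xg by metis
    then show "k = k'"
      using L k by (subst (asm) nth_eq_iff_index_eq) (auto simp: A_def)
  qed
  then have bij: "bij_betw g A A"
    using xg(2) endo_inj_surj[of A g] by (auto simp: bij_betw_def finite_A)
  define q where "q k = (if k \<in> A then g k else k)" for k
  have q: "q permutes A"
    using bij bij_betw_cong[of A q g A] by (intro bij_imp_permutes) (auto simp: q_def)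
  \<comment> \<open>A sorted rearrangement has the multiset of the sample and hence equals its
    sorted list, so all sorting permutations lead to the same values.\<close>
  have key: "x (p k) = L ! (k - 1)" 
    if p: "p permutes A" "\<forall>i\<in>A. \<forall>j\<in>A. i \<le> j \<longrightarrow> x (p i) \<le> x (p j)" and k: "k \<in> A" for p k
  proof -
    have "mset (map p xs) = mset xs"
      using permutes_inj_on[OF p(1)] permutes_image[OF p(1)]
      by (simp add: image_mset_mset_set flip: mset_set_set[OF xs(2), unfolded xs(1)])
    moreover have "mset (map (\<lambda>k. x (p k)) xs) = image_mset x (mset (map p xs))"
      by (simp add: image_mset.compositionality comp_def)
    ultimately have "mset (map (\<lambda>k. x (p k)) xs) = mset (map x xs)"
      by (simp only: mset_map)
    moreover have "sorted (map (\<lambda>k. x (p k)) xs)"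
      using p(2) xs(3,4) by (simp add: sorted_iff_nth_mono A_def)
    ultimately have "L = map (\<lambda>k. x (p k)) xs"
      unfolding L_def by (intro properties_for_sort) auto
    then show ?thesis
      using k xs(3,4) by (auto simp: A_def)
  qed
  have mono_q: "\<forall>i\<in>A. \<forall>j\<in>A. i \<le> j \<longrightarrow> x (q i) \<le> x (q j)"
  proof (intro ballI impI)
    fix i j assume ij: "i \<in> A" "j \<in> A" "i \<le> j"
    then have "L ! (i - 1) \<le> L ! (j - 1)"
      using L(3,4) by (intro sorted_nth_mono) (auto simp: A_def)
    then show "x (q i) \<le> x (q j)"
      using ij xg(1) by (simp only: q_def if_True)
  qed
  have uniq: "p = q" if p: "p permutes A" "\<forall>i\<in>A. \<forall>j\<in>A. i \<le> j \<longrightarrow> x (p i) \<le> x (p j)" for p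
  proof
    fix k show "p k = q k"
    proof (cases "k \<in> A")
      case True
      then have "x (p k) = x (q k)" using key[OF p True] key[OF q mono_q True] by simp
      then show ?thesis
        using True inj p(1) q by (meson inj_onD permutes_in_image)
    next
      case False
      then show ?thesis using p(1) q by (metis permutes_not_in)
    qed
  qed
  have "(\<Sum>p | p permutes A. F (\<lambda>k\<in>A. x (p k)) * 
            of_bool (\<forall>i\<in>A. \<forall>j\<in>A. i \<le> j \<longrightarrow> x (p i) \<le> x (p j)))
      = (\<Sum>p | p permutes A. if p = q then F (\<lambda>k\<in>A. L ! (k - 1)) else 0)"
  proof (intro sum.cong refl)
    fix p assume "p \<in> {p. p permutes A}"
    then have p: "p permutes A" by simp
    show "F (\<lambda>k\<in>A. x (p k)) * of_bool (\<forall>i\<in>A. \<forall>j\<in>A. i \<le> j \<longrightarrow> x (p i) \<le> x (p j))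
       = (if p = q then F (\<lambda>k\<in>A. L ! (k - 1)) else 0)"
    proof (cases "\<forall>i\<in>A. \<forall>j\<in>A. i \<le> j \<longrightarrow> x (p i) \<le> x (p j)")
      case True
      then have "(\<lambda>k\<in>A. x (p k)) = (\<lambda>k\<in>A. L ! (k - 1))"
        using key[OF p True] by (intro restrict_ext)
      with True uniq[OF p True] show ?thesis by simp
    next
      case False
      then have "p \<noteq> q" using mono_q by blast
      with False show ?thesis by (simp only: of_bool_eq mult_zero_right if_False)
    qed
  qed
  also have "\<dots> = F (\<lambda>k\<in>A. L ! (k - 1))"
    using q by (simp add: A_def finite_permutations)
  finally show ?thesis
    by (simp only: A_def L_def xs_def)
qed

text \<open>Off the ties the left integrand is a sum over all permutations of one function supported
  on the sorted region. The product law is invariant under each permutation, which gives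
  \<open>N!\<close> equal integrals.\<close>

lemma nn_integral_order_statistics:
  fixes f :: "real \<Rightarrow> ennreal" and F :: "(nat \<Rightarrow> real) \<Rightarrow> ennreal"
  defines "A \<equiv> \<lambda>N. {1..<Suc N}"
  assumes f[measurable]: "f \<in> borel_measurable borel" and prob: "prob_space (density lborel f)"
    and F: "F \<in> borel_measurable (PiM (A N) (\<lambda>_. borel))"
  shows "(\<integral>\<^sup>+x. F (\<lambda>k\<in>A N. sort (map x [1..<Suc N]) ! (k - 1)) \<partial>PiM (A N) (\<lambda>_. density lborel f)) =
     fact N * (\<integral>\<^sup>+x. F x * of_bool (\<forall>i\<in>A N. \<forall>j\<in>A N. i \<le> j \<longrightarrow> x i \<le> x j) \<partial>PiM (A N) (\<lambda>_. density lborel f))"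
proof -
  define B where "B = A N"
  let ?M = "PiM B (\<lambda>_. density lborel f)"
  have B: "finite B" "card B = N" by (auto simp: B_def A_def)
  interpret prob_space "density lborel f" by fact
  have F[measurable]: "F \<in> borel_measurable ?M"
    using F by (simp add: B_def cong: measurable_cong_sets sets_PiM_cong)
  define T where "T x = F x * of_bool (\<forall>i\<in>B. \<forall>j\<in>B. i \<le> j \<longrightarrow> x i \<le> x j)" for x
  have P: "Measurable.pred ?M (\<lambda>x. \<forall>i\<in>B. \<forall>j\<in>B. i \<le> j \<longrightarrow> x i \<le> x j)"
  proof (intro pred_intros_finite pred_intros_imp' B)
    fix i j assume "i \<in> B" "j \<in> B"
    then have xij: "(\<lambda>x. x i) \<in> borel_measurable ?M" "(\<lambda>x. x j) \<in> borel_measurable ?M"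
      using measurable_component_singleton[of _ B "\<lambda>_. density lborel f"] by auto
    show "Measurable.pred ?M (\<lambda>x. x i \<le> x j)"
      unfolding pred_def by (rule borel_measurable_le[OF xij])
  qed
  have T[measurable]: "T \<in> borel_measurable ?M"
    unfolding T_def
    by (intro borel_measurable_times_ennreal F measurable_compose[OF P, of of_bool]) simp
  \<comment> \<open>Ties are null for Lebesgue measure, hence also for any product density.\<close>
  have "AE x in PiM B (\<lambda>_. lborel). \<forall>i\<in>B. \<forall>j\<in>B. i \<noteq> j \<longrightarrow> (x i :: real) \<noteq> x j"
    using B AE_PiM_lborel_neq[of B] by (intro AE_ball_countable[THEN iffD2] countable_finite ballI) auto
  then have inj: "AE x in ?M. inj_on x B"
    unfolding PiM_density_lborel[OF B(1) f prob] using B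
    by (subst AE_density) (auto simp: inj_on_def)
  have "(\<integral>\<^sup>+x. F (\<lambda>k\<in>B. sort (map x [1..<Suc N]) ! (k - 1)) \<partial>?M) = 
    (\<integral>\<^sup>+x. (\<Sum>p | p permutes B. T (\<lambda>k\<in>B. x (p k))) \<partial>?M)"
  proof (rule nn_integral_cong_AE)
    show "AE x in ?M. F (\<lambda>k\<in>B. sort (map x [1..<Suc N]) ! (k - 1)) = (\<Sum>p | p permutes B. T (\<lambda>k\<in>B. x (p k)))"
      using inj
    proof (rule eventually_mono)
      fix x :: "nat \<Rightarrow> real" assume "inj_on x B"
      then have "inj_on x {1..<Suc N}" by (simp only: B_def A_def)
      from sum_permutations_sorted[OF this, of F, symmetric]
      show "F (\<lambda>k\<in>B. sort (map x [1..<Suc N]) ! (k - 1)) = (\<Sum>p | p permutes B. T (\<lambda>k\<in>B. x (p k)))"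
        unfolding B_def A_def T_def
        by (simp del: upt_Suc One_nat_def add: permutes_in_image cong: sum.cong)
    qed
  qed
  also have "\<dots> = (\<Sum>p | p permutes B. \<integral>\<^sup>+x. T (\<lambda>k\<in>B. x (p k)) \<partial>?M)"
    by (intro nn_integral_sum measurable_compose[OF _ T] measurable_restrict)
       (auto simp: permutes_in_image)
  also have "\<dots> = (\<Sum>p | p permutes B. \<integral>\<^sup>+x. T x \<partial>?M)"
  proof (intro sum.cong refl)
    fix p assume "p \<in> {p. p permutes B}"
    then have p: "p permutes B" by simp
    have "distr ?M ?M (\<lambda>x. \<lambda>k\<in>B. x (p k)) = ?M"
      using p permutes_in_image[OF p] prob
      by (intro distr_PiM_reindex) (auto simp: permutes_inj_on)
    then have "(\<integral>\<^sup>+x. T x \<partial>?M) = (\<integral>\<^sup>+x. T x \<partial>distr ?M ?M (\<lambda>x. \<lambda>k\<in>B. x (p k)))"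
      by simp
    also have "\<dots> = (\<integral>\<^sup>+x. T (\<lambda>k\<in>B. x (p k)) \<partial>?M)"
      using permutes_in_image[OF p] by (intro nn_integral_distr T measurable_restrict) auto
    finally show "(\<integral>\<^sup>+x. T (\<lambda>k\<in>B. x (p k)) \<partial>?M) = (\<integral>\<^sup>+x. T x \<partial>?M)" ..
  qed
  also have "\<dots> = fact N * (\<integral>\<^sup>+x. T x \<partial>?M)"
    using card_permutations[OF B(2,1)] by simp
  finally show ?thesis
    by (simp add: T_def B_def)
qed

section \<open>The scaled spacings as a uniform point of a simplex\<close>

lemma uniform_measure_01_density: "uniform_measure lborel {0..1::real} = density lborel (indicator {0..1})"
  by (auto simp: uniform_measure_def indicator_def fun_eq_iff intro!: arg_cong[where f = "density lborel"])

lemma prob_space_uniform_01: "prob_space (uniform_measure lborel {0..1::real})"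
  by (intro prob_space_uniform_measure) auto

text \<open>\<open>N\<close> stands for \<open>n - 1\<close>. The argument \<open>v\<close> carries
  only the coordinates \<open>1, ..., N\<close>, so the boundary values \<open>U_0 = 0\<close> and
  \<open>U_n = 1\<close> are inserted by the two case distinctions.\<close>

definition scaled_gaps :: "nat \<Rightarrow> (nat \<Rightarrow> real) \<Rightarrow> nat \<Rightarrow> real" where
  "scaled_gaps N v = (\<lambda>i\<in>{..<Suc N}.
     real (Suc N) * ((if i = N then 1 else v (Suc i)) - (if i = 0 then 0 else v i)))"

lemma spacing_eq_scaled_gaps:
  "(\<lambda>i\<in>{..<Suc N}. real (Suc N) * spacing (Suc N) \<omega> i) =
     scaled_gaps N (\<lambda>k\<in>{1..<Suc N}. sort (map \<omega> [1..<Suc N]) ! (k - 1))"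
proof -
  have 1: "unif_order (Suc N) \<omega> k = (if k = 0 then 0 else sort (map \<omega> [1..<Suc N]) ! (k - 1))" if "k < Suc N" for k
    using that by (subst unif_order.simps) (auto simp: nth_Cons' simp del: upt_Suc)
  have 2: "unif_order (Suc N) \<omega> (Suc N) = 1"
    using 1[of 0] by (subst unif_order.simps) (simp del: upt_Suc)
  have 3: "unif_order (Suc N) \<omega> (Suc i) = sort (map \<omega> [1..<Suc N]) ! i" if "i < N" for i
    using 1[of "Suc i"] that by (simp del: upt_Suc)
  show ?thesis
  proof
    fix i
    show "(\<lambda>i\<in>{..<Suc N}. real (Suc N) * spacing (Suc N) \<omega> i) i =
      scaled_gaps N (\<lambda>k\<in>{1..<Suc N}. sort (map \<omega> [1..<Suc N]) ! (k - 1)) i"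
    proof (cases "i < Suc N")
      case True
      then have "i = N \<or> i < N" by auto
      with True show ?thesis
        using 1[of i] 2 3[of i]
        by (auto simp: scaled_gaps_def spacing_def simp del: upt_Suc of_nat_Suc)
    qed (simp add: scaled_gaps_def)
  qed
qed

lemma measurable_scaled_gaps [measurable]:
  "scaled_gaps N \<in> measurable (PiM {1..<Suc N} (\<lambda>_. borel)) (PiM {..<Suc N} (\<lambda>_. borel))"
  unfolding scaled_gaps_def
proof (intro measurable_restrict)
  fix i assume i: "i \<in> {..<Suc N}"
  let ?M = "PiM {1..<Suc N} (\<lambda>_. borel :: real measure)"
  have [measurable]: "(\<lambda>v. if i = N then 1 else v (Suc i)) \<in> borel_measurable ?M"
    "(\<lambda>v. if i = 0 then 0 else v i) \<in> borel_measurable ?M"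
    using i by (cases "i = N"; cases "i = 0"; force intro: measurable_component_singleton)+
  show "(\<lambda>v. real (Suc N) * ((if i = N then 1 else v (Suc i)) - (if i = 0 then 0 else v i))) \<in> borel_measurable ?M"
    by measurable
qed

lemma measurable_spacing:
  assumes n: "n > 0"
  shows "(\<lambda>\<omega>. \<lambda>i\<in>{..<n}. real n * spacing n \<omega> i) \<in> measurable (unif_sample n) (PiM {..<n} (\<lambda>_. borel))"
proof -
  obtain N where N: "n = Suc N" using n by (cases n) auto
  have "(\<lambda>\<omega>. \<lambda>k\<in>{1..<Suc N}. sort (map \<omega> [1..<Suc N]) ! (k - 1)) \<in> measurable (unif_sample n) (PiM {1..<Suc N} (\<lambda>_. borel))"
  proof (intro measurable_restrict borel_measurable_sort_nth)
    fix k i assume "i \<in> set [1..<Suc N]"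
    then have "i \<in> {1..<Suc N}" by auto
    from measurable_component_singleton[OF this, of "\<lambda>_. uniform_measure lborel {0..1::real}"]
    show "(\<lambda>\<omega>. \<omega> i) \<in> borel_measurable (unif_sample n)"
      unfolding unif_sample_def N
      by (simp only: measurable_cong_sets[OF refl sets_uniform_measure] measurable_lborel1)
  qed auto
  then show ?thesis
    unfolding N spacing_eq_scaled_gaps by (rule measurable_compose[OF _ measurable_scaled_gaps])
qed

text \<open>Inverse of the substitution by partial sums with \<open>c = 1 / n\<close>: the first
  \<open>N\<close> gaps are free and the last is what remains of the total \<open>n\<close>.\<close>

lemma scaled_gaps_partial_sums:
  assumes "x \<in> extensional {..<N}"
  shows "scaled_gaps N (\<lambda>k\<in>{1..<Suc N}. 1 / real (Suc N) * (\<Sum>i<k. x i)) = x(N := real (Suc N) - (\<Sum>i<N. x i))"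
proof
  fix i
  consider "i > N" | "i = N" | "i < N" by linarith
  then show "scaled_gaps N (\<lambda>k\<in>{1..<Suc N}. 1 / real (Suc N) * (\<Sum>i<k. x i)) i = (x(N := real (Suc N) - (\<Sum>i<N. x i))) i"
  proof cases
    case 1
    then show ?thesis using assms by (auto simp: scaled_gaps_def extensional_def)
  next
    case 2
    then show ?thesis by (cases "N = 0") (auto simp: scaled_gaps_def right_diff_distrib simp del: of_nat_Suc)
  next
    case 3
    then show ?thesis by (cases "i = 0") (auto simp: scaled_gaps_def right_diff_distrib distrib_left add_divide_distrib simp del: of_nat_Suc)
  qed
qed

text \<open>This is the domain of integration after the substitution: sorted points of the unit
  interval correspond to a simplex of increments.\<close>

lemma partial_sums_order_iff:
  fixes x :: "nat \<Rightarrow> real"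
  assumes c: "c > 0"
  shows "(\<forall>i\<in>{1..<Suc N}. \<forall>j\<in>{1..<Suc N}. i \<le> j \<longrightarrow> c * (\<Sum>l<i. x l) \<le> c * (\<Sum>l<j. x l)) \<and> 
         (\<forall>i\<in>{1..<Suc N}. c * (\<Sum>l<i. x l) \<in> {0..1}) \<longleftrightarrow>
         (\<forall>i<N. 0 \<le> x i) \<and> (\<Sum>l<N. x l) \<le> 1 / c"
    (is "?mono \<and> ?bnd \<longleftrightarrow> ?nonneg \<and> ?le")
proof (intro iffI conjI; (elim conjE)?)
  assume mono: ?mono and bnd: ?bnd
  show ?nonneg
  proof (intro allI impI)
    fix i assume i: "i < N"
    show "0 \<le> x i"
    proof (cases i)
      case 0
      then have "0 \<le> c * (\<Sum>l<Suc 0. x l)" using bspec[OF bnd, of "Suc 0"] i by auto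
      then show ?thesis using 0 c by (simp add: zero_le_mult_iff)
    next
      case (Suc j)
      then have "c * (\<Sum>l<i. x l) \<le> c * (\<Sum>l<Suc i. x l)"
        using mono i by (auto simp del: sum.lessThan_Suc)
      then show ?thesis using c by simp
    qed
  qed
  show ?le
  proof (cases "N = 0")
    case False
    then have "c * (\<Sum>l<N. x l) \<le> 1" using bnd by auto
    then show ?thesis using c by (simp add: field_simps)
  qed (use c in simp)
next
  assume nn: ?nonneg and le: ?le
  have mono: "(\<Sum>l<i. x l) \<le> (\<Sum>l<j. x l)" if "i \<le> j" "j \<le> N" for i j
    using nn that by (intro sum_mono2) auto
  show ?mono
    using mono c by auto
  show ?bnd
  proof
    fix i assume i: "i \<in> {1..<Suc N}"
    then have "(\<Sum>l<i. x l) \<le> 1 / c" using le mono[of i N] by auto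
    then have "c * (\<Sum>l<i. x l) \<le> 1" using c by (simp add: field_simps)
    moreover have "0 \<le> c * (\<Sum>l<i. x l)" using i mono[of 0 i] c by auto
    ultimately show "c * (\<Sum>l<i. x l) \<in> {0..1}" by simp
  qed
qed

lemma prod_indicator:
  "finite A \<Longrightarrow> (\<Prod>i\<in>A. indicator S (f i)) = (of_bool (\<forall>i\<in>A. f i \<in> S) :: 'a :: comm_semiring_1)"
  by (induction A rule: finite_induct) (auto simp: indicator_def)

text \<open>The only factors are \<open>N!\<close> from symmetrisation and \<open>n^(-N)\<close>
  from the substitution; the integrand is otherwise constant on the simplex of total
  \<open>n\<close>, so the scaled spacings are uniform there.\<close>

lemma nn_integral_spacings:
  fixes G :: "(nat \<Rightarrow> real) \<Rightarrow> ennreal"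
  assumes G: "G \<in> borel_measurable (PiM {..<Suc N} (\<lambda>_. borel))"
  shows "(\<integral>\<^sup>+\<omega>. G (\<lambda>i\<in>{..<Suc N}. real (Suc N) * spacing (Suc N) \<omega> i) \<partial>unif_sample (Suc N)) =
    fact N * ennreal (1 / real (Suc N)) ^ N * 
    (\<integral>\<^sup>+x. G (x(N := real (Suc N) - (\<Sum>i<N. x i))) * 
       of_bool (\<forall>i<Suc N. 0 \<le> (x(N := real (Suc N) - (\<Sum>i<N. x i))) i) \<partial>PiM {..<N} (\<lambda>_. lborel))"
proof -
  let ?A = "{1..<Suc N}" and ?c = "1 / real (Suc N)" and ?L = "\<lambda>_::nat. lborel :: real measure"
  define F where "F v = G (scaled_gaps N v)" for v
  have F[measurable]: "F \<in> borel_measurable (PiM ?A (\<lambda>_. borel))"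
    unfolding F_def by (rule measurable_compose[OF measurable_scaled_gaps G])
  then have F'[measurable]: "F \<in> borel_measurable (PiM ?A ?L)"
    by (simp cong: measurable_cong_sets sets_PiM_cong)
  define Q where "Q v \<longleftrightarrow> (\<forall>i\<in>?A. \<forall>j\<in>?A. i \<le> j \<longrightarrow> v i \<le> (v j :: real))" for v
  have Q: "Measurable.pred (PiM ?A ?L) Q"
    unfolding Q_def 
  proof (intro pred_intros_finite pred_intros_imp')
    fix i j assume ij: "i \<in> ?A" "j \<in> ?A"
    then have xij: "(\<lambda>x. x i) \<in> borel_measurable (PiM ?A ?L)" "(\<lambda>x. x j) \<in> borel_measurable (PiM ?A ?L)"
      by auto
    show "Measurable.pred (PiM ?A ?L) (\<lambda>x. x i \<le> x j)"
      unfolding pred_def by (rule borel_measurable_le[OF xij])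
  qed auto
  have Q': "(\<lambda>v. of_bool (Q v) :: ennreal) \<in> borel_measurable (PiM ?A ?L)"
    by (rule measurable_compose[OF Q, of of_bool]) simp
  have Icc01: "{0..1::real} \<in> sets borel" by simp
  have I: "(\<lambda>v. \<Prod>i\<in>?A. indicator {0..1} (v i) :: ennreal) \<in> borel_measurable (PiM ?A ?L)"
    by (intro borel_measurable_prod_ennreal) measurable
  have "(\<integral>\<^sup>+\<omega>. G (\<lambda>i\<in>{..<Suc N}. real (Suc N) * spacing (Suc N) \<omega> i) \<partial>unif_sample (Suc N)) =
      (\<integral>\<^sup>+\<omega>. F (\<lambda>k\<in>?A. sort (map \<omega> [1..<Suc N]) ! (k - 1)) \<partial>PiM ?A (\<lambda>_. density lborel (indicator {0..1})))"
    unfolding spacing_eq_scaled_gaps F_def unif_sample_def uniform_measure_01_density ..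
  also have "\<dots> = fact N * (\<integral>\<^sup>+v. F v * of_bool (Q v) \<partial>PiM ?A (\<lambda>_. density lborel (indicator {0..1})))"
    unfolding Q_def using prob_space_uniform_01 F
    by (intro nn_integral_order_statistics) (auto simp: uniform_measure_01_density)
  also have "(\<integral>\<^sup>+v. F v * of_bool (Q v) \<partial>PiM ?A (\<lambda>_. density lborel (indicator {0..1}))) = 
     (\<integral>\<^sup>+v. (\<Prod>i\<in>?A. indicator {0..1} (v i)) * (F v * of_bool (Q v)) \<partial>PiM ?A ?L)"
    unfolding PiM_density_lborel[OF finite_atLeastLessThan borel_measurable_indicator[OF Icc01]
        prob_space_uniform_01[unfolded uniform_measure_01_density]]
    by (intro nn_integral_density borel_measurable_times_ennreal F' Q' I)
  also have "\<dots> = ennreal ?c ^ N * (\<integral>\<^sup>+x. (\<lambda>v. (\<Prod>i\<in>?A. indicator {0..1} (v i)) * (F v * of_bool (Q v)))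
       (\<lambda>k\<in>?A. ?c * (\<Sum>i<k. x i)) \<partial>PiM {..<N} ?L)"
    by (intro nn_integral_PiM_partial_sums borel_measurable_times_ennreal F' Q' I) simp
  also have "(\<integral>\<^sup>+x. (\<lambda>v. (\<Prod>i\<in>?A. indicator {0..1} (v i)) * (F v * of_bool (Q v)))
       (\<lambda>k\<in>?A. ?c * (\<Sum>i<k. x i)) \<partial>PiM {..<N} ?L) = 
       (\<integral>\<^sup>+x. G (x(N := real (Suc N) - (\<Sum>i<N. x i))) * 
       of_bool (\<forall>i<Suc N. 0 \<le> (x(N := real (Suc N) - (\<Sum>i<N. x i))) i) \<partial>PiM {..<N} (\<lambda>_. lborel))"
  proof (rule nn_integral_cong)
    fix x assume "x \<in> space (PiM {..<N} ?L)"
    then have x: "x \<in> extensional {..<N}" by (simp add: space_PiM PiE_def)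
    let ?v = "\<lambda>k\<in>?A. ?c * (\<Sum>i<k. x i)"
    have Fx: "F ?v = G (x(N := real (Suc N) - (\<Sum>i<N. x i)))"
      unfolding F_def scaled_gaps_partial_sums[OF x] ..
    let ?bnd = "\<forall>i\<in>?A. ?c * (\<Sum>l<i. x l) \<in> {0..1}"
      and ?mono = "\<forall>i\<in>?A. \<forall>j\<in>?A. i \<le> j \<longrightarrow> ?c * (\<Sum>l<i. x l) \<le> ?c * (\<Sum>l<j. x l)"
    have 1: "(\<Prod>i\<in>?A. indicator {0..1} (?v i)) = (of_bool ?bnd :: ennreal)"
      by (simp only: prod_indicator finite_atLeastLessThan restrict_apply' cong: ball_cong)
    have 2: "Q ?v \<longleftrightarrow> ?mono"
      unfolding Q_def by (auto simp del: One_nat_def)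
    have "(\<forall>i<Suc N. 0 \<le> (x(N := real (Suc N) - (\<Sum>i<N. x i))) i) \<longleftrightarrow> 
        (\<forall>i<N. 0 \<le> x i) \<and> (\<Sum>l<N. x l) \<le> 1 / ?c"
      by (auto simp: less_Suc_eq)
    also have "\<dots> \<longleftrightarrow> ?mono \<and> ?bnd"
      by (intro partial_sums_order_iff[symmetric]) simp
    finally have 3: "(\<forall>i<Suc N. 0 \<le> (x(N := real (Suc N) - (\<Sum>i<N. x i))) i) \<longleftrightarrow> ?mono \<and> ?bnd" .
    show "(\<Prod>i\<in>?A. indicator {0..1} (?v i)) * (F ?v * of_bool (Q ?v)) = 
        G (x(N := real (Suc N) - (\<Sum>i<N. x i))) * of_bool (\<forall>i<Suc N. 0 \<le> (x(N := real (Suc N) - (\<Sum>i<N. x i))) i)"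
      unfolding 1 2 3 Fx of_bool_conj by (simp only: ac_simps)
  qed
  finally show ?thesis by (simp only: ac_simps)
qed

text \<open>For negative \<open>b\<close> the region is empty; this is the origin of the cut-off of
  the density at \<open>s = n\<close>.\<close>

lemma nn_integral_simplex:
  fixes b :: real
  assumes "finite Q"
  shows "(\<integral>\<^sup>+y. of_bool ((\<forall>i\<in>Q. 0 \<le> y i) \<and> sum y Q \<le> b) \<partial>PiM Q (\<lambda>_. lborel)) =
    ennreal (if 0 \<le> b then b ^ card Q / fact (card Q) else 0)"
proof (cases "0 \<le> b")
  case True
  let ?M = "PiM Q (\<lambda>_. lborel :: real measure)"
  let ?S = "{y. (\<forall>i\<in>Q. 0 \<le> y i) \<and> sum y Q \<le> b} \<inter> space ?M"
  have "?S = Pi\<^sub>E Q (\<lambda>_. {0..}) \<inter> ((\<lambda>x. sum x Q) -` {..b} \<inter> space ?M)"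
    by (auto simp: space_PiM)
  also have "\<dots> \<in> sets ?M"
    using assms by (intro sets.Int sets_PiM_I_finite measurable_sets[where A = borel]) auto
  finally have "(\<integral>\<^sup>+y. indicator ?S y \<partial>?M) = emeasure ?M ?S"
    by (rule nn_integral_indicator)
  also have "\<dots> = b ^ card Q / fact (card Q)"
    using emeasure_std_simplex_aux[OF assms True] by simp
  also have "(\<integral>\<^sup>+y. indicator ?S y \<partial>?M) = (\<integral>\<^sup>+y. of_bool ((\<forall>i\<in>Q. 0 \<le> y i) \<and> sum y Q \<le> b) \<partial>?M)"
    by (intro nn_integral_cong) (auto simp: indicator_def)
  finally show ?thesis using True by simp
next
  case False
  have "\<not> ((\<forall>i\<in>Q. 0 \<le> y i) \<and> sum y Q \<le> b)" for y :: "_ \<Rightarrow> real"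
    using False sum_nonneg[of Q y] by fastforce
  then have "(\<integral>\<^sup>+y. of_bool ((\<forall>i\<in>Q. 0 \<le> y i) \<and> sum y Q \<le> b) \<partial>PiM Q (\<lambda>_. lborel)) = (\<integral>\<^sup>+y. 0 \<partial>PiM Q (\<lambda>_. lborel :: real measure))"
    by (intro nn_integral_cong) (simp only: of_bool_eq)
  with False show ?thesis by simp
qed

lemma borel_measurable_of_bool:
  "Measurable.pred M P \<Longrightarrow> (\<lambda>x. of_bool (P x) :: ennreal) \<in> borel_measurable M"
  by (rule measurable_compose[of P M "count_space UNIV" of_bool]) simp_all

text \<open>Since \<open>card I\<close> is at most \<open>N\<close>, some index \<open>i1\<close>
  lies outside \<open>I\<close>. Taking it as the determined coordinate leaves all of
  \<open>I\<close> free, and the other coordinates \<open>Q\<close> are integrated out over a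
  simplex of size \<open>n - sum x I\<close>.\<close>

lemma nn_integral_spacings_marginal:
  fixes G :: "(nat \<Rightarrow> real) \<Rightarrow> ennreal"
  assumes I: "I \<subseteq> {..<Suc N}" "card I \<le> N"
    and G: "G \<in> borel_measurable (PiM I (\<lambda>_. borel))"
  shows "(\<integral>\<^sup>+\<omega>. G (\<lambda>i\<in>I. real (Suc N) * spacing (Suc N) \<omega> i) \<partial>unif_sample (Suc N)) =
    fact N * ennreal (1 / real (Suc N)) ^ N * 
    (\<integral>\<^sup>+x. G x * of_bool (\<forall>i\<in>I. 0 \<le> x i) * 
       ennreal (if sum x I \<le> real (Suc N) then (real (Suc N) - sum x I) ^ (N - card I) / fact (N - card I) else 0)
       \<partial>PiM I (\<lambda>_. lborel))"
proof -
  let ?L = "\<lambda>_::nat. lborel :: real measure" and ?n = "real (Suc N)" and ?K = "{..<Suc N}"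
  have "I \<noteq> ?K" using I(2) by auto
  then obtain i1 where i1: "i1 \<in> ?K" "i1 \<notin> I" using I(1) by auto
  define Q where "Q = ?K - {i1} - I"
  have fin: "finite I" "finite Q" using I finite_subset by (auto simp: Q_def)
  have IQ: "I \<inter> Q = {}" "?K - {i1} = I \<union> Q" "?K - {N} = {..<N}" "?K = insert i1 (I \<union> Q)"
    using I i1 by (auto simp: Q_def)
  have "card (I \<union> Q) = N"
    using i1 by (simp flip: IQ(2))
  then have cQ: "card Q = N - card I"
    using fin IQ(1) by (simp add: card_Un_disjoint)
  define H where "H y = G (restrict y I) * of_bool (\<forall>i<Suc N. 0 \<le> y i)" for y
  have GL: "G \<in> borel_measurable (PiM I ?L)"
    using G by (simp cong: measurable_cong_sets sets_PiM_cong)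
  have P: "Measurable.pred (PiM ?K ?L) (\<lambda>y. \<forall>i<Suc N. 0 \<le> y i)"
  proof -
    have "Measurable.pred (PiM ?K ?L) (\<lambda>y. \<forall>i\<in>?K. 0 \<le> y i)"
      unfolding pred_def by measurable
    then show ?thesis by (simp add: Ball_def)
  qed
  have H: "H \<in> borel_measurable (PiM ?K ?L)"
    unfolding H_def 
    by (intro borel_measurable_times_ennreal borel_measurable_of_bool P
        measurable_compose[OF measurable_restrict_subset[OF I(1)] GL])
  have dep: "(\<lambda>x. x(i1 := a - sum x (?K - {i1}))) \<in> measurable (PiM (I \<union> Q) ?L) (PiM ?K ?L)" for a
    unfolding IQ(4) using i1 IQ(2) fin by (intro measurable_fun_upd[where J = "I \<union> Q"]) auto
  have "(\<integral>\<^sup>+\<omega>. G (\<lambda>i\<in>I. ?n * spacing (Suc N) \<omega> i) \<partial>unif_sample (Suc N)) = 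
     (\<integral>\<^sup>+\<omega>. G (restrict (\<lambda>i\<in>?K. ?n * spacing (Suc N) \<omega> i) I) \<partial>unif_sample (Suc N))"
    using I by (auto simp: Int_absorb1 intro!: nn_integral_cong arg_cong[where f = G])
  also have "\<dots> = fact N * ennreal (1 / ?n) ^ N * (\<integral>\<^sup>+x. H (x(N := ?n - sum x {..<N})) \<partial>PiM {..<N} ?L)"
    unfolding H_def
    by (rule nn_integral_spacings[of "\<lambda>y. G (restrict y I)"])
       (rule measurable_compose[OF measurable_restrict_subset[OF I(1)] G])
  also have "(\<integral>\<^sup>+x. H (x(N := ?n - sum x {..<N})) \<partial>PiM {..<N} ?L) =
     (\<integral>\<^sup>+x. H (x(i1 := ?n - sum x (?K - {i1}))) \<partial>PiM (I \<union> Q) ?L)"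
    using nn_integral_PiM_dependent_coordinate[of ?K N i1 H ?n] H i1 unfolding IQ(3) IQ(2) by simp
  also have "\<dots> = (\<integral>\<^sup>+x. \<integral>\<^sup>+y. H ((merge I Q (x, y))(i1 := ?n - sum (merge I Q (x, y)) (?K - {i1}))) \<partial>PiM Q ?L \<partial>PiM I ?L)"
    by (rule lborels.product_nn_integral_fold[OF IQ(1) fin measurable_compose[OF dep H]])
  also have "\<dots> = (\<integral>\<^sup>+x. \<integral>\<^sup>+y. G x * of_bool (\<forall>i\<in>I. 0 \<le> x i) * 
      of_bool ((\<forall>i\<in>Q. 0 \<le> y i) \<and> sum y Q \<le> ?n - sum x I) \<partial>PiM Q ?L \<partial>PiM I ?L)"
  proof (intro nn_integral_cong)
    fix x y :: "nat \<Rightarrow> real" assume "x \<in> space (PiM I ?L)"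
    then have x: "restrict x I = x" by (auto simp: space_PiM PiE_def extensional_restrict)
    let ?z = "(merge I Q (x, y))(i1 := ?n - sum (merge I Q (x, y)) (?K - {i1}))"
    have s: "sum (merge I Q (x, y)) (?K - {i1}) = sum x I + sum y Q"
      unfolding IQ(2) using IQ(1) fin by (subst sum.union_disjoint) (auto intro!: arg_cong2[where f = "(+)"] sum.cong)
    have "restrict ?z I = restrict x I"
      using i1 by (auto simp: fun_eq_iff merge_def)
    moreover have "(\<forall>i<Suc N. 0 \<le> ?z i) \<longleftrightarrow> (\<forall>i\<in>I. 0 \<le> x i) \<and> (\<forall>i\<in>Q. 0 \<le> y i) \<and> sum y Q \<le> ?n - sum x I"
    proof -
      have "(\<forall>i<Suc N. 0 \<le> ?z i) \<longleftrightarrow> (\<forall>i\<in>?K. 0 \<le> ?z i)" by auto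
      also have "\<dots> \<longleftrightarrow> (\<forall>i\<in>I. 0 \<le> ?z i) \<and> (\<forall>i\<in>Q. 0 \<le> ?z i) \<and> 0 \<le> ?z i1"
        unfolding IQ(4) by auto
      also have "(\<forall>i\<in>I. 0 \<le> ?z i) \<longleftrightarrow> (\<forall>i\<in>I. 0 \<le> x i)"
        using i1 by (intro ball_cong) (auto simp: merge_def)
      also have "(\<forall>i\<in>Q. 0 \<le> ?z i) \<longleftrightarrow> (\<forall>i\<in>Q. 0 \<le> y i)"
        using IQ(1) by (intro ball_cong) (auto simp: Q_def merge_def)
      finally show ?thesis by (simp add: s del: of_nat_Suc) linarith
    qed
    ultimately show "H ?z = G x * of_bool (\<forall>i\<in>I. 0 \<le> x i) * 
      of_bool ((\<forall>i\<in>Q. 0 \<le> y i) \<and> sum y Q \<le> ?n - sum x I)"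
      unfolding H_def x by (simp only: of_bool_conj mult.assoc)
  qed
  also have "\<dots> = (\<integral>\<^sup>+x. G x * of_bool (\<forall>i\<in>I. 0 \<le> x i) * 
       ennreal (if sum x I \<le> ?n then (?n - sum x I) ^ (N - card I) / fact (N - card I) else 0)
       \<partial>PiM I (\<lambda>_. lborel))"
  proof (rule nn_integral_cong)
    fix x
    have "(\<lambda>y. of_bool ((\<forall>i\<in>Q. 0 \<le> y i) \<and> sum y Q \<le> ?n - sum x I) :: ennreal) \<in> borel_measurable (PiM Q ?L)"
      using fin by (intro borel_measurable_of_bool) (unfold pred_def, measurable)
    then show "(\<integral>\<^sup>+y. G x * of_bool (\<forall>i\<in>I. 0 \<le> x i) * 
      of_bool ((\<forall>i\<in>Q. 0 \<le> y i) \<and> sum y Q \<le> ?n - sum x I) \<partial>PiM Q ?L) = G x * of_bool (\<forall>i\<in>I. 0 \<le> x i) * 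
       ennreal (if sum x I \<le> ?n then (?n - sum x I) ^ (N - card I) / fact (N - card I) else 0)"
      using nn_integral_simplex[OF fin(2), of "?n - sum x I"]
      by (simp add: nn_integral_cmult cQ del: of_nat_Suc)
  qed
  finally show ?thesis .
qed

section \<open>Density relative to independent exponentials\<close>

lemma prob_space_exponential: "prob_space (density lborel (exponential_density 1))"
  by (rule prob_space_exponential_density) simp

lemma product_prob_space_exponential: "product_prob_space (\<lambda>_. density lborel (exponential_density 1))"
  by (intro product_prob_spaceI prob_space_exponential)

lemma prob_space_exp_sample: "prob_space (exp_sample n)"
  unfolding exp_sample_def by (rule prob_space_PiM) (rule prob_space_exponential)

lemma prob_space_unif_sample: "prob_space (unif_sample n)"
  unfolding unif_sample_def by (rule prob_space_PiM) (rule prob_space_uniform_01)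

lemma nn_integral_exp_sample_restrict:
  fixes G :: "(nat \<Rightarrow> real) \<Rightarrow> ennreal"
  assumes I: "I \<subseteq> {..<n}" and G: "G \<in> borel_measurable (PiM I (\<lambda>_. borel))"
  shows "(\<integral>\<^sup>+x. G (restrict x I) \<partial>exp_sample n) = 
    (\<integral>\<^sup>+x. ennreal (exp (- sum x I)) * of_bool (\<forall>i\<in>I. 0 \<le> x i) * G x \<partial>PiM I (\<lambda>_. lborel))"
proof -
  let ?D = "\<lambda>_::nat. density lborel (\<lambda>x. ennreal (exponential_density 1 x))"
  have fin: "finite I" using I finite_subset by auto
  have G': "G \<in> borel_measurable (PiM I ?D)"
    using G by (simp cong: measurable_cong_sets sets_PiM_cong)
  have GL: "G \<in> borel_measurable (PiM I (\<lambda>_. lborel))"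
    using G by (simp cong: measurable_cong_sets sets_PiM_cong)
  have e: "(\<lambda>x. ennreal (exponential_density 1 x)) \<in> borel_measurable borel" by simp
  have "(\<integral>\<^sup>+x. G (restrict x I) \<partial>exp_sample n) = (\<integral>\<^sup>+x. G x \<partial>PiM I ?D)"
    unfolding exp_sample_def
    by (subst product_prob_space.distr_restrict[OF product_prob_space_exponential I finite_lessThan])
       (rule nn_integral_distr[OF measurable_restrict_subset[OF I], symmetric], simp add: G')
  also have "\<dots> = (\<integral>\<^sup>+x. (\<Prod>i\<in>I. ennreal (exponential_density 1 (x i))) * G x \<partial>PiM I (\<lambda>_. lborel))"
    unfolding PiM_density_lborel[OF fin e prob_space_exponential]
  proof (rule nn_integral_density[OF _ GL])
    show "(\<lambda>x. \<Prod>i\<in>I. ennreal (exponential_density 1 (x i))) \<in> borel_measurable (PiM I (\<lambda>_. lborel))"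
      by (intro borel_measurable_prod_ennreal) measurable
  qed
  also have "\<dots> = (\<integral>\<^sup>+x. ennreal (exp (- sum x I)) * of_bool (\<forall>i\<in>I. 0 \<le> x i) * G x \<partial>PiM I (\<lambda>_. lborel))"
  proof (rule nn_integral_cong)
    fix x :: "nat \<Rightarrow> real"
    have "(\<Prod>i\<in>I. ennreal (exponential_density 1 (x i))) = (\<Prod>i\<in>I. ennreal (exp (- x i)) * indicator {0..} (x i))"
      by (intro prod.cong) (auto simp: erlang_density_def indicator_def)
    also have "\<dots> = ennreal (exp (- sum x I)) * of_bool (\<forall>i\<in>I. 0 \<le> x i)"
      using fin by (simp add: prod.distrib prod_indicator prod_ennreal exp_sum sum_negf[symmetric])
    finally show "(\<Prod>i\<in>I. ennreal (exponential_density 1 (x i))) * G x = 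
        ennreal (exp (- sum x I)) * of_bool (\<forall>i\<in>I. 0 \<le> x i) * G x" by simp
  qed
  finally show ?thesis .
qed

text \<open>The marginal density of \<open>l\<close> scaled spacings with sum \<open>s\<close>,
  divided by the exponential density \<open>exp (- s)\<close>. The exponent \<open>n - 1 - l\<close>
  counts the coordinates that were integrated out.\<close>

definition gap_density :: "nat \<Rightarrow> nat \<Rightarrow> real \<Rightarrow> real" where
  "gap_density n l s = fact (n - 1) / (real n ^ (n - 1) * fact (n - 1 - l)) *
     (if s \<le> real n then (real n - s) ^ (n - 1 - l) * exp s else 0)"

lemma gap_density_nonneg: "gap_density n l s \<ge> 0"
  by (simp add: gap_density_def)

lemma borel_measurable_gap_density [measurable]: "gap_density n l \<in> borel_measurable borel"
  unfolding gap_density_def[abs_def] by measurable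

lemma nn_integral_spacings_eq_exp_sample:
  fixes G :: "(nat \<Rightarrow> real) \<Rightarrow> ennreal"
  assumes I: "I \<subseteq> {..<n}" "card I < n" and G: "G \<in> borel_measurable (PiM I (\<lambda>_. borel))"
  shows "(\<integral>\<^sup>+\<omega>. G (\<lambda>i\<in>I. real n * spacing n \<omega> i) \<partial>unif_sample n) =
    (\<integral>\<^sup>+x. G (restrict x I) * ennreal (gap_density n (card I) (sum x I)) \<partial>exp_sample n)"
proof -
  obtain N where N: "n = Suc N" using I(2) by (cases n) auto
  let ?L = "\<lambda>_::nat. lborel :: real measure"
  define c where "c = fact (n - 1) / (real n ^ (n - 1))"
  have fin: "finite I" using I finite_subset by auto
  have sI: "(\<lambda>x. sum x I :: real) \<in> borel_measurable (PiM I (\<lambda>_. borel))"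
    using fin by measurable
  have GL: "G \<in> borel_measurable (PiM I ?L)"
    using G by (simp cong: measurable_cong_sets sets_PiM_cong)
  have sL: "(\<lambda>x. sum x I :: real) \<in> borel_measurable (PiM I ?L)"
    using sI by (simp cong: measurable_cong_sets sets_PiM_cong)
  have P: "Measurable.pred (PiM I ?L) (\<lambda>x. \<forall>i\<in>I. 0 \<le> x i)"
    using fin unfolding pred_def by measurable
  have c0: "c \<ge> 0" by (simp add: c_def)
  have c: "fact N * ennreal (1 / real (Suc N)) ^ N = ennreal c"
    unfolding c_def N
    by (simp add: ennreal_fact[symmetric] ennreal_power ennreal_mult[symmetric] power_one_over divide_simps del: of_nat_Suc)
  let ?w = "\<lambda>s. if s \<le> real n then (real n - s) ^ (N - card I) / fact (N - card I) else 0"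
  have w: "?w \<in> borel_measurable borel" by measurable
  \<comment> \<open>The exponential weight cancels the factor \<open>exp s\<close> built into
    \<open>gap_density\<close>.\<close>
  have gd: "ennreal (exp (- s)) * ennreal (gap_density n (card I) s) = ennreal c * ennreal (?w s)" for s
    using c0 by (auto simp: ennreal_mult[symmetric] gap_density_nonneg gap_density_def c_def N exp_minus field_simps)
  have "(\<integral>\<^sup>+\<omega>. G (\<lambda>i\<in>I. real n * spacing n \<omega> i) \<partial>unif_sample n) = 
     ennreal c * (\<integral>\<^sup>+x. G x * of_bool (\<forall>i\<in>I. 0 \<le> x i) * ennreal (?w (sum x I)) \<partial>PiM I ?L)"
    using nn_integral_spacings_marginal[of I N G] I G unfolding c N by simp
  also have "\<dots> = (\<integral>\<^sup>+x. ennreal c * (G x * of_bool (\<forall>i\<in>I. 0 \<le> x i) * ennreal (?w (sum x I))) \<partial>PiM I ?L)"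
    by (intro nn_integral_cmult[symmetric] borel_measurable_times_ennreal GL borel_measurable_of_bool P
        measurable_compose[OF sL measurable_compose[OF w measurable_ennreal]])
  also have "\<dots> = (\<integral>\<^sup>+x. ennreal (exp (- sum x I)) * of_bool (\<forall>i\<in>I. 0 \<le> x i) * 
      (G x * ennreal (gap_density n (card I) (sum x I))) \<partial>PiM I ?L)"
  proof (rule nn_integral_cong)
    fix x :: "nat \<Rightarrow> real"
    let ?b = "of_bool (\<forall>i\<in>I. 0 \<le> x i) :: ennreal"
    have "ennreal c * (G x * ?b * ennreal (?w (sum x I))) = G x * ?b * (ennreal c * ennreal (?w (sum x I)))"
      by (rule mult.left_commute)
    also have "\<dots> = G x * ?b * (ennreal (exp (- sum x I)) * ennreal (gap_density n (card I) (sum x I)))"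
      by (simp only: gd)
    finally show "ennreal c * (G x * ?b * ennreal (?w (sum x I))) =
        ennreal (exp (- sum x I)) * ?b * (G x * ennreal (gap_density n (card I) (sum x I)))"
      by (simp only: ac_simps)
  qed
  also have "\<dots> = (\<integral>\<^sup>+x. (\<lambda>x. G x * ennreal (gap_density n (card I) (sum x I))) (restrict x I) \<partial>exp_sample n)"
    by (intro nn_integral_exp_sample_restrict[OF I(1), symmetric] borel_measurable_times_ennreal G
       measurable_compose[OF sI measurable_compose[OF borel_measurable_gap_density measurable_ennreal]])
  finally show ?thesis by simp
qed

section \<open>Expansion of the density\<close>

text \<open>With \<open>N = n - l\<close> and \<open>t = s - l\<close> this is
  \<open>gap_density\<close> up to a factor independent of \<open>s\<close>, because
  \<open>n - s = N (1 - t / N)\<close>. Centring at the mean \<open>l\<close> of the sum cancels the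
  linear part of the logarithm up to \<open>t / N\<close>.\<close>

definition gap_profile :: "nat \<Rightarrow> real \<Rightarrow> real" where
  "gap_profile N t = (if t \<le> real N then (1 - t / real N) ^ (N - 1) * exp t else 0)"

lemma gap_profile_nonneg: "N > 0 \<Longrightarrow> gap_profile N t \<ge> 0"
  by (simp add: gap_profile_def)

lemma gap_profile_le:
  assumes N: "N > 0"
  shows "gap_profile N t \<le> 3"
proof (cases "t \<le> real N")
  case True
  let ?v = "t / real N"
  have v: "?v \<le> 1" using True N by simp
  have "(1 - ?v) ^ (N - 1) \<le> exp (- ?v) ^ (N - 1)"
    using v exp_ge_add_one_self[of "- ?v"] by (intro power_mono) auto
  also have "\<dots> = exp (?v - t)"
    using N by (simp add: exp_of_nat_mult[symmetric] of_nat_diff field_simps)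
  finally have "(1 - ?v) ^ (N - 1) * exp t \<le> exp (?v - t) * exp t"
    by (intro mult_right_mono) auto
  also have "\<dots> = exp ?v" by (simp add: exp_add[symmetric])
  also have "\<dots> \<le> exp 1" using v by simp
  also have "\<dots> \<le> 3" by (rule exp_le)
  finally show ?thesis using True by (simp add: gap_profile_def)
qed (simp add: gap_profile_def)

text \<open>Mean value theorem: the expression inside the modulus vanishes at 0 and has derivative
  \<open>- x^2 / (1 - x)\<close>, which is at most \<open>2 v^2\<close> in modulus for
  \<open>x\<close> between \<open>-|v|\<close> and \<open>|v|\<close>.\<close>

lemma ln_one_minus_third_order:
  fixes v :: real
  assumes "\<bar>v\<bar> \<le> 1/2"
  shows "\<bar>ln (1 - v) + v + v\<^sup>2 / 2\<bar> \<le> 2 * \<bar>v\<bar> ^ 3"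
proof -
  define g where "g x = ln (1 - x) + x + x\<^sup>2 / 2" for x :: real
  have "norm (g v - g 0) \<le> (2 * v\<^sup>2) * norm (v - 0)"
  proof (rule field_differentiable_bound[where S = "{-\<bar>v\<bar>..\<bar>v\<bar>}" and f' = "\<lambda>x. - (x\<^sup>2 / (1 - x))"])
    fix x assume x: "x \<in> {-\<bar>v\<bar>..\<bar>v\<bar>}"
    then have x': "\<bar>x\<bar> \<le> \<bar>v\<bar>" "1 - x \<ge> 1/2" using assms by auto
    show "(g has_field_derivative - (x\<^sup>2 / (1 - x))) (at x within {-\<bar>v\<bar>..\<bar>v\<bar>})"
      unfolding g_def[abs_def] using x'
      by (auto intro!: derivative_eq_intros simp: field_simps power2_eq_square)
    have "x\<^sup>2 \<le> v\<^sup>2" using x'(1) by (simp add: abs_le_square_iff)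
    then have "x\<^sup>2 \<le> 2 * v\<^sup>2 * (1 - x)"
      using x'(2) mult_left_mono[of "1/2" "1 - x" "2 * v\<^sup>2"] by simp
    then show "norm (- (x\<^sup>2 / (1 - x))) \<le> 2 * v\<^sup>2"
      using x'(2) by (simp add: field_simps)
  qed auto
  then show ?thesis
    by (simp add: g_def power2_eq_square power3_eq_cube)
qed

text \<open>The error is quadratic in \<open>w = (1 + t^2) / N\<close>. Where
  \<open>t^2 > N\<close>, one has \<open>w >= 1\<close> and boundedness suffices; elsewhere
  \<open>|t / N| <= 1/2\<close>, and the logarithm is expanded before exponentiating.\<close>

lemma gap_profile_expansion:
  fixes t :: real
  assumes N: "N \<ge> 4"
  shows "\<bar>gap_profile N t - (1 + t / real N - t\<^sup>2 / (2 * real N))\<bar> \<le> 30000 * ((1 + t\<^sup>2) / real N)\<^sup>2"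
proof -
  define w where "w = (1 + t\<^sup>2) / real N"
  define v where "v = t / real N"
  have N0: "real N \<ge> 4" using N by simp
  have w0: "w > 0" using N0 by (simp add: w_def add_pos_nonneg)
  have t2: "2 * \<bar>t\<bar> \<le> 1 + t\<^sup>2"
    using sum_squares_bound[of 1 "\<bar>t\<bar>"] by simp
  have vw: "\<bar>v\<bar> \<le> w / 2"
    using t2 N0 by (simp add: v_def w_def field_simps)
  have qw: "t\<^sup>2 / (2 * real N) \<le> w / 2" "0 \<le> t\<^sup>2 / (2 * real N)"
    using N0 by (auto simp: w_def field_simps)
  show ?thesis
  proof (cases "t\<^sup>2 \<le> real N")
    case False
    then have w1: "w \<ge> 1" using N0 by (simp add: w_def field_simps)
    have "\<bar>gap_profile N t - 1\<bar> \<le> 3"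
      using gap_profile_nonneg[of N t] gap_profile_le[of N t] N by (auto simp: abs_if)
    then have "\<bar>gap_profile N t - (1 + v - t\<^sup>2 / (2 * real N))\<bar> \<le> 3 + w"
      using vw qw by linarith
    also have "\<dots> \<le> 4 * w" using w1 by simp
    also have "\<dots> \<le> 30000 * w\<^sup>2" using w1 by (simp add: power2_eq_square)
    finally show ?thesis by (simp add: v_def w_def)
  next
    case True
    have "4 * t\<^sup>2 \<le> (real N)\<^sup>2"
      using True N0 mult_mono[of 4 "real N" "t\<^sup>2" "real N"] by (simp add: power2_eq_square)
    then have "(2 * \<bar>t\<bar>)\<^sup>2 \<le> (real N)\<^sup>2" by (simp add: power_mult_distrib)
    then have "2 * \<bar>t\<bar> \<le> real N" by (rule power2_le_imp_le) simp
    then have v12: "\<bar>v\<bar> \<le> 1/2" and tN: "t \<le> real N"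
      using N0 by (auto simp: v_def field_simps)
    have wle: "w \<le> 5/4" using True N0 by (simp add: w_def field_simps)
    define r where "r = ln (1 - v) + v + v\<^sup>2 / 2"
    have r: "\<bar>r\<bar> \<le> 2 * \<bar>v\<bar> ^ 3"
      unfolding r_def by (rule ln_one_minus_third_order[OF v12])
    define L where "L = (real N - 1) * ln (1 - v) + t"
    have phi: "gap_profile N t = exp L"
    proof -
      have "1 - v > 0" using v12 by auto
      then have "(1 - v) ^ (N - 1) = exp (real (N - 1) * ln (1 - v))"
        by (simp only: exp_of_nat_mult exp_ln)
      also have "real (N - 1) = real N - 1" using N by simp
      finally show ?thesis
        using tN by (simp add: gap_profile_def L_def exp_add v_def[symmetric])
    qed
    \<comment> \<open>The term \<open>v^2 / 2\<close> is left over because the power in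
      \<open>gap_profile\<close> is \<open>N - 1\<close> rather than \<open>N\<close>.\<close>
    define E where "E = v\<^sup>2 / 2 + (real N - 1) * r"
    have NV: "real N * v = t" using N0 by (simp add: v_def)
    have L: "L = v - t\<^sup>2 / (2 * real N) + E"
    proof -
      have q: "t\<^sup>2 / (2 * real N) = real N * v\<^sup>2 / 2"
        using N0 by (simp add: v_def power2_eq_square)
      show ?thesis
        unfolding L_def E_def r_def q using NV by (simp add: algebra_simps diff_divide_distrib)
    qed
    have e1: "v\<^sup>2 \<le> w\<^sup>2"
      using vw w0 by (intro abs_le_square_iff[THEN iffD1]) auto
    have e2: "\<bar>(real N - 1) * r\<bar> \<le> 2 * w\<^sup>2"
    proof -
      have "\<bar>(real N - 1) * r\<bar> \<le> real N * (2 * \<bar>v\<bar> ^ 3)"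
        unfolding abs_mult using r N0 by (intro mult_mono) auto
      also have "\<dots> = 2 * (\<bar>t\<bar> * t\<^sup>2) / (real N)\<^sup>2"
        using N0 by (simp add: v_def power2_eq_square power3_eq_cube field_simps)
      also have "\<dots> \<le> 2 * ((1 + t\<^sup>2) * (1 + t\<^sup>2)) / (real N)\<^sup>2"
        using t2 by (intro divide_right_mono mult_left_mono mult_mono) auto
      also have "\<dots> = 2 * w\<^sup>2" by (simp add: w_def power2_eq_square)
      finally show ?thesis .
    qed
    have E: "\<bar>E\<bar> \<le> 3 * w\<^sup>2"
      unfolding E_def using e1 e2 w0 zero_le_power2[of v] zero_le_power2[of w] by linarith
    have "w\<^sup>2 \<le> 5/4 * w" using wle w0 by (simp add: power2_eq_square)
    then have L5: "\<bar>L\<bar> \<le> 5 * w"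
      unfolding L using E vw qw w0 by linarith
    then have L7: "\<bar>L\<bar> \<le> 7" using wle by linarith
    \<comment> \<open>Taylor with \<open>|L| <= 5 w\<close> and \<open>|L| <= 7\<close>:
      \<open>exp 7\<close> is at most \<open>3 ^ 7 = 2187\<close>, and \<open>2187 * 25 / 2\<close>
      is rounded up to 27338 below.\<close>
    obtain \<tau> where \<tau>: "\<bar>\<tau>\<bar> \<le> \<bar>L\<bar>" "exp L = (\<Sum>m<2. L ^ m / fact m) + exp \<tau> / fact 2 * L ^ 2"
      using Maclaurin_exp_le[of L 2] by blast
    have "exp \<tau> \<le> exp (7 * 1)" using \<tau>(1) L7 by auto
    also have "\<dots> = exp 1 ^ 7" using exp_of_nat_mult[of 7 "1::real"] by simp
    also have "\<dots> \<le> 3 ^ 7" by (intro power_mono exp_le) auto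
    finally have "exp \<tau> \<le> 2187" by simp
    moreover have "L\<^sup>2 \<le> (5 * w)\<^sup>2" using L5 w0 by (intro abs_le_square_iff[THEN iffD1]) auto
    ultimately have "exp \<tau> * L\<^sup>2 \<le> 2187 * (25 * w\<^sup>2)"
      by (intro mult_mono) (auto simp: power_mult_distrib)
    moreover have "exp L - 1 - L = exp \<tau> * L\<^sup>2 / 2"
      using \<tau>(2) by (simp add: numeral_2_eq_2)
    moreover have "0 \<le> exp \<tau> * L\<^sup>2" by simp
    ultimately have "\<bar>exp L - (1 + L)\<bar> \<le> 27338 * w\<^sup>2"
      using zero_le_power2[of w] by (simp only: abs_le_iff) linarith
    moreover have "\<bar>(1 + L) - (1 + v - t\<^sup>2 / (2 * real N))\<bar> \<le> 3 * w\<^sup>2"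
      using E by (simp add: L)
    ultimately have "\<bar>exp L - (1 + v - t\<^sup>2 / (2 * real N))\<bar> \<le> 30000 * w\<^sup>2"
      using zero_le_power2[of w] by linarith
    then show ?thesis by (simp add: phi v_def w_def)
  qed
qed

text \<open>For \<open>w <= 1\<close> the quadratic error is absorbed into the linear one; for
  \<open>w > 1\<close> the uniform bound on the profile takes over.\<close>

lemma gap_profile_minus_one:
  fixes t :: real
  assumes N: "N \<ge> 4"
  shows "\<bar>gap_profile N t - 1\<bar> \<le> 30001 * ((1 + t\<^sup>2) / real N)"
proof -
  define w where "w = (1 + t\<^sup>2) / real N"
  have w0: "w > 0" using N by (simp add: w_def add_pos_nonneg)
  have t2: "2 * \<bar>t\<bar> \<le> 1 + t\<^sup>2"
    using sum_squares_bound[of 1 "\<bar>t\<bar>"] by simp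
  have v: "\<bar>t / real N\<bar> \<le> w / 2" "t\<^sup>2 / (2 * real N) \<le> w / 2" "0 \<le> t\<^sup>2 / (2 * real N)"
    using t2 N by (auto simp: w_def field_simps)
  show ?thesis
  proof (cases "w \<le> 1")
    case True
    then have "w\<^sup>2 \<le> w" using w0 by (simp add: power2_eq_square)
    then show ?thesis
      using gap_profile_expansion[OF N, of t] v unfolding w_def[symmetric] by linarith
  next
    case False
    have "\<bar>gap_profile N t - 1\<bar> \<le> 3"
      using gap_profile_nonneg[of N t] gap_profile_le[of N t] N by (auto simp: abs_if)
    with False show ?thesis unfolding w_def[symmetric] by linarith
  qed
qed

section \<open>Moments of exponential sums\<close>

text \<open>The vector of coordinates has the product law, which is the distributional criterion for
  independence; that criterion requires a nonempty index set, hence the case distinction.\<close>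

lemma indep_vars_PiM_coordinates:
  assumes "finite K" "\<And>i. prob_space (M i)"
  shows "prob_space.indep_vars (PiM K M) M (\<lambda>i x. x i) K"
proof (cases "K = {}")
  case True
  interpret P: prob_space "PiM K M" by (intro prob_space_PiM assms)
  show ?thesis unfolding P.indep_vars_def P.indep_sets_def by (simp add: True)
next
  case False
  interpret P: prob_space "PiM K M" by (intro prob_space_PiM assms)
  have c: "distr (PiM K M) (M i) (\<lambda>x. x i) = M i" if "i \<in> K" for i
    using that assms by (intro distr_PiM_component) auto
  have "distr (PiM K M) (PiM K M) (\<lambda>x. \<lambda>i\<in>K. x i) = distr (PiM K M) (PiM K M) (\<lambda>x. x)"
    by (intro distr_cong) (auto simp: space_PiM PiE_def extensional_restrict)
  also have "\<dots> = PiM K M" by (simp add: distr_id)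
  also have "\<dots> = PiM K (\<lambda>i. distr (PiM K M) (M i) (\<lambda>x. x i))"
    using c by (intro PiM_cong) auto
  finally show ?thesis
    using False by (subst P.indep_vars_iff_distr_eq_PiM') auto
qed

lemma indep_vars_exp_sample: "prob_space.indep_vars (exp_sample n) (\<lambda>_. borel) (\<lambda>i x. x i) {..<n}"
proof -
  interpret prob_space "exp_sample n" by (rule prob_space_exp_sample)
  have "indep_vars (\<lambda>_. density lborel (exponential_density 1)) (\<lambda>i x. x i) {..<n}"
    unfolding exp_sample_def by (rule indep_vars_PiM_coordinates) (auto intro: prob_space_exponential)
  then have "indep_vars (\<lambda>_. borel) (\<lambda>i. (\<lambda>y. y) \<circ> (\<lambda>x. x i)) {..<n}"
    by (rule indep_vars_compose) auto
  then show ?thesis by (simp add: comp_def)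
qed

lemma distributed_exp_sample_coordinate:
  assumes "i < n"
  shows "distributed (exp_sample n) lborel (\<lambda>x. x i) (exponential_density 1)"
proof -
  have "distr (exp_sample n) (density lborel (exponential_density 1)) (\<lambda>x. x i) = density lborel (exponential_density 1)"
    unfolding exp_sample_def using assms by (intro distr_PiM_component prob_space_exponential) auto
  also have "distr (exp_sample n) (density lborel (exponential_density 1)) (\<lambda>x. x i) = distr (exp_sample n) lborel (\<lambda>x. x i)"
    by (intro distr_cong) auto
  finally show ?thesis
    using assms measurable_component_singleton[of i "{..<n}" "\<lambda>_. density lborel (exponential_density 1)"]
    by (auto simp: distributed_def exp_sample_def)
qed

text \<open>Off by one: \<open>erlang_density k\<close> is the gamma density of shape
  \<open>k + 1\<close>, the law of a sum of \<open>k + 1\<close> exponentials.\<close>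

lemma distributed_exp_sample_sum:
  assumes I: "I \<subseteq> {..<n}" "I \<noteq> {}"
  shows "distributed (exp_sample n) lborel (\<lambda>x. sum x I) (erlang_density (card I - 1) 1)"
proof -
  interpret prob_space "exp_sample n" by (rule prob_space_exp_sample)
  have "finite I" using I finite_subset by auto
  moreover have "indep_vars (\<lambda>_. borel) (\<lambda>i x. x i) I"
    using indep_vars_subset[OF indep_vars_exp_sample I(1)] .
  ultimately show ?thesis
    using exponential_distributed_sum[of I 1 "\<lambda>i x. x i"] I distributed_exp_sample_coordinate by auto
qed

text \<open>The moments are written as rising factorials, polynomials in \<open>card I\<close>, so
  that the central moment below reduces to a polynomial identity.\<close>

lemma exp_sample_sum_power:
  assumes I: "I \<subseteq> {..<n}" "I \<noteq> {}"
  shows "integrable (exp_sample n) (\<lambda>x. sum x I ^ k)"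
    and "(\<integral>x. sum x I ^ k \<partial>exp_sample n) = (\<Prod>j<k. real (card I + j))"
proof -
  interpret prob_space "exp_sample n" by (rule prob_space_exp_sample)
  have "finite I" using I finite_subset by auto
  then obtain l where l: "card I = Suc l" using I by (cases "card I") auto
  show "integrable (exp_sample n) (\<lambda>x. sum x I ^ k)"
    by (rule erlang_ith_moment_integrable[OF _ distributed_exp_sample_sum[OF I]]) simp
  have "(\<integral>x. sum x I ^ k \<partial>exp_sample n) = fact (l + k) / fact l"
    using erlang_ith_moment[OF _ distributed_exp_sample_sum[OF I], of k] l by simp
  also have "\<dots> = (\<Prod>j<k. real (card I + j))"
    by (induction k) (simp_all add: l field_simps)
  finally show "(\<integral>x. sum x I ^ k \<partial>exp_sample n) = (\<Prod>j<k. real (card I + j))" .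
qed

text \<open>Order 12 is the power of \<open>t\<close> in the cube of \<open>chi^2\<close>. After
  expansion into raw moments all powers of \<open>l\<close> above the sixth cancel, and the
  remaining ones are at most \<open>l ^ 6\<close> because \<open>l >= 1\<close>.\<close>

lemma exp_sample_sum_central_moment:
  assumes I: "I \<subseteq> {..<n}" "I \<noteq> {}"
  defines "l \<equiv> real (card I)"
  shows "integrable (exp_sample n) (\<lambda>x. (sum x I - l) ^ k)"
    and "(\<integral>x. (sum x I - l) ^ 12 \<partial>exp_sample n) \<le> 176214841 * l ^ 6"
proof -
  have bin: "(sum x I - l) ^ k = (\<Sum>i\<le>k. (of_nat (k choose i) * (- l) ^ (k - i)) * sum x I ^ i)" for x k
    using binomial_ring[of "sum x I" "- l" k] by (simp add: mult_ac)
  show "integrable (exp_sample n) (\<lambda>x. (sum x I - l) ^ k)"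
    unfolding bin by (intro Bochner_Integration.integrable_sum integrable_mult_right exp_sample_sum_power[OF I])
  have "finite I" using I finite_subset by auto
  then have l1: "l \<ge> 1" using I by (simp add: l_def Suc_leI card_gt_0_iff)
  have "(\<integral>x. (sum x I - l) ^ 12 \<partial>exp_sample n) = 
     (\<Sum>i\<le>12. (of_nat (12 choose i) * (- l) ^ (12 - i)) * (\<Prod>j<i. l + real j))"
    unfolding bin using exp_sample_sum_power[OF I]
    by (subst Bochner_Integration.integral_sum) (auto simp: l_def intro!: sum.cong)
  also have "\<dots> = 10395 * l ^ 6 + 866250 * l ^ 5 + 11098780 * l ^ 4 + 47324376 * l ^ 3 + 76998240 * l ^ 2 + 39916800 * l"
    by (simp add: atMost_nat_numeral lessThan_nat_numeral binomial_fact' fact_numeral) algebra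
  also have "\<dots> \<le> 10395 * l ^ 6 + 866250 * l ^ 6 + 11098780 * l ^ 6 + 47324376 * l ^ 6 + 76998240 * l ^ 6 + 39916800 * l ^ 6"
    using l1 by (intro add_mono mult_left_mono power_increasing self_le_power) auto
  finally show "(\<integral>x. (sum x I - l) ^ 12 \<partial>exp_sample n) \<le> 176214841 * l ^ 6" by simp
qed

section \<open>Hoelder inequality and deviation bounds\<close>

definition norm3 :: "'a measure \<Rightarrow> ('a \<Rightarrow> real) \<Rightarrow> real" where
  "norm3 M f = (\<integral>x. \<bar>f x\<bar> ^ 3 \<partial>M) powr (1 / 3)"

definition in_L3 :: "'a measure \<Rightarrow> ('a \<Rightarrow> real) \<Rightarrow> bool" where
  "in_L3 M f \<longleftrightarrow> f \<in> borel_measurable M \<and> integrable M (\<lambda>x. \<bar>f x\<bar> ^ 3)"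

lemma norm3_nonneg: "norm3 M f \<ge> 0"
  by (simp add: norm3_def)

lemma norm3_cube: "norm3 M f ^ 3 = (\<integral>x. \<bar>f x\<bar> ^ 3 \<partial>M)"
proof -
  have "(i powr (1 / 3)) ^ 3 = i" if "i \<ge> 0" for i :: real
    using that by (cases "i = 0") (simp_all add: powr_power)
  then show ?thesis
    by (simp add: norm3_def)
qed

lemma norm3_le:
  assumes "(\<integral>x. \<bar>f x\<bar> ^ 3 \<partial>M) \<le> c ^ 3" "c \<ge> 0"
  shows "norm3 M f \<le> c"
  using assms norm3_cube[of M f] power_le_imp_le_base[of "norm3 M f" 2 c] by (simp add: numeral_3_eq_3)

lemma norm3_cmult: "norm3 M (\<lambda>x. c * f x) = \<bar>c\<bar> * norm3 M f"
proof -
  have "norm3 M (\<lambda>x. c * f x) ^ 3 = (\<bar>c\<bar> * norm3 M f) ^ 3"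
    unfolding norm3_cube power_mult_distrib by (simp add: abs_mult power_mult_distrib)
  then show ?thesis
    by (rule power_eq_imp_eq_base) (simp_all add: norm3_nonneg)
qed

lemma in_L3_cmult: "in_L3 M f \<Longrightarrow> in_L3 M (\<lambda>x. c * f x)"
  by (auto simp: in_L3_def abs_mult power_mult_distrib)

lemma in_L3_bound:
  assumes "in_L3 M g" "f \<in> borel_measurable M" "\<And>x. x \<in> space M \<Longrightarrow> \<bar>f x\<bar> \<le> \<bar>g x\<bar>"
  shows "in_L3 M f" "norm3 M f \<le> norm3 M g"
proof -
  have [measurable]: "f \<in> borel_measurable M" "g \<in> borel_measurable M"
    using assms by (auto simp: in_L3_def)
  have le: "\<bar>f x\<bar> ^ 3 \<le> \<bar>g x\<bar> ^ 3" if "x \<in> space M" for x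
    using assms(3)[OF that] by (intro power_mono) auto
  have "integrable M (\<lambda>x. \<bar>f x\<bar> ^ 3)"
    by (rule Bochner_Integration.integrable_bound[of M "\<lambda>x. \<bar>g x\<bar> ^ 3"])
       (use assms(1) le in \<open>auto simp: in_L3_def\<close>)
  then show L3: "in_L3 M f"
    by (simp add: in_L3_def)
  show "norm3 M f \<le> norm3 M g"
  proof (rule norm3_le)
    show "(\<integral>x. \<bar>f x\<bar> ^ 3 \<partial>M) \<le> norm3 M g ^ 3"
      unfolding norm3_cube
      by (rule integral_mono) (use L3 assms(1) le in \<open>auto simp: in_L3_def\<close>)
  qed (rule norm3_nonneg)
qed

text \<open>Arithmetic-geometric mean inequality, from the factorisation of
  \<open>a^3 + b^3 + c^3 - 3 a b c\<close>.\<close>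

lemma young_cube:
  fixes a b c :: real
  assumes "a \<ge> 0" "b \<ge> 0" "c \<ge> 0"
  shows "a * b * c \<le> (a ^ 3 + b ^ 3 + c ^ 3) / 3"
proof -
  have "a ^ 3 + b ^ 3 + c ^ 3 - 3 * (a * b * c) = (a + b + c) * ((a - b)\<^sup>2 + (b - c)\<^sup>2 + (c - a)\<^sup>2) / 2"
    by (simp add: power2_eq_square power3_eq_cube algebra_simps)
  also have "\<dots> \<ge> 0" using assms by simp
  finally show ?thesis by simp
qed

text \<open>\<open>young_cube\<close> is applied to the three functions divided by their norms; the
  right side then integrates to 1.\<close>

lemma holder3:
  assumes f: "in_L3 M f" and g: "in_L3 M g" and e: "in_L3 M e"
  shows "integrable M (\<lambda>x. f x * g x * e x)"
    and "\<bar>\<integral>x. f x * g x * e x \<partial>M\<bar> \<le> norm3 M f * norm3 M g * norm3 M e"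
proof -
  have [measurable]: "f \<in> borel_measurable M" "g \<in> borel_measurable M" "e \<in> borel_measurable M"
    using f g e by (auto simp: in_L3_def)
  have int: "integrable M (\<lambda>x. \<bar>f x\<bar> ^ 3)" "integrable M (\<lambda>x. \<bar>g x\<bar> ^ 3)" "integrable M (\<lambda>x. \<bar>e x\<bar> ^ 3)"
    using f g e by (auto simp: in_L3_def)
  have pw: "\<bar>f x * g x * e x\<bar> \<le> (\<bar>f x\<bar> ^ 3 + \<bar>g x\<bar> ^ 3 + \<bar>e x\<bar> ^ 3) / 3" for x
    using young_cube[of "\<bar>f x\<bar>" "\<bar>g x\<bar>" "\<bar>e x\<bar>"] by (simp add: abs_mult)
  show i: "integrable M (\<lambda>x. f x * g x * e x)"
    by (rule Bochner_Integration.integrable_bound[of M "\<lambda>x. (\<bar>f x\<bar> ^ 3 + \<bar>g x\<bar> ^ 3 + \<bar>e x\<bar> ^ 3) / 3"])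
       (use int pw in auto)
  define a b c where "a = norm3 M f" and "b = norm3 M g" and "c = norm3 M e"
  have nn: "a \<ge> 0" "b \<ge> 0" "c \<ge> 0" by (simp_all add: a_def b_def c_def norm3_nonneg)
  have zero: "AE x in M. q x = 0" if "in_L3 M q" "norm3 M q = 0" for q
  proof -
    have "(\<integral>x. \<bar>q x\<bar> ^ 3 \<partial>M) = 0" using norm3_cube[of M q] that by simp
    then have "AE x in M. \<bar>q x\<bar> ^ 3 = 0"
      using that by (subst (asm) integral_nonneg_eq_0_iff_AE) (auto simp: in_L3_def)
    then show ?thesis by simp
  qed
  show "\<bar>\<integral>x. f x * g x * e x \<partial>M\<bar> \<le> norm3 M f * norm3 M g * norm3 M e"
  \<comment> \<open>Normalising needs nonzero norms; a factor of norm zero vanishes almost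
    everywhere.\<close>
  proof (cases "a = 0 \<or> b = 0 \<or> c = 0")
    case True
    then have "AE x in M. f x * g x * e x = 0"
      using zero[OF f] zero[OF g] zero[OF e] by (auto simp: a_def b_def c_def)
    then have "(\<integral>x. f x * g x * e x \<partial>M) = 0"
      by (intro integral_eq_zero_AE)
    then show ?thesis by (simp add: norm3_nonneg)
  next
    case False
    then have pos: "a > 0" "b > 0" "c > 0" using nn by auto
    have "\<bar>\<integral>x. f x * g x * e x \<partial>M\<bar> \<le> (\<integral>x. \<bar>f x * g x * e x\<bar> \<partial>M)"
      by (rule integral_abs_bound)
    also have "\<dots> \<le> (\<integral>x. a * b * c * ((\<bar>f x\<bar> ^ 3 / a ^ 3 + \<bar>g x\<bar> ^ 3 / b ^ 3 + \<bar>e x\<bar> ^ 3 / c ^ 3) / 3) \<partial>M)"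
    proof (rule integral_mono)
      fix x
      have "\<bar>f x * g x * e x\<bar> = a * b * c * ((\<bar>f x\<bar> / a) * (\<bar>g x\<bar> / b) * (\<bar>e x\<bar> / c))"
        using pos by (simp add: abs_mult)
      also have "\<dots> \<le> a * b * c * ((\<bar>f x\<bar> ^ 3 / a ^ 3 + \<bar>g x\<bar> ^ 3 / b ^ 3 + \<bar>e x\<bar> ^ 3 / c ^ 3) / 3)"
        using young_cube[of "\<bar>f x\<bar> / a" "\<bar>g x\<bar> / b" "\<bar>e x\<bar> / c"] pos
        by (intro mult_left_mono) (auto simp: power_divide)
      finally show "\<bar>f x * g x * e x\<bar> \<le> a * b * c * ((\<bar>f x\<bar> ^ 3 / a ^ 3 + \<bar>g x\<bar> ^ 3 / b ^ 3 + \<bar>e x\<bar> ^ 3 / c ^ 3) / 3)" .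
    qed (use i int in auto)
    also have "\<dots> = a * b * c * ((a ^ 3 / a ^ 3 + b ^ 3 / b ^ 3 + c ^ 3 / c ^ 3) / 3)"
      unfolding a_def b_def c_def norm3_cube using int by simp
    also have "\<dots> = a * b * c" using pos by simp
    finally show ?thesis by (simp add: a_def b_def c_def)
  qed
qed

lemma (in prob_space) in_L3_const: "in_L3 M (\<lambda>_. c)"
  by (simp add: in_L3_def)

lemma (in prob_space) norm3_one: "norm3 M (\<lambda>_. 1) = 1"
  by (simp add: norm3_def prob_space)

lemma cube_add_le:
  fixes a b :: real
  assumes "a \<ge> 0" "b \<ge> 0"
  shows "(a + b) ^ 3 \<le> 4 * (a ^ 3 + b ^ 3)"
proof -
  have "4 * (a ^ 3 + b ^ 3) - (a + b) ^ 3 = 3 * ((a + b) * (a - b)\<^sup>2)"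
    by (simp add: power2_eq_square power3_eq_cube algebra_simps)
  also have "\<dots> \<ge> 0" using assms by simp
  finally show ?thesis by simp
qed

lemma in_L3_add:
  assumes "in_L3 M f" "in_L3 M g"
  shows "in_L3 M (\<lambda>x. f x + g x)"
proof -
  have [measurable]: "f \<in> borel_measurable M" "g \<in> borel_measurable M"
    using assms by (auto simp: in_L3_def)
  have bd: "\<bar>f x + g x\<bar> ^ 3 \<le> 4 * (\<bar>f x\<bar> ^ 3 + \<bar>g x\<bar> ^ 3)" for x
  proof -
    have "\<bar>f x + g x\<bar> ^ 3 \<le> (\<bar>f x\<bar> + \<bar>g x\<bar>) ^ 3" by (intro power_mono) auto
    also have "\<dots> \<le> 4 * (\<bar>f x\<bar> ^ 3 + \<bar>g x\<bar> ^ 3)" by (intro cube_add_le) auto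
    finally show ?thesis .
  qed
  have "integrable M (\<lambda>x. \<bar>f x + g x\<bar> ^ 3)"
    by (rule Bochner_Integration.integrable_bound[of M "\<lambda>x. 4 * (\<bar>f x\<bar> ^ 3 + \<bar>g x\<bar> ^ 3)"])
       (use assms bd in \<open>auto simp: in_L3_def\<close>)
  then show ?thesis by (simp add: in_L3_def)
qed

lemma (in prob_space) in_L3_integrable:
  assumes "in_L3 M f" "in_L3 M g"
  shows "integrable M f" "integrable M (\<lambda>x. f x * g x)"
  using holder3(1)[OF assms in_L3_const[of 1]] holder3(1)[OF assms(1) in_L3_const[of 1] in_L3_const[of 1]] 
  by simp_all

text \<open>\<open>(l / n) * chi\<close> is the quantity \<open>u\<close> of the overview. Writing
  it so separates the small factor \<open>l / n\<close> from a variable whose moments are bounded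
  uniformly in \<open>l\<close>.\<close>

definition chi :: "nat set \<Rightarrow> (nat \<Rightarrow> real) \<Rightarrow> real" where
  "chi I x = 1 + (sum x I - real (card I))\<^sup>2 / real (card I)"

lemma chi_ge_one: "chi I x \<ge> 1"
  by (simp add: chi_def)

text \<open>The central moment of order 12 of the gamma distribution with parameter \<open>l\<close> is a polynomial of degree 6
  in \<open>l\<close> with nonnegative coefficients, whose sum is 176214841.\<close>

definition kappa :: real where
  "kappa = 32 * (1 + 176214841)"

lemma kappa_ge_one: "kappa \<ge> 1"
  by (simp add: kappa_def)

lemma chi_moment:
  assumes I: "I \<subseteq> {..<n}" "I \<noteq> {}"
  shows "integrable (exp_sample n) (\<lambda>x. chi I x ^ 6)" "(\<integral>x. chi I x ^ 6 \<partial>exp_sample n) \<le> kappa"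
proof -
  interpret prob_space "exp_sample n" by (rule prob_space_exp_sample)
  define l where "l = real (card I)"
  have "finite I" using I finite_subset by auto
  then have l1: "l \<ge> 1" using I by (simp add: l_def Suc_leI card_gt_0_iff)
  note mom = exp_sample_sum_central_moment[OF I, folded l_def]
  have [measurable]: "(\<lambda>x. sum x I) \<in> borel_measurable (exp_sample n)"
    using exp_sample_sum_power(1)[OF I, of 1] by auto
  have [measurable]: "chi I \<in> borel_measurable (exp_sample n)"
    unfolding chi_def[abs_def] by measurable
  have bd: "chi I x ^ 6 \<le> 32 * (1 + (sum x I - l) ^ 12 / l ^ 6)" for x
  proof -
    \<comment> \<open>Squares first, then cubes: \<open>(1 + y)^2 <= 2 (1 + y^2)\<close> is cubed,
      and \<open>8 * 4 = 32\<close> is the factor in \<open>kappa\<close>.\<close>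
    have aux: "(1 + y) ^ 6 \<le> 32 * (1 + y ^ 6)" if "y \<ge> 0" for y :: real
    proof -
      have "(1 + y) ^ 2 \<le> 2 * (1 + y ^ 2)"
        using zero_le_power2[of "1 - y"] by (simp add: power2_eq_square algebra_simps)
      then have "((1 + y) ^ 2) ^ 3 \<le> (2 * (1 + y ^ 2)) ^ 3" by (intro power_mono) auto
      moreover have "(1 + y ^ 2) ^ 3 \<le> 4 * (1 + y ^ 6)"
        using cube_add_le[of 1 "y\<^sup>2"] by (simp add: power_mult[symmetric])
      moreover have "((1 + y) ^ 2) ^ 3 = (1 + y) ^ 6" "(2 * (1 + y ^ 2)) ^ 3 = 8 * (1 + y ^ 2) ^ 3"
        by (simp_all only: power_mult[symmetric] power_mult_distrib) simp_all
      ultimately show ?thesis by linarith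
    qed
    have "((sum x I - l)\<^sup>2 / l) ^ 6 = (sum x I - l) ^ 12 / l ^ 6"
      by (simp add: power_divide)
    then show ?thesis
      using aux[of "(sum x I - l)\<^sup>2 / l"] l1 by (simp add: chi_def l_def)
  qed
  show int: "integrable (exp_sample n) (\<lambda>x. chi I x ^ 6)"
  proof (rule Bochner_Integration.integrable_bound)
    show "integrable (exp_sample n) (\<lambda>x. 32 * (1 + (sum x I - l) ^ 12 / l ^ 6))"
      using mom(1)[of 12] by simp
    show "AE x in exp_sample n. norm (chi I x ^ 6) \<le> norm (32 * (1 + (sum x I - l) ^ 12 / l ^ 6))"
    proof (rule AE_I2)
      fix x
      have "norm (chi I x ^ 6) = chi I x ^ 6" by simp
      also note bd[of x]
      finally show "norm (chi I x ^ 6) \<le> norm (32 * (1 + (sum x I - l) ^ 12 / l ^ 6))"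
        unfolding real_norm_def by (rule order_trans[OF _ abs_ge_self])
    qed
  qed measurable
  have "(\<integral>x. chi I x ^ 6 \<partial>exp_sample n) \<le> (\<integral>x. 32 * (1 + (sum x I - l) ^ 12 / l ^ 6) \<partial>exp_sample n)"
    by (rule integral_mono) (use int bd mom(1)[of 12] in auto)
  also have "\<dots> = 32 * (1 + (\<integral>x. (sum x I - l) ^ 12 \<partial>exp_sample n) / l ^ 6)"
    using mom(1)[of 12] by (simp add: prob_space)
  also have "\<dots> \<le> kappa"
    using mom(2) l1 by (simp add: kappa_def field_simps)
  finally show "(\<integral>x. chi I x ^ 6 \<partial>exp_sample n) \<le> kappa" .
qed

lemma norm3_chi:
  assumes I: "I \<subseteq> {..<n}" "I \<noteq> {}"
  shows "in_L3 (exp_sample n) (\<lambda>x. (chi I x)\<^sup>2)" "norm3 (exp_sample n) (\<lambda>x. (chi I x)\<^sup>2) \<le> kappa"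
proof -
  have [measurable]: "(\<lambda>x. sum x I) \<in> borel_measurable (exp_sample n)"
    using exp_sample_sum_power(1)[OF I, of 1] by auto
  have [measurable]: "chi I \<in> borel_measurable (exp_sample n)"
    unfolding chi_def[abs_def] by measurable
  have eq: "\<bar>(chi I x)\<^sup>2\<bar> ^ 3 = chi I x ^ 6" for x by simp
  show "in_L3 (exp_sample n) (\<lambda>x. (chi I x)\<^sup>2)"
    unfolding in_L3_def eq using chi_moment(1)[OF I] by simp
  \<comment> \<open>The cube of the norm is at most \<open>kappa\<close>; using \<open>kappa\<close>
    in place of its cube root only enlarges the constant.\<close>
  have "kappa \<le> kappa ^ 3" by (simp add: kappa_def)
  then show "norm3 (exp_sample n) (\<lambda>x. (chi I x)\<^sup>2) \<le> kappa"
    using chi_moment(2)[OF I] kappa_ge_one by (intro norm3_le) (simp_all add: eq)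
qed

section \<open>Comparison of spacings and exponentials\<close>

text \<open>Measurability on \<open>PiM I\<close> only concerns functions that are
  \<open>undefined\<close> off \<open>I\<close>. Invariance under restriction extends it to
  arbitrary arguments, so that the same \<open>F\<close> can be evaluated at spacings and at
  exponentials.\<close>

definition depends_on :: "nat set \<Rightarrow> ((nat \<Rightarrow> real) \<Rightarrow> real) \<Rightarrow> bool" where
  "depends_on I F \<longleftrightarrow> F \<in> borel_measurable (PiM I (\<lambda>_. borel)) \<and> (\<forall>x. F (restrict x I) = F x)"

lemma depends_on_mono:
  assumes "depends_on I F" "I \<subseteq> J"
  shows "depends_on J F"
proof -
  have "(\<lambda>x. F (restrict x I)) \<in> borel_measurable (PiM J (\<lambda>_. borel))"
    using assms by (intro measurable_compose[OF measurable_restrict_subset[OF assms(2)]]) (auto simp: depends_on_def)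
  then have "F \<in> borel_measurable (PiM J (\<lambda>_. borel))"
    using assms(1) by (simp add: depends_on_def)
  moreover have "F (restrict x J) = F x" for x
    using assms by (metis Int_absorb1 depends_on_def restrict_restrict)
  ultimately show ?thesis by (simp add: depends_on_def)
qed

lemma depends_on_borel_measurable:
  assumes "depends_on I F" "I \<subseteq> {..<n}"
  shows "F \<in> borel_measurable (exp_sample n)"
proof -
  have "F \<in> borel_measurable (PiM {..<n} (\<lambda>_. borel))"
    using depends_on_mono[OF assms] by (simp add: depends_on_def)
  then show ?thesis
    by (simp add: exp_sample_def cong: measurable_cong_sets sets_PiM_cong)
qed

lemma depends_on_const: "depends_on I (\<lambda>_. c)"
  by (simp add: depends_on_def)

lemma depends_on_sum: "finite I \<Longrightarrow> depends_on I (\<lambda>x. sum x I)"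
  by (auto simp: depends_on_def)

lemma depends_on_compose:
  assumes "depends_on I F" "g \<in> borel_measurable borel"
  shows "depends_on I (\<lambda>x. g (F x))"
  using assms by (auto simp: depends_on_def intro: measurable_compose)

lemma depends_on_mult:
  assumes "depends_on I F" "depends_on I G"
  shows "depends_on I (\<lambda>x. F x * G x)"
  using assms by (auto simp: depends_on_def)

lemma depends_on_diff:
  assumes "depends_on I F" "depends_on I G"
  shows "depends_on I (\<lambda>x. F x - G x)"
  using assms by (auto simp: depends_on_def)

definition gaps :: "nat \<Rightarrow> (nat \<Rightarrow> real) \<Rightarrow> nat \<Rightarrow> real" where
  "gaps n \<omega> i = real n * spacing n \<omega> i"

text \<open>The formula for nonnegative integrands, applied to indicators, identifies two image
  measures on the coordinates in \<open>I\<close>; integrability and integrals of signed functions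
  follow from this equality.\<close>

lemma gaps_transfer:
  fixes F :: "(nat \<Rightarrow> real) \<Rightarrow> real"
  assumes I: "I \<subseteq> {..<n}" "card I < n" and F: "depends_on I F"
  shows "integrable (unif_sample n) (\<lambda>\<omega>. F (gaps n \<omega>)) \<longleftrightarrow>
      integrable (exp_sample n) (\<lambda>x. gap_density n (card I) (sum x I) * F x)"
    and "(\<integral>\<omega>. F (gaps n \<omega>) \<partial>unif_sample n) = (\<integral>x. gap_density n (card I) (sum x I) * F x \<partial>exp_sample n)"
    and "(\<lambda>\<omega>. F (gaps n \<omega>)) \<in> borel_measurable (unif_sample n)"
proof -
  let ?P = "PiM I (\<lambda>_. borel :: real measure)"
  let ?r = "\<lambda>x. gap_density n (card I) (sum x I)"
  let ?E = "density (exp_sample n) (\<lambda>x. ennreal (?r x))"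
  have fin: "finite I" using I finite_subset by auto
  have Fm: "F \<in> borel_measurable ?P" and Fr: "\<And>x. F (restrict x I) = F x"
    using F by (auto simp: depends_on_def)
  have r: "?r \<in> borel_measurable (exp_sample n)"
    by (intro depends_on_borel_measurable[OF _ I(1)] depends_on_compose[OF depends_on_sum[OF fin]]
        borel_measurable_gap_density)
  have re: "(\<lambda>x. ennreal (?r x)) \<in> borel_measurable (exp_sample n)"
    using r by (rule measurable_compose[OF _ measurable_ennreal])
  have g: "(\<lambda>\<omega>. restrict (gaps n \<omega>) I) \<in> measurable (unif_sample n) ?P"
  proof -
    have "n > 0" using I by auto
    from measurable_compose[OF measurable_spacing[OF this] measurable_restrict_subset[OF I(1)]]
    show ?thesis
      using I(1) by (simp add: gaps_def[abs_def] restrict_restrict Int_absorb1)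
  qed
  have res: "(\<lambda>x. restrict x I) \<in> measurable (exp_sample n) ?P"
  proof -
    have "(\<lambda>x. restrict x I) \<in> measurable (PiM {..<n} (\<lambda>_. borel)) ?P"
      by (rule measurable_restrict_subset[OF I(1)])
    then show ?thesis
      by (simp add: exp_sample_def cong: measurable_cong_sets sets_PiM_cong)
  qed
  then have resE: "(\<lambda>x. restrict x I) \<in> measurable ?E ?P"
    by simp
  have eq: "distr (unif_sample n) ?P (\<lambda>\<omega>. restrict (gaps n \<omega>) I) = distr ?E ?P (\<lambda>x. restrict x I)"
  proof (rule measure_eqI)
    fix A assume "A \<in> sets (distr (unif_sample n) ?P (\<lambda>\<omega>. restrict (gaps n \<omega>) I))"
    then have A: "A \<in> sets ?P" by simp
    then have iA: "indicator A \<in> borel_measurable ?P" by simp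
    have "emeasure (distr (unif_sample n) ?P (\<lambda>\<omega>. restrict (gaps n \<omega>) I)) A =
       (\<integral>\<^sup>+\<omega>. indicator A (restrict (gaps n \<omega>) I) \<partial>unif_sample n)"
      using nn_integral_distr[OF g, of "indicator A"] A by simp
    also have "\<dots> = (\<integral>\<^sup>+x. indicator A (restrict x I) * ennreal (?r x) \<partial>exp_sample n)"
      using nn_integral_spacings_eq_exp_sample[OF I iA] by (simp add: gaps_def[abs_def])
    also have "\<dots> = (\<integral>\<^sup>+x. indicator A (restrict x I) \<partial>?E)"
      using measurable_compose[OF res iA] re by (subst nn_integral_density) (auto simp: mult.commute)
    also have "\<dots> = emeasure (distr ?E ?P (\<lambda>x. restrict x I)) A"
      using nn_integral_distr[OF resE, of "indicator A"] A by simp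
    finally show "emeasure (distr (unif_sample n) ?P (\<lambda>\<omega>. restrict (gaps n \<omega>) I)) A = 
        emeasure (distr ?E ?P (\<lambda>x. restrict x I)) A" .
  qed simp
  have Fexp: "F \<in> borel_measurable (exp_sample n)"
    by (rule depends_on_borel_measurable[OF F I(1)])
  have nn: "AE x in exp_sample n. 0 \<le> ?r x" by (simp add: gap_density_nonneg)
  have "integrable (unif_sample n) (\<lambda>\<omega>. F (gaps n \<omega>)) \<longleftrightarrow> 
      integrable (distr (unif_sample n) ?P (\<lambda>\<omega>. restrict (gaps n \<omega>) I)) F"
    by (subst integrable_distr_eq[OF g Fm]) (simp add: Fr)
  also have "\<dots> \<longleftrightarrow> integrable ?E F"
    unfolding eq by (subst integrable_distr_eq[OF resE Fm]) (simp add: Fr)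
  also have "\<dots> \<longleftrightarrow> integrable (exp_sample n) (\<lambda>x. ?r x * F x)"
    using integrable_density[OF Fexp r nn] by simp
  finally show "integrable (unif_sample n) (\<lambda>\<omega>. F (gaps n \<omega>)) \<longleftrightarrow> integrable (exp_sample n) (\<lambda>x. ?r x * F x)" .
  have "(\<integral>\<omega>. F (gaps n \<omega>) \<partial>unif_sample n) = 
      integral\<^sup>L (distr (unif_sample n) ?P (\<lambda>\<omega>. restrict (gaps n \<omega>) I)) F"
    by (subst integral_distr[OF g Fm]) (simp add: Fr)
  also have "\<dots> = integral\<^sup>L ?E F"
    unfolding eq by (subst integral_distr[OF resE Fm]) (simp add: Fr)
  also have "\<dots> = (\<integral>x. ?r x * F x \<partial>exp_sample n)"
    using integral_density[OF Fexp r nn] by simp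
  finally show "(\<integral>\<omega>. F (gaps n \<omega>) \<partial>unif_sample n) = (\<integral>x. ?r x * F x \<partial>exp_sample n)" .
  show "(\<lambda>\<omega>. F (gaps n \<omega>)) \<in> borel_measurable (unif_sample n)"
    using measurable_compose[OF g Fm] by (simp add: Fr)
qed

text \<open>\<open>D\<close> collects the factors that do not involve \<open>s\<close>. Its value
  stays open here and is recovered from the total mass.\<close>

lemma gap_density_eq_profile:
  assumes "l < n"
  obtains D where "D \<ge> 0" "\<And>s. gap_density n l s = D * gap_profile (n - l) (s - real l)"
proof
  let ?N = "real (n - l)"
  let ?D = "fact (n - 1) / (real n ^ (n - 1) * fact (n - 1 - l)) * (?N ^ (n - 1 - l) * exp (real l))"
  show "?D \<ge> 0" by simp
  fix s
  have N: "?N = real n - real l" "?N > 0" using assms by auto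
  have "(real n - s) ^ (n - 1 - l) = ?N ^ (n - 1 - l) * (1 - (s - real l) / ?N) ^ (n - l - 1)"
  proof -
    have "real n - s = ?N * (1 - (s - real l) / ?N)"
      using N by (simp add: field_simps)
    then show ?thesis
      by (metis diff_commute power_mult_distrib)
  qed
  moreover have "exp s = exp (real l) * exp (s - real l)"
    by (simp add: exp_add[symmetric])
  moreover have "s \<le> real n \<longleftrightarrow> s - real l \<le> ?N" using N by simp
  ultimately show "gap_density n l s = ?D * gap_profile (n - l) (s - real l)"
    by (simp only: gap_density_def gap_profile_def) simp
qed

text \<open>The expansions of the profile are multiplied by \<open>D\<close>, which is controlled
  through \<open>D * p = 1\<close> with \<open>p\<close> the expectation of the profile. Only the
  coefficient \<open>1 / (2 n)\<close> has to be exact: for centred functions of disjoint blocks the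
  terms with \<open>a\<close> and \<open>b\<close> integrate to zero.\<close>

lemma gap_density_estimates:
  assumes I: "I \<subseteq> {..<n}" "I \<noteq> {}" and small: "1000000 * kappa * real (card I) \<le> real n"
  defines "l \<equiv> real (card I)"
  shows "card I < n"
    and "\<bar>gap_density n (card I) (sum x I) - 1\<bar> \<le> 500000 * kappa * (l / real n) * chi I x"
    and "\<exists>a b. \<forall>x. \<bar>gap_density n (card I) (sum x I) - (a + b * (sum x I - l) - (sum x I - l)\<^sup>2 / (2 * real n))\<bar>
           \<le> 500000 * kappa * (l / real n)\<^sup>2 * (chi I x)\<^sup>2"
proof -
  interpret prob_space "exp_sample n" by (rule prob_space_exp_sample)
  let ?\<rho> = "\<lambda>x. gap_density n (card I) (sum x I)"
  have fin: "finite I" using I finite_subset by auto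
  then have l1: "l \<ge> 1" using I by (simp add: l_def Suc_leI card_gt_0_iff)
  have k1: "kappa \<ge> 1" by (rule kappa_ge_one)
  have "1000000 * l \<le> 1000000 * kappa * l" using k1 l1 by simp
  with small have nl: "real n \<ge> 1000000 * l" unfolding l_def by linarith
  show ln: "card I < n" using nl l1 by (simp add: l_def)
  define N where "N = n - card I"
  have N: "real N = real n - l" using ln by (simp add: N_def l_def)
  then have N4: "N \<ge> 4" and Nn: "real N \<ge> real n / 2" "real N > 0" using nl l1 by linarith+
  have n0: "real n > 0" using nl l1 by linarith
  obtain D where D: "D \<ge> 0" "\<And>s. gap_density n (card I) s = D * gap_profile N (s - l)"
    using gap_density_eq_profile[OF ln] unfolding N_def l_def by metis
  define q where "q = l / real n"
  have q0: "q > 0" using l1 n0 by (simp add: q_def)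
  have qsmall: "1000000 * kappa * q \<le> 1" using small n0 by (simp add: q_def l_def field_simps)
  define t where "t x = sum x I - l" for x
  have chi: "chi I x = 1 + (t x)\<^sup>2 / l" "chi I x \<ge> 1" for x
    by (simp_all add: chi_def t_def l_def)
  \<comment> \<open>\<open>N >= n / 2\<close> and \<open>l >= 1\<close> turn the error variable of
    the profile into \<open>2 q chi\<close>; this doubles 30001 to 60002.\<close>
  have w: "(1 + (t x)\<^sup>2) / real N \<le> 2 * q * chi I x" "0 \<le> (1 + (t x)\<^sup>2) / real N" for x
  proof -
    have "(1 + (t x)\<^sup>2) / real N \<le> (l + (t x)\<^sup>2) / (real n / 2)"
      using l1 n0 Nn by (intro frac_le) auto
    also have "\<dots> = 2 * q * chi I x"
      using l1 n0 by (simp add: q_def chi(1) add_divide_distrib distrib_left mult.commute)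
    finally show "(1 + (t x)\<^sup>2) / real N \<le> 2 * q * chi I x" .
  qed auto
  have p1: "\<bar>gap_profile N (t x) - 1\<bar> \<le> 60002 * q * chi I x" for x
    using gap_profile_minus_one[OF N4, of "t x"] w(1)[of x] by linarith
  have sm: "(\<lambda>x. sum x I) \<in> borel_measurable (exp_sample n)"
    by (rule depends_on_borel_measurable[OF depends_on_sum[OF fin] I(1)])
  have pm: "(\<lambda>x. gap_profile N (t x)) \<in> borel_measurable (exp_sample n)"
    unfolding gap_profile_def t_def using sm by measurable
  have pint: "integrable (exp_sample n) (\<lambda>x. gap_profile N (t x))"
    by (rule integrable_const_bound[where B = 3])
       (use pm N4 gap_profile_nonneg[of N] gap_profile_le[of N] in auto)
  have cint: "integrable (exp_sample n) (chi I)" and cE: "(\<integral>x. chi I x \<partial>exp_sample n) \<le> kappa"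
  proof -
    have le: "chi I x \<le> chi I x ^ 6" for x
      using chi(2)[of x] self_le_power[of "chi I x" 6] by simp
    have cm: "chi I \<in> borel_measurable (exp_sample n)"
      unfolding chi_def[abs_def] using sm by measurable
    show i: "integrable (exp_sample n) (chi I)"
    proof (rule Bochner_Integration.integrable_bound[OF chi_moment(1)[OF I] cm], rule AE_I2)
      fix x show "norm (chi I x) \<le> norm (chi I x ^ 6)"
        using le[of x] chi(2)[of x] by simp
    qed
    have "(\<integral>x. chi I x \<partial>exp_sample n) \<le> (\<integral>x. chi I x ^ 6 \<partial>exp_sample n)"
      by (rule integral_mono[OF i chi_moment(1)[OF I] le])
    also have "\<dots> \<le> kappa" by (rule chi_moment(2)[OF I])
    finally show "(\<integral>x. chi I x \<partial>exp_sample n) \<le> kappa" .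
  qed
  define p where "p = (\<integral>x. gap_profile N (t x) \<partial>exp_sample n)"
  have "\<bar>p - 1\<bar> = \<bar>\<integral>x. (gap_profile N (t x) - 1) \<partial>exp_sample n\<bar>"
    using pint by (simp add: p_def prob_space)
  also have "\<dots> \<le> (\<integral>x. \<bar>gap_profile N (t x) - 1\<bar> \<partial>exp_sample n)"
    by (rule integral_abs_bound)
  also have "\<dots> \<le> (\<integral>x. 60002 * q * chi I x \<partial>exp_sample n)"
    by (rule integral_mono) (use pint cint p1 in auto)
  also have "\<dots> \<le> 60002 * q * kappa"
    using cE q0 by simp
  finally have p: "\<bar>p - 1\<bar> \<le> 60002 * kappa * q" by (simp add: mult_ac)
  \<comment> \<open>The constant in \<open>small\<close> keeps \<open>p\<close> away from zero, so
    that \<open>D\<close> is bounded.\<close>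
  then have p12: "p \<ge> 1/2" using qsmall by linarith
  \<comment> \<open>Transferring the constant function 1 shows that \<open>gap_density\<close> has
    expectation 1.\<close>
  have "D * p = (\<integral>x. ?\<rho> x * 1 \<partial>exp_sample n)"
    by (simp add: D(2) p_def t_def)
  also have "\<dots> = (\<integral>\<omega>. 1 \<partial>unif_sample n)"
    by (rule gaps_transfer(2)[OF I(1) ln depends_on_const, symmetric])
  also have "\<dots> = 1"
    using prob_space.prob_space[OF prob_space_unif_sample] by simp
  finally have Dp: "D * p = 1" .
  have D2: "D \<le> 2"
    using Dp p12 D(1) mult_left_mono[of "1/2" p D] by simp
  have "\<bar>D - 1\<bar> = D * \<bar>p - 1\<bar>"
    using Dp D(1) by (metis abs_minus_commute abs_mult abs_of_nonneg mult.right_neutral right_diff_distrib)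
  also have "\<dots> \<le> 2 * (60002 * kappa * q)"
    using D2 D(1) p by (intro mult_mono) auto
  finally have D1: "\<bar>D - 1\<bar> \<le> 120004 * kappa * q" by simp
  have rho: "?\<rho> x = D * gap_profile N (t x)" for x
    by (simp add: D(2) t_def)
  have kq: "q \<le> kappa * q" using k1 q0 by simp
  show "\<bar>?\<rho> x - 1\<bar> \<le> 500000 * kappa * (l / real n) * chi I x"
  proof -
    have "\<bar>?\<rho> x - 1\<bar> \<le> D * \<bar>gap_profile N (t x) - 1\<bar> + \<bar>D - 1\<bar>"
    proof -
      have "?\<rho> x - 1 = D * (gap_profile N (t x) - 1) + (D - 1)"
        by (simp add: rho algebra_simps)
      then show ?thesis
        using abs_triangle_ineq[of "D * (gap_profile N (t x) - 1)" "D - 1"] D(1) by (simp add: abs_mult)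
    qed
    also have "\<dots> \<le> 2 * (60002 * q * chi I x) + 120004 * kappa * q * chi I x"
    proof (rule add_mono)
      show "D * \<bar>gap_profile N (t x) - 1\<bar> \<le> 2 * (60002 * q * chi I x)"
        using D2 p1 by (intro mult_mono) auto
      have "120004 * kappa * q \<le> 120004 * kappa * q * chi I x"
        using chi(2)[of x] q0 k1 by simp
      with D1 show "\<bar>D - 1\<bar> \<le> 120004 * kappa * q * chi I x" by linarith
    qed
    also have "\<dots> \<le> 120004 * (kappa * q) * chi I x + 120004 * kappa * q * chi I x"
      using mult_right_mono[OF kq, of "chi I x"] chi(2)[of x] by simp
    also have "\<dots> \<le> 500000 * kappa * q * chi I x"
      using chi(2)[of x] q0 k1 by simp
    finally show ?thesis by (simp add: q_def)
  qed
  show "\<exists>a b. \<forall>x. \<bar>?\<rho> x - (a + b * (sum x I - l) - (sum x I - l)\<^sup>2 / (2 * real n))\<bar>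
           \<le> 500000 * kappa * (l / real n)\<^sup>2 * (chi I x)\<^sup>2"
  proof (intro exI allI)
    fix x
    let ?c = "chi I x"
    have qc: "0 \<le> q\<^sup>2 * ?c\<^sup>2" by simp
    have a: "\<bar>gap_profile N (t x) - (1 + t x / real N - (t x)\<^sup>2 / (2 * real N))\<bar> \<le> 120000 * (q\<^sup>2 * ?c\<^sup>2)"
    proof -
      have "((1 + (t x)\<^sup>2) / real N)\<^sup>2 \<le> (2 * q * ?c)\<^sup>2"
        using w[of x] by (intro power_mono) auto
      then show ?thesis
        using gap_profile_expansion[OF N4, of "t x"] by (simp add: power_mult_distrib)
    qed
    \<comment> \<open>The coefficient \<open>D / (2 N)\<close> produced by the profile is replaced
      by \<open>1 / (2 n)\<close>. The relative error has order \<open>q\<close>, one part from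
      \<open>D - 1\<close> and one from \<open>n - N = l\<close>; multiplied by
      \<open>t^2 <= l chi\<close> it is of order \<open>q^2\<close>.\<close>
    have b: "\<bar>D / (2 * real N) - 1 / (2 * real n)\<bar> \<le> (120004 * kappa + 1) * q / real n"
    proof -
      have "D / (2 * real N) - 1 / (2 * real n) = (D - 1) / (2 * real N) + l / (2 * real N * real n)"
      proof -
        have "l = real n - real N" using N by simp
        then have "l / (2 * real N * real n) = 1 / (2 * real N) - 1 / (2 * real n)"
          using Nn n0 by (simp add: diff_divide_distrib)
        then show ?thesis by (simp add: diff_divide_distrib)
      qed
      also have "\<bar>\<dots>\<bar> \<le> \<bar>D - 1\<bar> / (2 * real N) + l / (2 * real N * real n)"
        using Nn n0 l1 by (intro order_trans[OF abs_triangle_ineq]) (simp add: abs_divide)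
      also have "\<dots> \<le> (120004 * kappa * q) / real n + l / (real n * real n)"
        using D1 Nn n0 l1 by (intro add_mono frac_le mult_right_mono) auto
      also have "\<dots> = (120004 * kappa + 1) * q / real n"
        by (simp add: q_def add_divide_distrib algebra_simps)
      finally show ?thesis .
    qed
    have tc: "(t x)\<^sup>2 \<le> l * ?c" using l1 by (simp add: chi(1) field_simps)
    have c: "(t x)\<^sup>2 * \<bar>D / (2 * real N) - 1 / (2 * real n)\<bar> \<le> (120004 * kappa + 1) * (q\<^sup>2 * ?c\<^sup>2)"
    proof -
      have "(t x)\<^sup>2 * \<bar>D / (2 * real N) - 1 / (2 * real n)\<bar> \<le> (l * ?c) * ((120004 * kappa + 1) * q / real n)"
        using tc b l1 chi(2)[of x] by (intro mult_mono) auto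
      also have "\<dots> = (120004 * kappa + 1) * (q\<^sup>2 * ?c)"
        by (simp add: q_def power2_eq_square)
      also have "\<dots> \<le> (120004 * kappa + 1) * (q\<^sup>2 * ?c\<^sup>2)"
        using chi(2)[of x] k1 by (intro mult_left_mono) (auto simp: power2_eq_square)
      finally show ?thesis .
    qed
    have "?\<rho> x - (D + D / real N * (sum x I - l) - (sum x I - l)\<^sup>2 / (2 * real n)) = 
       D * (gap_profile N (t x) - (1 + t x / real N - (t x)\<^sup>2 / (2 * real N)))
        - (t x)\<^sup>2 * (D / (2 * real N) - 1 / (2 * real n))"
      by (simp add: rho t_def[symmetric] algebra_simps)
    also have "\<bar>\<dots>\<bar> \<le> D * \<bar>gap_profile N (t x) - (1 + t x / real N - (t x)\<^sup>2 / (2 * real N))\<bar>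
        + (t x)\<^sup>2 * \<bar>D / (2 * real N) - 1 / (2 * real n)\<bar>"
      using D(1) by (intro order_trans[OF abs_triangle_ineq4]) (simp add: abs_mult)
    also have "\<dots> \<le> 2 * (120000 * (q\<^sup>2 * ?c\<^sup>2)) + (120004 * kappa + 1) * (q\<^sup>2 * ?c\<^sup>2)"
      using a D2 by (intro add_mono[OF mult_mono c]) auto
    also have "\<dots> = (240001 + 120004 * kappa) * (q\<^sup>2 * ?c\<^sup>2)"
      by (simp add: algebra_simps)
    also have "\<dots> \<le> (500000 * kappa) * (q\<^sup>2 * ?c\<^sup>2)"
      using k1 by (intro mult_right_mono) auto
    finally show "\<bar>?\<rho> x - (D + D / real N * (sum x I - l) - (sum x I - l)\<^sup>2 / (2 * real n))\<bar>
           \<le> 500000 * kappa * (l / real n)\<^sup>2 * (chi I x)\<^sup>2"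
      by (simp add: q_def mult.assoc)
  qed
qed

lemma integral_mult_disjoint:
  assumes F: "depends_on I F" "I \<subseteq> {..<n}" "integrable (exp_sample n) F"
    and G: "depends_on J G" "J \<subseteq> {..<n}" "integrable (exp_sample n) G"
    and disj: "I \<inter> J = {}"
  shows "integrable (exp_sample n) (\<lambda>x. F x * G x)"
    and "(\<integral>x. F x * G x \<partial>exp_sample n) = (\<integral>x. F x \<partial>exp_sample n) * (\<integral>x. G x \<partial>exp_sample n)"
proof -
  interpret prob_space "exp_sample n" by (rule prob_space_exp_sample)
  have "indep_var borel (F \<circ> (\<lambda>x. restrict x I)) borel (G \<circ> (\<lambda>x. restrict x J))"
    using F(1) G(1)
    by (intro indep_var_compose[OF indep_var_restrict[OF indep_vars_exp_sample disj F(2) G(2)]])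
       (auto simp: depends_on_def)
  moreover have "F \<circ> (\<lambda>x. restrict x I) = F" "G \<circ> (\<lambda>x. restrict x J) = G"
    using F(1) G(1) by (auto simp: depends_on_def)
  ultimately have ind: "indep_var borel F borel G" by simp
  show "integrable (exp_sample n) (\<lambda>x. F x * G x)"
    by (rule indep_var_integrable[OF ind F(3) G(3)])
  show "(\<integral>x. F x * G x \<partial>exp_sample n) = (\<integral>x. F x \<partial>exp_sample n) * (\<integral>x. G x \<partial>exp_sample n)"
    by (rule indep_var_lebesgue_integral[OF ind F(3) G(3)])
qed

text \<open>\<open>|t| <= sqrt l * chi\<close> and \<open>1 <= chi\<close>, so the bound for
  \<open>chi^2\<close> also controls \<open>t\<close> and \<open>t^2\<close>. The factor
  \<open>sqrt l\<close> is the standard deviation of the sum.\<close>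

lemma norm3_centred_sum:
  assumes I: "I \<subseteq> {..<n}" "I \<noteq> {}"
  defines "l \<equiv> real (card I)"
  shows "in_L3 (exp_sample n) (\<lambda>x. sum x I - l)"
    and "in_L3 (exp_sample n) (\<lambda>x. (sum x I - l)\<^sup>2)"
    and "norm3 (exp_sample n) (\<lambda>x. sum x I - l) \<le> sqrt l * kappa"
proof -
  have fin: "finite I" using I finite_subset by auto
  then have l1: "l \<ge> 1" using I by (simp add: l_def Suc_leI card_gt_0_iff)
  have sm [measurable]: "(\<lambda>x. sum x I) \<in> borel_measurable (exp_sample n)"
    by (rule depends_on_borel_measurable[OF depends_on_sum[OF fin] I(1)])
  note L3 = norm3_chi(1)[OF I, THEN in_L3_cmult]
  have c: "(sum x I - l)\<^sup>2 \<le> l * (chi I x)\<^sup>2" for x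
  proof -
    have "(sum x I - l)\<^sup>2 \<le> l * chi I x"
      using l1 by (simp add: chi_def l_def field_simps)
    also have "\<dots> \<le> l * (chi I x)\<^sup>2"
      using l1 chi_ge_one[of I x] by (simp add: power2_eq_square)
    finally show ?thesis .
  qed
  show "in_L3 (exp_sample n) (\<lambda>x. (sum x I - l)\<^sup>2)"
    by (rule in_L3_bound(1)[OF L3[of l]]) (use c l1 in auto)
  have s: "\<bar>sum x I - l\<bar> \<le> \<bar>sqrt l * (chi I x)\<^sup>2\<bar>" for x
  proof -
    have "\<bar>sum x I - l\<bar> \<le> sqrt (l * (chi I x)\<^sup>2)"
      using c[of x] by (simp add: real_le_rsqrt)
    also have "\<dots> = sqrt l * chi I x"
      using chi_ge_one[of I x] by (simp add: real_sqrt_mult)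
    also have "\<dots> \<le> sqrt l * (chi I x)\<^sup>2"
      using l1 chi_ge_one[of I x] by (intro mult_left_mono) (auto simp: power2_eq_square)
    finally show ?thesis using l1 by simp
  qed
  show "in_L3 (exp_sample n) (\<lambda>x. sum x I - l)"
    by (rule in_L3_bound(1)[OF L3[of "sqrt l"] _ s]) simp
  have "norm3 (exp_sample n) (\<lambda>x. sum x I - l) \<le> norm3 (exp_sample n) (\<lambda>x. sqrt l * (chi I x)\<^sup>2)"
    by (rule in_L3_bound(2)[OF L3[of "sqrt l"] _ s]) simp
  also have "\<dots> \<le> sqrt l * kappa"
    using norm3_chi(2)[OF I] l1 by (simp add: norm3_cmult mult_left_mono)
  finally show "norm3 (exp_sample n) (\<lambda>x. sum x I - l) \<le> sqrt l * kappa" .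
qed

text \<open>The difference of the two expectations is that of \<open>F G\<close> times the density
  minus 1, to which Hoelder applies. The case \<open>G = 1\<close> controls single means.\<close>

lemma gaps_product_moment:
  assumes I: "I \<subseteq> {..<n}" "I \<noteq> {}" and small: "1000000 * kappa * real (card I) \<le> real n"
    and F: "depends_on I F" "in_L3 (exp_sample n) F"
    and G: "depends_on I G" "in_L3 (exp_sample n) G"
  shows "integrable (unif_sample n) (\<lambda>\<omega>. F (gaps n \<omega>) * G (gaps n \<omega>))"
    and "\<bar>(\<integral>\<omega>. F (gaps n \<omega>) * G (gaps n \<omega>) \<partial>unif_sample n) - (\<integral>x. F x * G x \<partial>exp_sample n)\<bar>
      \<le> 500000 * kappa\<^sup>2 * (real (card I) / real n) * (norm3 (exp_sample n) F * norm3 (exp_sample n) G)"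
proof -
  interpret prob_space "exp_sample n" by (rule prob_space_exp_sample)
  let ?\<rho> = "\<lambda>x. gap_density n (card I) (sum x I)"
  define q where "q = real (card I) / real n"
  note est = gap_density_estimates[OF I small, folded q_def]
  have fin: "finite I" using I finite_subset by auto
  have k0: "kappa > 0" using kappa_ge_one by simp
  have q0: "q \<ge> 0" by (simp add: q_def)
  have FG: "depends_on I (\<lambda>x. F x * G x)" by (rule depends_on_mult[OF F(1) G(1)])
  note tr = gaps_transfer[OF I(1) est(1) FG]
  have rm: "(\<lambda>x. ?\<rho> x - 1) \<in> borel_measurable (exp_sample n)"
    by (intro depends_on_borel_measurable[OF _ I(1)] depends_on_diff depends_on_const
        depends_on_compose[OF depends_on_sum[OF fin]] borel_measurable_gap_density)
  note L3 = norm3_chi(1)[OF I, THEN in_L3_cmult, of "500000 * kappa * q"]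
  have bd: "\<bar>?\<rho> x - 1\<bar> \<le> \<bar>500000 * kappa * q * (chi I x)\<^sup>2\<bar>" for x
  proof -
    have "500000 * kappa * q * chi I x \<le> 500000 * kappa * q * (chi I x)\<^sup>2"
      using chi_ge_one[of I x] k0 q0 by (intro mult_left_mono) (auto simp: power2_eq_square)
    with est(2)[of x] show ?thesis by linarith
  qed
  have e: "in_L3 (exp_sample n) (\<lambda>x. ?\<rho> x - 1)"
    by (rule in_L3_bound(1)[OF L3 rm bd])
  have ne: "norm3 (exp_sample n) (\<lambda>x. ?\<rho> x - 1) \<le> 500000 * kappa\<^sup>2 * q"
  proof -
    have "norm3 (exp_sample n) (\<lambda>x. ?\<rho> x - 1) \<le> norm3 (exp_sample n) (\<lambda>x. 500000 * kappa * q * (chi I x)\<^sup>2)"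
      by (rule in_L3_bound(2)[OF L3 rm bd])
    also have "\<dots> = 500000 * kappa * q * norm3 (exp_sample n) (\<lambda>x. (chi I x)\<^sup>2)"
      using k0 q0 by (simp add: norm3_cmult)
    also have "\<dots> \<le> 500000 * kappa * q * kappa"
      using norm3_chi(2)[OF I] k0 q0 by (intro mult_left_mono) auto
    finally show ?thesis by (simp add: power2_eq_square mult_ac)
  qed
  note h = holder3[OF F(2) G(2) e]
  have int: "integrable (exp_sample n) (\<lambda>x. F x * G x)"
    by (rule in_L3_integrable(2)[OF F(2) G(2)])
  have split: "?\<rho> x * (F x * G x) = F x * G x * (?\<rho> x - 1) + F x * G x" for x
    by (simp add: algebra_simps)
  show "integrable (unif_sample n) (\<lambda>\<omega>. F (gaps n \<omega>) * G (gaps n \<omega>))"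
    unfolding tr(1) split using h(1) int by simp
  have "(\<integral>\<omega>. F (gaps n \<omega>) * G (gaps n \<omega>) \<partial>unif_sample n) - (\<integral>x. F x * G x \<partial>exp_sample n) =
      (\<integral>x. F x * G x * (?\<rho> x - 1) \<partial>exp_sample n)"
    unfolding tr(2) split using h(1) int by simp
  also have "\<bar>\<dots>\<bar> \<le> norm3 (exp_sample n) F * norm3 (exp_sample n) G * norm3 (exp_sample n) (\<lambda>x. ?\<rho> x - 1)"
    by (rule h(2))
  also have "\<dots> \<le> norm3 (exp_sample n) F * norm3 (exp_sample n) G * (500000 * kappa\<^sup>2 * q)"
    using ne by (intro mult_left_mono) (auto simp: norm3_nonneg)
  finally show "\<bar>(\<integral>\<omega>. F (gaps n \<omega>) * G (gaps n \<omega>) \<partial>unif_sample n) - (\<integral>x. F x * G x \<partial>exp_sample n)\<bar>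
      \<le> 500000 * kappa\<^sup>2 * (real (card I) / real n) * (norm3 (exp_sample n) F * norm3 (exp_sample n) G)"
    by (simp add: q_def mult_ac)
qed

text \<open>The second expansion is used on the union of the blocks, which has \<open>2 m\<close>
  indices; squaring \<open>2 m / n\<close> turns 500000 into 2000000.\<close>

lemma gaps_product_moment_disjoint:
  assumes I: "I \<subseteq> {..<n}" "card I = m" and J: "J \<subseteq> {..<n}" "card J = m"
    and m: "m > 0" and disj: "I \<inter> J = {}" and small: "2000000 * kappa * real m \<le> real n"
    and F: "depends_on I F" "in_L3 (exp_sample n) F" "(\<integral>x. F x \<partial>exp_sample n) = 0"
    and G: "depends_on J G" "in_L3 (exp_sample n) G" "(\<integral>x. G x \<partial>exp_sample n) = 0"
  shows "\<bar>(\<integral>\<omega>. F (gaps n \<omega>) * G (gaps n \<omega>) \<partial>unif_sample n) +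
        (\<integral>x. F x * (sum x I - real m) \<partial>exp_sample n) * (\<integral>x. G x * (sum x J - real m) \<partial>exp_sample n) / real n\<bar>
      \<le> 2000000 * kappa\<^sup>2 * (real m / real n)\<^sup>2 * (norm3 (exp_sample n) F * norm3 (exp_sample n) G)"
proof -
  interpret prob_space "exp_sample n" by (rule prob_space_exp_sample)
  let ?E = "exp_sample n"
  define K where "K = I \<union> J"
  have fin: "finite I" "finite J" "finite K" using I J finite_subset by (auto simp: K_def)
  have cK: "card K = 2 * m" using fin disj I J by (simp add: K_def card_Un_disjoint)
  have ne: "I \<noteq> {}" "J \<noteq> {}" "K \<noteq> {}" using m I J by (auto simp: K_def)
  have K: "K \<subseteq> {..<n}" using I J by (simp add: K_def)
  have FK: "depends_on K F" and GK: "depends_on K G"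
    using F G depends_on_mono by (auto simp: K_def)
  have smallK: "1000000 * kappa * real (card K) \<le> real n" using small by (simp add: cK)
  let ?\<rho> = "\<lambda>x. gap_density n (card K) (sum x K)"
  define q where "q = real (card K) / real n"
  note est = gap_density_estimates[OF K ne(3) smallK, folded q_def]
  have k0: "kappa > 0" using kappa_ge_one by simp
  have n0: "real n > 0" using est(1) by simp
  define tI tJ where "tI x = sum x I - real m" and "tJ x = sum x J - real m" for x
  obtain a b where ab: "\<And>x. \<bar>?\<rho> x - (a + b * (sum x K - real (card K)) - (sum x K - real (card K))\<^sup>2 / (2 * real n))\<bar>
           \<le> 500000 * kappa * q\<^sup>2 * (chi K x)\<^sup>2"
    using est(3) by blast
  have tK: "sum x K - real (card K) = tI x + tJ x" for x
    using fin disj by (simp add: K_def[symmetric] cK tI_def tJ_def) (simp add: K_def sum.union_disjoint)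
  define p where "p x = a + b * (tI x + tJ x) - (tI x + tJ x)\<^sup>2 / (2 * real n)" for x
  define e where "e x = ?\<rho> x - p x" for x
  have sm: "(\<lambda>x. sum x I) \<in> borel_measurable ?E" "(\<lambda>x. sum x J) \<in> borel_measurable ?E"
      "(\<lambda>x. ?\<rho> x) \<in> borel_measurable ?E"
    using depends_on_borel_measurable[OF depends_on_sum[OF fin(1)] I(1)]
      depends_on_borel_measurable[OF depends_on_sum[OF fin(2)] J(1)]
      depends_on_borel_measurable[OF depends_on_compose[OF depends_on_sum[OF fin(3)] borel_measurable_gap_density] K]
    by auto
  have em: "e \<in> borel_measurable ?E"
    unfolding e_def[abs_def] p_def tI_def tJ_def using sm by measurable
  note L3 = norm3_chi(1)[OF K ne(3), THEN in_L3_cmult, of "500000 * kappa * q\<^sup>2"]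
  have bd: "\<bar>e x\<bar> \<le> \<bar>500000 * kappa * q\<^sup>2 * (chi K x)\<^sup>2\<bar>" for x
    using ab[of x] unfolding tK e_def p_def by linarith
  have e: "in_L3 ?E e"
    by (rule in_L3_bound(1)[OF L3 em bd])
  have ne: "norm3 ?E e \<le> 500000 * kappa\<^sup>2 * q\<^sup>2"
  proof -
    have "norm3 ?E e \<le> norm3 ?E (\<lambda>x. 500000 * kappa * q\<^sup>2 * (chi K x)\<^sup>2)"
      by (rule in_L3_bound(2)[OF L3 em bd])
    also have "\<dots> = 500000 * kappa * q\<^sup>2 * norm3 ?E (\<lambda>x. (chi K x)\<^sup>2)"
      using k0 by (simp add: norm3_cmult)
    also have "\<dots> \<le> 500000 * kappa * q\<^sup>2 * kappa"
      using norm3_chi(2)[OF K ne(3)] k0 by (intro mult_left_mono) auto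
    finally show ?thesis by (simp add: power2_eq_square mult_ac)
  qed
  note h = holder3[OF F(2) G(2) e]
  have tI: "depends_on I tI" "in_L3 ?E tI" "in_L3 ?E (\<lambda>x. (tI x)\<^sup>2)"
    and tJ: "depends_on J tJ" "in_L3 ?E tJ" "in_L3 ?E (\<lambda>x. (tJ x)\<^sup>2)"
    using norm3_centred_sum(1,2)[of I n] norm3_centred_sum(1,2)[of J n] I J \<open>I \<noteq> {}\<close> \<open>J \<noteq> {}\<close>
      depends_on_diff[OF depends_on_sum[OF fin(1)] depends_on_const]
      depends_on_diff[OF depends_on_sum[OF fin(2)] depends_on_const]
    by (auto simp: tI_def[abs_def] tJ_def[abs_def])
  have F1: "depends_on I (\<lambda>x. F x * tI x)" "integrable ?E (\<lambda>x. F x * tI x)"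
    and F2: "depends_on I (\<lambda>x. F x * (tI x)\<^sup>2)" "integrable ?E (\<lambda>x. F x * (tI x)\<^sup>2)"
    and F0: "integrable ?E F"
    using F(1,2) tI depends_on_compose[OF tI(1), of "\<lambda>y. y\<^sup>2"]
    by (auto intro!: depends_on_mult in_L3_integrable)
  have G1: "depends_on J (\<lambda>x. G x * tJ x)" "integrable ?E (\<lambda>x. G x * tJ x)"
    and G2: "depends_on J (\<lambda>x. G x * (tJ x)\<^sup>2)" "integrable ?E (\<lambda>x. G x * (tJ x)\<^sup>2)"
    and G0: "integrable ?E G"
    using G(1,2) tJ depends_on_compose[OF tJ(1), of "\<lambda>y. y\<^sup>2"]
    by (auto intro!: depends_on_mult in_L3_integrable)
  note prod = integral_mult_disjoint[OF _ I(1) _ _ J(1) _ disj]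
  note p00 = prod[OF F(1) F0 G(1) G0] and p10 = prod[OF F1 G(1) G0] and p01 = prod[OF F(1) F0 G1]
    and p20 = prod[OF F2 G(1) G0] and p11 = prod[OF F1 G1] and p02 = prod[OF F(1) F0 G2]
  \<comment> \<open>Each summand of the polynomial part is arranged as a function of
    \<open>I\<close> times a function of \<open>J\<close>. The cross term has coefficient
    \<open>1 / n\<close> because \<open>2 tI tJ\<close> is divided by \<open>2 n\<close>.\<close>
  have expand: "?\<rho> x * (F x * G x) = F x * G x * e x + (a * (F x * G x) + b * ((F x * tI x) * G x)
      + b * (F x * (G x * tJ x)) - 1 / (2 * real n) * ((F x * (tI x)\<^sup>2) * G x)
      - 1 / real n * ((F x * tI x) * (G x * tJ x)) - 1 / (2 * real n) * (F x * (G x * (tJ x)\<^sup>2)))" for x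
    using n0 by (simp add: e_def p_def field_simps power2_eq_square)
  have "(\<integral>\<omega>. F (gaps n \<omega>) * G (gaps n \<omega>) \<partial>unif_sample n) = (\<integral>x. ?\<rho> x * (F x * G x) \<partial>?E)"
    by (rule gaps_transfer(2)[OF K est(1) depends_on_mult[OF FK GK]])
  also have "\<dots> = (\<integral>x. F x * G x * e x \<partial>?E) - 1 / real n * ((\<integral>x. F x * tI x \<partial>?E) * (\<integral>x. G x * tJ x \<partial>?E))"
    unfolding expand using h(1) p00 p10 p01 p20 p11 p02 F(3) G(3) by simp
  finally have "\<bar>(\<integral>\<omega>. F (gaps n \<omega>) * G (gaps n \<omega>) \<partial>unif_sample n) +
      (\<integral>x. F x * tI x \<partial>?E) * (\<integral>x. G x * tJ x \<partial>?E) / real n\<bar> = \<bar>\<integral>x. F x * G x * e x \<partial>?E\<bar>"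
    by simp
  also have "\<dots> \<le> norm3 ?E F * norm3 ?E G * norm3 ?E e" by (rule h(2))
  also have "\<dots> \<le> norm3 ?E F * norm3 ?E G * (500000 * kappa\<^sup>2 * q\<^sup>2)"
    using ne by (intro mult_left_mono) (auto simp: norm3_nonneg)
  also have "\<dots> = 2000000 * kappa\<^sup>2 * (real m / real n)\<^sup>2 * (norm3 ?E F * norm3 ?E G)"
    by (simp add: q_def cK power_mult_distrib power_divide)
  finally show ?thesis by (simp add: tI_def tJ_def)
qed

section \<open>Cyclic blocks and the variance\<close>

text \<open>One full turn adds 1 to both end points of a gap.\<close>

lemma spacing_mod:
  assumes n: "n > 0"
  shows "spacing n \<omega> (k mod n) = spacing n \<omega> k"
proof (induction k rule: less_induct)
  case (less k)
  show ?case
  proof (cases "k < n")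
    case False
    have u: "unif_order n \<omega> j = 1 + unif_order n \<omega> (j - n)" if "j \<ge> n" for j
      using that n by (subst unif_order.simps) simp
    have "spacing n \<omega> k = spacing n \<omega> (k - n)"
      using False u[of k] u[of "Suc k"] by (simp add: spacing_def Suc_diff_le)
    also have "\<dots> = spacing n \<omega> ((k - n) mod n)"
      using less.IH[of "k - n"] False n by simp
    also have "(k - n) mod n = k mod n"
      using False by (simp add: mod_if[of k n])
    finally show ?thesis ..
  qed simp
qed

lemma wrap_less: "n > 0 \<Longrightarrow> wrap n j < n"
  by (simp add: wrap_def nat_less_iff)

lemma wrap_of_nat: "wrap n (int k) = k mod n"
  by (simp add: wrap_def nat_mod_as_int)

lemma wrap_eq_iff: "n > 0 \<Longrightarrow> wrap n i = wrap n j \<longleftrightarrow> i mod int n = j mod int n"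
  by (simp add: wrap_def nat_eq_iff)

lemma wrap_wrap_add: "n > 0 \<Longrightarrow> wrap n (int (wrap n j) + i) = wrap n (j + i)"
  by (simp add: wrap_def mod_add_left_eq)

lemma X_block_wrap: "n > 0 \<Longrightarrow> X_block n m (int (wrap n j)) = X_block n m j"
  by (auto simp: X_block_def wrap_wrap_add)

lemma h_exp_wrap: "n > 0 \<Longrightarrow> h_exp n m h (int (wrap n j)) = h_exp n m h j"
  using wrap_wrap_add[of n j 0] by (auto simp: h_exp_def[abs_def] X_block_wrap)

text \<open>The coordinates on which the \<open>k\<close>-th summand depends. As a set it ignores
  repetitions, so summing over it gives the block total once \<open>m <= n\<close>.\<close>

definition block :: "nat \<Rightarrow> nat \<Rightarrow> nat \<Rightarrow> nat set" where
  "block n m k = (\<lambda>i. wrap n (int k + int i)) ` {..<m}"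

text \<open>Congruent integers at distance less than \<open>n\<close> coincide.\<close>

lemma inj_on_wrap:
  assumes n: "n > 0" and S: "\<And>i j. i \<in> S \<Longrightarrow> j \<in> S \<Longrightarrow> i - j < int n"
  shows "inj_on (wrap n) S"
proof (rule inj_onI)
  fix i j assume ij: "i \<in> S" "j \<in> S" "wrap n i = wrap n j"
  then have "int n dvd i - j" using n by (simp add: wrap_eq_iff mod_eq_dvd_iff)
  moreover have "\<bar>i - j\<bar> < int n" using S[OF ij(1,2)] S[OF ij(2,1)] by linarith
  ultimately show "i = j"
    using zdvd_imp_le[of "int n" "\<bar>i - j\<bar>"] by force
qed

lemma inj_on_block:
  assumes "0 < n" "m \<le> n"
  shows "inj_on (\<lambda>i. wrap n (int k + int i)) {..<m}"
proof -
  have "inj_on (wrap n) ((\<lambda>i. int k + int i) ` {..<m})"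
    using assms by (intro inj_on_wrap) auto
  moreover have "inj_on (\<lambda>i. int k + int i) {..<m}" by (auto simp: inj_on_def)
  ultimately show ?thesis
    by (auto simp: inj_on_def)
qed

lemma card_block: "0 < n \<Longrightarrow> m \<le> n \<Longrightarrow> card (block n m k) = m"
  unfolding block_def by (simp add: card_image inj_on_block)

lemma block_subset: "0 < n \<Longrightarrow> block n m k \<subseteq> {..<n}"
  by (auto simp: block_def wrap_less)

lemma X_sum_eq_sum_block:
  assumes "0 < n" "m \<le> n"
  shows "X_sum n m (int k) x = sum x (block n m k)"
  unfolding block_def X_sum_def X_block_def using inj_on_block[OF assms]
  by (subst sum.reindex) auto

text \<open>The summation window as a set of residues, so that its complement in
  \<open>{..<n}\<close> is available. For \<open>2 m <= n\<close> its \<open>2 m - 1\<close>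
  integers have distinct residues and no term is lost.\<close>

definition neighbours :: "nat \<Rightarrow> nat \<Rightarrow> nat \<Rightarrow> nat set" where
  "neighbours n m k = wrap n ` {int k - int m + 1..int k + int m - 1}"

lemma sum_neighbours:
  assumes "0 < n" "2 * m \<le> n"
  shows "(\<Sum>j\<in>{int k - int m + 1..int k + int m - 1}. f (wrap n j)) = sum f (neighbours n m k)"
proof -
  have "inj_on (wrap n) {int k - int m + 1..int k + int m - 1}"
    using assms by (intro inj_on_wrap) auto
  then show ?thesis by (simp add: neighbours_def sum.reindex)
qed

lemma neighbours_subset: "0 < n \<Longrightarrow> neighbours n m k \<subseteq> {..<n}"
  by (auto simp: neighbours_def wrap_less)

text \<open>A common coordinate, \<open>k + i\<close> congruent to \<open>j + i'\<close>, puts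
  \<open>j\<close> at the residue of \<open>k + i - i'\<close>, which lies in the window because
  \<open>i\<close> and \<open>i'\<close> are below \<open>m\<close>.\<close>

lemma block_disjoint:
  assumes n: "0 < n" and j: "j < n" "j \<notin> neighbours n m k"
  shows "block n m k \<inter> block n m j = {}"
proof (rule ccontr)
  assume "block n m k \<inter> block n m j \<noteq> {}"
  then obtain i i' where i: "i < m" "i' < m" "wrap n (int k + int i) = wrap n (int j + int i')"
    by (auto simp: block_def)
  have "(int k + int i) mod int n = (int j + int i') mod int n"
    using i(3) n by (simp add: wrap_eq_iff)
  then have "(int k + int i - int i') mod int n = (int j + int i' - int i') mod int n"
    by (rule mod_diff_cong) simp
  then have "wrap n (int k + int i - int i') = wrap n (int j)"
    using n by (simp add: wrap_eq_iff)
  then have "wrap n (int k + int i - int i') = j"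
    using j(1) by (simp add: wrap_of_nat)
  moreover have "int k + int i - int i' \<in> {int k - int m + 1..int k + int m - 1}"
    using i by auto
  ultimately show False using j(2) by (auto simp: neighbours_def)
qed

lemma depends_on_h_exp:
  assumes n: "0 < n" and h: "h (wrap n k) \<in> borel_measurable (PiM {..<m} (\<lambda>_. borel))" and k: "k = int k'"
  shows "depends_on (block n m k') (h_exp n m h k)"
proof -
  let ?B = "block n m k'"
  have w: "wrap n (k + int i) \<in> ?B" if "i < m" for i
    using that by (auto simp: block_def k)
  have "X_block n m k \<in> measurable (PiM ?B (\<lambda>_. borel)) (PiM {..<m} (\<lambda>_. borel))"
    unfolding X_block_def[abs_def]
    by (intro measurable_restrict measurable_component_singleton) (auto intro: w)
  then have "h_exp n m h k \<in> borel_measurable (PiM ?B (\<lambda>_. borel))"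
    unfolding h_exp_def[abs_def] using h by (rule measurable_compose)
  moreover have "X_block n m k (restrict x ?B) = X_block n m k x" for x
    using w by (auto simp: X_block_def restrict_def fun_eq_iff)
  ultimately show ?thesis
    by (simp add: depends_on_def h_exp_def)
qed

text \<open>Periodicity of the spacings matches the wrapped indices, so each summand is the same
  function \<open>h_exp\<close>, evaluated at spacings instead of exponentials.\<close>

lemma R_stat_eq_gaps:
  assumes n: "0 < n"
  shows "R_stat n m h \<omega> = (\<Sum>k<n. h_exp n m h (int k) (gaps n \<omega>))"
  unfolding R_stat_def
proof (intro sum.cong refl)
  fix k assume "k \<in> {..<n}"
  then have k: "wrap n (int k) = k" by (simp add: wrap_of_nat)
  have w: "wrap n (int k + int i) = (k + i) mod n" for i
    by (metis of_nat_add wrap_of_nat)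
  show "h k (\<lambda>i\<in>{..<m}. real n * spacing n \<omega> (k + i)) = h_exp n m h (int k) (gaps n \<omega>)"
    unfolding h_exp_def k X_block_def w gaps_def spacing_mod[OF n] ..
qed

section \<open>The variance for a fixed sample size\<close>

lemma expectation_exp_sample_sum:
  assumes "I \<subseteq> {..<n}" "I \<noteq> {}"
  shows "(\<integral>x. sum x I \<partial>exp_sample n) = real (card I)"
  using exp_sample_sum_power(2)[OF assms, of 1] by simp

text \<open>\<open>n_large\<close> stands in for \<open>m = o(n)\<close>. It is twice the threshold
  for one block, because a pair of blocks occupies up to \<open>2 m\<close> coordinates.\<close>

locale spacing_statistic =
  fixes n m :: nat and h :: "nat \<Rightarrow> (nat \<Rightarrow> real) \<Rightarrow> real"
  assumes m_pos: "m > 0" and n_large: "2000000 * kappa * real m \<le> real n"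
    and h_measurable: "\<And>k. k < n \<Longrightarrow> h k \<in> borel_measurable (PiM {..<m} (\<lambda>_. borel))"
    and h_third_moment: "\<And>k. k < n \<Longrightarrow> integrable (exp_sample n) (\<lambda>x. \<bar>h_exp n m h (int k) x\<bar> ^ 3)"
begin

sublocale E: prob_space "exp_sample n" by (rule prob_space_exp_sample)
sublocale U: prob_space "unif_sample n" by (rule prob_space_unif_sample)

lemma n_ge: "2 * m \<le> n" "n > 0" "m \<le> n"
proof -
  have "2000000 * real m \<le> 2000000 * kappa * real m"
    using kappa_ge_one by (intro mult_right_mono) auto
  then have "2000000 * real m \<le> real n" using n_large by linarith
  then have "2 * real m \<le> real n" by linarith
  then show "2 * m \<le> n" by linarith
  then show "n > 0" "m \<le> n" using m_pos by auto
qed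

definition centred :: "nat \<Rightarrow> (nat \<Rightarrow> real) \<Rightarrow> real" where
  "centred k x = h_exp n m h (int k) x - E.expectation (h_exp n m h (int k))"

definition third :: "nat \<Rightarrow> real" where
  "third k = norm3 (exp_sample n) (centred k)"

definition cov_sum :: "nat \<Rightarrow> real" where
  "cov_sum k = (\<integral>x. centred k x * (sum x (block n m k) - real m) \<partial>exp_sample n)"

abbreviation "blk \<equiv> block n m"

lemma blk: "blk k \<subseteq> {..<n}" "card (blk k) = m" "blk k \<noteq> {}"
  using card_block[of n m k] block_subset[of n m k] n_ge m_pos by auto

lemma wrap_id: "k < n \<Longrightarrow> wrap n (int k) = k"
  by (simp add: wrap_of_nat)

lemma h_exp_depends: "k < n \<Longrightarrow> depends_on (blk k) (h_exp n m h (int k))"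
  using n_ge h_measurable[of k] by (intro depends_on_h_exp) (simp_all add: wrap_id)

lemma h_exp_L3: "k < n \<Longrightarrow> in_L3 (exp_sample n) (h_exp n m h (int k))"
  using depends_on_borel_measurable[OF h_exp_depends blk(1)] h_third_moment by (simp add: in_L3_def)

lemma centred_depends: "k < n \<Longrightarrow> depends_on (blk k) (centred k)"
  unfolding centred_def[abs_def] by (intro depends_on_diff h_exp_depends depends_on_const)

lemma centred_L3: "k < n \<Longrightarrow> in_L3 (exp_sample n) (centred k)"
  unfolding centred_def[abs_def]
  using in_L3_add[OF h_exp_L3 E.in_L3_const[of "- E.expectation (h_exp n m h (int k))"]] by simp

lemma centred_mean: "k < n \<Longrightarrow> (\<integral>x. centred k x \<partial>exp_sample n) = 0"
  using E.in_L3_integrable(1)[OF h_exp_L3 h_exp_L3] by (simp add: centred_def[abs_def] E.prob_space)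

lemma third_nonneg: "third k \<ge> 0"
  by (simp add: third_def norm3_nonneg)

lemma third_eq: "abs_mom3 n m h (int k) powr (1 / 3) = third k"
  by (simp add: third_def norm3_def abs_mom3_def centred_def)

lemma abs_mom3_wrap: "abs_mom3 n m h (int (wrap n j)) = abs_mom3 n m h j"
  by (simp add: abs_mom3_def h_exp_wrap n_ge)

lemma covar_h_h: "covar (exp_sample n) (h_exp n m h (int k)) (h_exp n m h j) =
    (\<integral>x. centred k x * centred (wrap n j) x \<partial>exp_sample n)"
  by (simp add: covar_def centred_def h_exp_wrap n_ge)

lemma covar_h_sum: "covar (exp_sample n) (h_exp n m h (int k)) (X_sum n m (int k)) = cov_sum k"
proof -
  have "X_sum n m (int k) = (\<lambda>x. sum x (blk k))"
    using X_sum_eq_sum_block[OF n_ge(2,3)] by auto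
  then show ?thesis
    using expectation_exp_sample_sum[OF blk(1,3)] by (simp add: covar_def cov_sum_def centred_def blk(2))
qed

lemma sigma_sq_eq:
  "sigma_sq n m h = (\<Sum>k<n. \<Sum>j\<in>neighbours n m k. \<integral>x. centred k x * centred j x \<partial>exp_sample n)
     - (\<Sum>k<n. cov_sum k)\<^sup>2 / real n"
proof -
  have C: "C_stat n m h = (1 / real n) * (\<Sum>k<n. \<Sum>j\<in>neighbours n m k. \<integral>x. centred k x * centred j x \<partial>exp_sample n)"
    unfolding C_stat_def covar_h_h
    by (subst sum_neighbours[OF n_ge(2,1), where f = "\<lambda>j. \<integral>x. centred _ x * centred j x \<partial>exp_sample n"]) simp
  have B: "B_stat n m h = (1 / real n) * (\<Sum>k<n. cov_sum k)"
    by (simp add: B_stat_def covar_h_sum)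
  show ?thesis
    unfolding sigma_sq_def B C using n_ge by (simp add: right_diff_distrib power2_eq_square)
qed

lemma error_sum_eq:
  "(\<Sum>k<n. \<Sum>j\<in>{int k - int m + 1..int k + int m - 1}. (abs_mom3 n m h (int k) * abs_mom3 n m h j) powr (1 / 3))
    = (\<Sum>k<n. \<Sum>j\<in>neighbours n m k. third k * third j)"
proof (intro sum.cong refl)
  fix k
  have nn: "abs_mom3 n m h j \<ge> 0" for j by (simp add: abs_mom3_def)
  have "(abs_mom3 n m h (int k) * abs_mom3 n m h j) powr (1 / 3) = third k * third (wrap n j)" for j
    using nn by (simp add: powr_mult third_eq[symmetric] abs_mom3_wrap)
  then show "(\<Sum>j\<in>{int k - int m + 1..int k + int m - 1}. (abs_mom3 n m h (int k) * abs_mom3 n m h j) powr (1 / 3))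
    = (\<Sum>j\<in>neighbours n m k. third k * third j)"
    by (simp add: sum_neighbours[OF n_ge(2,1), where f = "\<lambda>j. third k * third j"])
qed

lemma pair_support:
  assumes "k < n" "j < n"
  shows "blk k \<union> blk j \<subseteq> {..<n}" "blk k \<union> blk j \<noteq> {}"
    "1000000 * kappa * real (card (blk k \<union> blk j)) \<le> real n"
    "depends_on (blk k \<union> blk j) (centred k)" "depends_on (blk k \<union> blk j) (centred j)"
    "real (card (blk k \<union> blk j)) / real n \<le> 2 * (real m / real n)"
proof -
  have c: "card (blk k \<union> blk j) \<le> 2 * m"
    using card_Un_le[of "blk k" "blk j"] by (simp add: blk(2))
  then have "1000000 * kappa * real (card (blk k \<union> blk j)) \<le> 1000000 * kappa * real (2 * m)"
    using kappa_ge_one by (intro mult_left_mono) auto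
  then show "1000000 * kappa * real (card (blk k \<union> blk j)) \<le> real n"
    using n_large by simp
  have "real (card (blk k \<union> blk j)) / real n \<le> real (2 * m) / real n"
    using c by (intro divide_right_mono) linarith+
  then show "real (card (blk k \<union> blk j)) / real n \<le> 2 * (real m / real n)" by simp
  show "depends_on (blk k \<union> blk j) (centred k)" "depends_on (blk k \<union> blk j) (centred j)"
    using depends_on_mono[OF centred_depends[OF assms(1)], of "blk k \<union> blk j"]
      depends_on_mono[OF centred_depends[OF assms(2)], of "blk k \<union> blk j"] by auto
qed (use blk in auto)

lemma pair_integrable:
  assumes "k < n" "j < n"
  shows "integrable (unif_sample n) (\<lambda>\<omega>. centred k (gaps n \<omega>) * centred j (gaps n \<omega>))"
  using pair_support[OF assms] assms centred_L3 by (intro gaps_product_moment(1)) auto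

text \<open>The union of two blocks has at most \<open>2 m\<close> elements, whence twice 500000.
  Overlap is allowed, so this serves the neighbouring pairs.\<close>

lemma pair_close:
  assumes "k < n" "j < n"
  shows "\<bar>(\<integral>\<omega>. centred k (gaps n \<omega>) * centred j (gaps n \<omega>) \<partial>unif_sample n)
      - (\<integral>x. centred k x * centred j x \<partial>exp_sample n)\<bar> \<le> 1000000 * kappa\<^sup>2 * (real m / real n) * (third k * third j)"
proof -
  note s = pair_support[OF assms]
  have "\<bar>(\<integral>\<omega>. centred k (gaps n \<omega>) * centred j (gaps n \<omega>) \<partial>unif_sample n)
      - (\<integral>x. centred k x * centred j x \<partial>exp_sample n)\<bar>
     \<le> 500000 * kappa\<^sup>2 * (real (card (blk k \<union> blk j)) / real n) * (third k * third j)"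
    unfolding third_def
    by (intro gaps_product_moment(2) s centred_L3 assms)
  also have "\<dots> \<le> 500000 * kappa\<^sup>2 * (2 * (real m / real n)) * (third k * third j)"
    using s(6) by (intro mult_right_mono mult_left_mono) (auto simp: third_nonneg)
  finally show ?thesis by simp
qed

lemma pair_far:
  assumes k: "k < n" and j: "j < n" "j \<notin> neighbours n m k"
  shows "\<bar>(\<integral>\<omega>. centred k (gaps n \<omega>) * centred j (gaps n \<omega>) \<partial>unif_sample n) + cov_sum k * cov_sum j / real n\<bar>
    \<le> 2000000 * kappa\<^sup>2 * (real m / real n)\<^sup>2 * (third k * third j)"
  unfolding third_def cov_sum_def
  using n_ge m_pos n_large k j
  by (intro gaps_product_moment_disjoint blk block_disjoint centred_depends centred_L3 centred_mean) auto

text \<open>Hoelder with the constant 1 as third function. Since \<open>sqrt m\<close> bounds the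
  deviation of the block total, a product of two such covariances divided by \<open>n\<close> has
  order \<open>m / n\<close>.\<close>

lemma cov_sum_bound:
  assumes k: "k < n"
  shows "\<bar>cov_sum k\<bar> \<le> sqrt (real m) * kappa * third k"
proof -
  note c = norm3_centred_sum[OF blk(1,3)[of k], unfolded blk(2)]
  have "\<bar>cov_sum k\<bar> \<le> third k * norm3 (exp_sample n) (\<lambda>x. sum x (blk k) - real m) * 1"
    using holder3(2)[OF centred_L3[OF k] c(1) E.in_L3_const[of 1]]
    by (simp add: cov_sum_def third_def E.norm3_one)
  also have "\<dots> \<le> third k * (sqrt (real m) * kappa)"
    using c(3) third_nonneg by (simp add: mult_left_mono)
  finally show ?thesis by (simp add: mult_ac)
qed

text \<open>The centring refers to the exponentials; under the spacings a mean of relative order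
  \<open>m / n\<close> may remain.\<close>

lemma mean_bound:
  assumes k: "k < n"
  shows "integrable (unif_sample n) (\<lambda>\<omega>. centred k (gaps n \<omega>))"
    and "\<bar>\<integral>\<omega>. centred k (gaps n \<omega>) \<partial>unif_sample n\<bar> \<le> 500000 * kappa\<^sup>2 * (real m / real n) * third k"
proof -
  have "1000000 * kappa * real m \<le> 2000000 * kappa * real m" using kappa_ge_one by simp
  then have s: "1000000 * kappa * real (card (blk k)) \<le> real n" using n_large by (simp add: blk(2))
  note g = gaps_product_moment[OF blk(1,3) s centred_depends[OF k] centred_L3[OF k] depends_on_const[of _ 1] E.in_L3_const[of 1]]
  show "integrable (unif_sample n) (\<lambda>\<omega>. centred k (gaps n \<omega>))" using g(1) by simp
  show "\<bar>\<integral>\<omega>. centred k (gaps n \<omega>) \<partial>unif_sample n\<bar> \<le> 500000 * kappa\<^sup>2 * (real m / real n) * third k"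
    using g(2) centred_mean[OF k] by (simp add: blk(2) E.norm3_one third_def)
qed

lemma R_stat_centred:
  "R_stat n m h \<omega> = (\<Sum>k<n. centred k (gaps n \<omega>)) + (\<Sum>k<n. E.expectation (h_exp n m h (int k)))"
  by (simp add: R_stat_eq_gaps[OF n_ge(2)] centred_def sum.distrib[symmetric])

text \<open>Guarantees that the variance is a genuine integral and not the default value 0 of a
  non-integrable function.\<close>

lemma R_stat_square_integrable: "integrable (unif_sample n) (\<lambda>\<omega>. (R_stat n m h \<omega>)\<^sup>2)"
proof -
  let ?c = "\<Sum>k<n. E.expectation (h_exp n m h (int k))"
  have "(R_stat n m h \<omega>)\<^sup>2 = (\<Sum>k<n. \<Sum>j<n. centred k (gaps n \<omega>) * centred j (gaps n \<omega>))
      + 2 * ?c * (\<Sum>k<n. centred k (gaps n \<omega>)) + ?c\<^sup>2" for \<omega>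
    unfolding R_stat_centred sum_product[symmetric] by (simp add: power2_eq_square algebra_simps)
  then show ?thesis
    by (simp only:) (intro Bochner_Integration.integrable_add Bochner_Integration.integrable_sum
        integrable_mult_right pair_integrable mean_bound(1) U.integrable_const; simp)
qed

lemma variance_R_stat:
  "U.variance (R_stat n m h) =
     (\<Sum>k<n. \<Sum>j<n. \<integral>\<omega>. centred k (gaps n \<omega>) * centred j (gaps n \<omega>) \<partial>unif_sample n)
     - (\<Sum>k<n. \<integral>\<omega>. centred k (gaps n \<omega>) \<partial>unif_sample n)\<^sup>2"
proof -
  let ?T = "\<lambda>\<omega>. \<Sum>k<n. centred k (gaps n \<omega>)"
  have iT: "integrable (unif_sample n) ?T" using mean_bound(1) by auto
  have sq: "(?T \<omega>)\<^sup>2 = (\<Sum>k<n. \<Sum>j<n. centred k (gaps n \<omega>) * centred j (gaps n \<omega>))" for \<omega>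
    by (simp add: power2_eq_square sum_product)
  have iT2: "integrable (unif_sample n) (\<lambda>\<omega>. (?T \<omega>)\<^sup>2)"
    unfolding sq by (intro Bochner_Integration.integrable_sum pair_integrable) auto
  have "U.variance (R_stat n m h) = U.variance ?T"
    using iT by (simp add: R_stat_centred[abs_def] U.prob_space)
  also have "\<dots> = U.expectation (\<lambda>\<omega>. (?T \<omega>)\<^sup>2) - (U.expectation ?T)\<^sup>2"
    by (rule U.variance_eq[OF iT iT2])
  also have "U.expectation ?T = (\<Sum>k<n. \<integral>\<omega>. centred k (gaps n \<omega>) \<partial>unif_sample n)"
    using mean_bound(1) by (intro Bochner_Integration.integral_sum) auto
  also have "U.expectation (\<lambda>\<omega>. (?T \<omega>)\<^sup>2) =
      (\<Sum>k<n. \<Sum>j<n. \<integral>\<omega>. centred k (gaps n \<omega>) * centred j (gaps n \<omega>) \<partial>unif_sample n)"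
    unfolding sq
    by (subst Bochner_Integration.integral_sum, intro Bochner_Integration.integrable_sum pair_integrable)
       (auto intro!: sum.cong Bochner_Integration.integral_sum pair_integrable)
  finally show ?thesis .
qed

text \<open>Three errors are added: neighbouring pairs contribute order \<open>q\<close>, disjoint
  pairs order \<open>q^2\<close>, and the square of the remaining mean order
  \<open>q^2\<close>.\<close>

lemma variance_error:
  defines "q \<equiv> real m / real n" and "A \<equiv> 1000000 * kappa\<^sup>2"
  shows "\<bar>U.variance (R_stat n m h) - sigma_sq n m h\<bar> \<le>
    (A + kappa\<^sup>2) * q * (\<Sum>k<n. \<Sum>j\<in>neighbours n m k. third k * third j)
     + (2 * A + A\<^sup>2) * q\<^sup>2 * (\<Sum>k<n. third k)\<^sup>2"
proof -
  define u where "u k j = (\<integral>\<omega>. centred k (gaps n \<omega>) * centred j (gaps n \<omega>) \<partial>unif_sample n)" for k j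
  define c where "c k j = (\<integral>x. centred k x * centred j x \<partial>exp_sample n)" for k j
  define v where "v k = (\<integral>\<omega>. centred k (gaps n \<omega>) \<partial>unif_sample n)" for k
  let ?N = "neighbours n m"
  have q0: "q \<ge> 0" by (simp add: q_def)
  have split: "(\<Sum>j<n. f j) = (\<Sum>j\<in>?N k. f j) + (\<Sum>j\<in>{..<n} - ?N k. f j)" for f :: "nat \<Rightarrow> real" and k
    using neighbours_subset[OF n_ge(2), of m k] by (metis add.commute finite_lessThan sum.subset_diff)
  have split2: "(\<Sum>k<n. \<Sum>j<n. f k j) = (\<Sum>k<n. \<Sum>j\<in>?N k. f k j) + (\<Sum>k<n. \<Sum>j\<in>{..<n} - ?N k. f k j)"
    for f :: "nat \<Rightarrow> nat \<Rightarrow> real"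
    by (subst sum.distrib[symmetric]) (rule sum.cong[OF refl split])
  \<comment> \<open>\<open>n B^2\<close> runs over all pairs, whereas neighbouring pairs are
    compared with the exponential covariance alone; the extra product is bounded by
    \<open>kappa^2 q\<close> times the norms.\<close>
  have near: "\<bar>u k j - c k j + cov_sum k * cov_sum j / real n\<bar> \<le> (A + kappa\<^sup>2) * q * (third k * third j)"
    if kj: "k < n" "j \<in> ?N k" for k j
  proof -
    have j: "j < n" using kj neighbours_subset[OF n_ge(2), of m k] by auto
    have "\<bar>cov_sum k * cov_sum j / real n\<bar> \<le> (sqrt (real m) * kappa * third k) * (sqrt (real m) * kappa * third j) / real n"
      unfolding abs_divide abs_mult
      using cov_sum_bound[OF kj(1)] cov_sum_bound[OF j] kappa_ge_one third_nonneg
      by (auto intro!: divide_right_mono mult_mono)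
    also have "\<dots> = (sqrt (real m) * sqrt (real m)) * kappa\<^sup>2 * (third k * third j) / real n"
      by (simp only: power2_eq_square ac_simps)
    also have "\<dots> = kappa\<^sup>2 * q * (third k * third j)"
      by (simp add: q_def)
    finally have "\<bar>cov_sum k * cov_sum j / real n\<bar> \<le> kappa\<^sup>2 * q * (third k * third j)" .
    moreover have "\<bar>u k j - c k j\<bar> \<le> A * q * (third k * third j)"
      using pair_close[OF kj(1) j] by (simp add: u_def c_def A_def q_def)
    ultimately show ?thesis
      using abs_triangle_ineq[of "u k j - c k j" "cov_sum k * cov_sum j / real n"]
      unfolding distrib_right by linarith
  qed
  have far: "\<bar>u k j + cov_sum k * cov_sum j / real n\<bar> \<le> 2 * A * q\<^sup>2 * (third k * third j)"
    if "k < n" "j \<in> {..<n} - ?N k" for k j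
    using pair_far[of k j] that by (simp add: u_def A_def q_def)
  have "U.variance (R_stat n m h) - sigma_sq n m h =
     (\<Sum>k<n. \<Sum>j<n. u k j) - (\<Sum>k<n. v k)\<^sup>2 - (\<Sum>k<n. \<Sum>j\<in>?N k. c k j)
      + (\<Sum>k<n. \<Sum>j<n. cov_sum k * cov_sum j / real n)"
    unfolding variance_R_stat sigma_sq_eq u_def v_def c_def
    by (simp add: power2_eq_square sum_product sum_divide_distrib)
  also have "\<dots> = (\<Sum>k<n. \<Sum>j\<in>?N k. u k j - c k j + cov_sum k * cov_sum j / real n)
      + (\<Sum>k<n. \<Sum>j\<in>{..<n} - ?N k. u k j + cov_sum k * cov_sum j / real n) - (\<Sum>k<n. v k)\<^sup>2"
    by (simp add: split2[of u] split2[of "\<lambda>k j. cov_sum k * cov_sum j / real n"] sum.distrib sum_subtractf)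
  finally have diff: "U.variance (R_stat n m h) - sigma_sq n m h = \<dots>" .
  have "\<bar>U.variance (R_stat n m h) - sigma_sq n m h\<bar> \<le> (\<Sum>k<n. \<Sum>j\<in>?N k. (A + kappa\<^sup>2) * q * (third k * third j))
      + (\<Sum>k<n. \<Sum>j\<in>{..<n} - ?N k. 2 * A * q\<^sup>2 * (third k * third j)) + (\<Sum>k<n. A * q * third k)\<^sup>2"
  proof -
    have "\<bar>\<Sum>k<n. \<Sum>j\<in>?N k. u k j - c k j + cov_sum k * cov_sum j / real n\<bar> \<le> 
        (\<Sum>k<n. \<Sum>j\<in>?N k. (A + kappa\<^sup>2) * q * (third k * third j))"
      using near by (auto intro!: order_trans[OF sum_abs] sum_mono)
    moreover have "\<bar>\<Sum>k<n. \<Sum>j\<in>{..<n} - ?N k. u k j + cov_sum k * cov_sum j / real n\<bar> \<le> 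
        (\<Sum>k<n. \<Sum>j\<in>{..<n} - ?N k. 2 * A * q\<^sup>2 * (third k * third j))"
      using far by (auto intro!: order_trans[OF sum_abs] sum_mono)
    moreover have "(\<Sum>k<n. v k)\<^sup>2 \<le> (\<Sum>k<n. A * q * third k)\<^sup>2"
    proof -
      have "\<bar>v k\<bar> \<le> A * q * third k" if "k < n" for k
      proof -
        have "500000 * kappa\<^sup>2 * q * third k \<le> A * q * third k"
          using third_nonneg q0 by (intro mult_right_mono) (auto simp: A_def)
        then show ?thesis using mean_bound(2)[OF that] unfolding v_def q_def by linarith
      qed
      then have "\<bar>\<Sum>k<n. v k\<bar> \<le> (\<Sum>k<n. A * q * third k)"
        by (auto intro!: order_trans[OF sum_abs] sum_mono)
      then show ?thesis by (metis abs_ge_zero power2_abs power_mono)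
    qed
    ultimately show ?thesis
      using zero_le_power2[of "\<Sum>k<n. v k"] unfolding diff by linarith
  qed
  also have "\<dots> \<le> (A + kappa\<^sup>2) * q * (\<Sum>k<n. \<Sum>j\<in>?N k. third k * third j)
     + (\<Sum>k<n. \<Sum>j<n. 2 * A * q\<^sup>2 * (third k * third j)) + (\<Sum>k<n. A * q * third k)\<^sup>2"
  proof (intro add_mono order_refl)
    show "(\<Sum>k<n. \<Sum>j\<in>?N k. (A + kappa\<^sup>2) * q * (third k * third j))
       \<le> (A + kappa\<^sup>2) * q * (\<Sum>k<n. \<Sum>j\<in>?N k. third k * third j)"
      by (simp only: sum_distrib_left order_refl)
    \<comment> \<open>By nonnegativity the sum over distant pairs may be extended to all pairs,
      which completes the square of the sum of \<open>third\<close>.\<close>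
    have "0 \<le> 2 * A * q\<^sup>2 * (third k * third j)" for k j
      by (simp add: A_def third_nonneg)
    then show "(\<Sum>k<n. \<Sum>j\<in>{..<n} - ?N k. 2 * A * q\<^sup>2 * (third k * third j))
       \<le> (\<Sum>k<n. \<Sum>j<n. 2 * A * q\<^sup>2 * (third k * third j))"
      by (intro sum_mono sum_mono2) auto
  qed
  also have "(\<Sum>k<n. \<Sum>j<n. 2 * A * q\<^sup>2 * (third k * third j)) = 2 * A * q\<^sup>2 * (\<Sum>k<n. third k)\<^sup>2"
    by (simp only: power2_eq_square[of "\<Sum>k<n. third k"] sum_product) (simp only: sum_distrib_left)
  also have "(\<Sum>k<n. A * q * third k)\<^sup>2 = A\<^sup>2 * q\<^sup>2 * (\<Sum>k<n. third k)\<^sup>2"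
    by (simp add: sum_distrib_left[symmetric] power_mult_distrib)
  finally show ?thesis by (simp add: algebra_simps)
qed

end

text \<open>\<open>c\<close> is chosen before \<open>m\<close>, hence absolute, and the threshold
  for \<open>n\<close> is chosen before \<open>h\<close>, so the estimate is uniform over the
  functions.\<close>

theorem proposition2p2:
  shows "\<exists>c::real. c > 0 \<and>
    (\<forall>m :: nat \<Rightarrow> nat.
      (\<forall>n. m n \<ge> 1) \<longrightarrow> (\<lambda>n. real (m n)) \<in> o(\<lambda>n. real n) \<longrightarrow>
      (\<forall>\<^sub>F n in sequentially.
        \<forall>h :: nat \<Rightarrow> (nat \<Rightarrow> real) \<Rightarrow> real.
          (\<forall>k<n. h k \<in> borel_measurable (PiM {..<m n} (\<lambda>_. borel))) \<longrightarrow>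
          (\<forall>k<n. integrable (exp_sample n) (\<lambda>x. \<bar>h_exp n (m n) h (int k) x\<bar> ^ 3)) \<longrightarrow>
          sigma_sq n (m n) h > 0 \<longrightarrow>
          integrable (unif_sample n) (\<lambda>\<omega>. (R_stat n (m n) h \<omega>)\<^sup>2) \<and>
          (\<exists>r::real.
            prob_space.variance (unif_sample n) (R_stat n (m n) h)
              = sigma_sq n (m n) h * (1 + r) \<and>
            \<bar>r\<bar> \<le> c / sigma_sq n (m n) h *
              (real (m n) / real n *
                 (\<Sum>k<n. \<Sum>j\<in>{int k - int (m n) + 1..int k + int (m n) - 1}.
                    (abs_mom3 n (m n) h (int k) * abs_mom3 n (m n) h j) powr (1 / 3))
               + real (m n) powr (3 / 2) / real n powr (3 / 2) *
                 (\<Sum>k<n. abs_mom3 n (m n) h (int k) powr (1 / 3))\<^sup>2))))"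
proof -
  define A where "A = 1000000 * kappa\<^sup>2"
  \<comment> \<open>The sum of the two constants in \<open>variance_error\<close>, so that
    \<open>c\<close> dominates both.\<close>
  define c where "c = (A + kappa\<^sup>2) + (2 * A + A\<^sup>2)"
  have A0: "A > 0" using kappa_ge_one by (simp add: A_def)
  show ?thesis
  proof (intro exI[of _ c] conjI allI impI)
    show "c > 0" using A0 by (simp add: c_def add_pos_nonneg)
    fix m :: "nat \<Rightarrow> nat"
    assume m1: "\<forall>n. m n \<ge> 1" and mo: "(\<lambda>n. real (m n)) \<in> o(\<lambda>n. real n)"
    \<comment> \<open>The little-o condition at this particular constant is the assumption
      \<open>n_large\<close> of the locale.\<close>
    have "\<forall>\<^sub>F n in sequentially. norm (real (m n)) \<le> 1 / (2000000 * kappa) * norm (real n)"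
      using landau_o.smallD[OF mo, of "1 / (2000000 * kappa)"] kappa_ge_one by simp
    then show "\<forall>\<^sub>F n in sequentially.
        \<forall>h :: nat \<Rightarrow> (nat \<Rightarrow> real) \<Rightarrow> real.
          (\<forall>k<n. h k \<in> borel_measurable (PiM {..<m n} (\<lambda>_. borel))) \<longrightarrow>
          (\<forall>k<n. integrable (exp_sample n) (\<lambda>x. \<bar>h_exp n (m n) h (int k) x\<bar> ^ 3)) \<longrightarrow>
          sigma_sq n (m n) h > 0 \<longrightarrow>
          integrable (unif_sample n) (\<lambda>\<omega>. (R_stat n (m n) h \<omega>)\<^sup>2) \<and>
          (\<exists>r::real.
            prob_space.variance (unif_sample n) (R_stat n (m n) h)
              = sigma_sq n (m n) h * (1 + r) \<and>
            \<bar>r\<bar> \<le> c / sigma_sq n (m n) h *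
              (real (m n) / real n *
                 (\<Sum>k<n. \<Sum>j\<in>{int k - int (m n) + 1..int k + int (m n) - 1}.
                    (abs_mom3 n (m n) h (int k) * abs_mom3 n (m n) h j) powr (1 / 3))
               + real (m n) powr (3 / 2) / real n powr (3 / 2) *
                 (\<Sum>k<n. abs_mom3 n (m n) h (int k) powr (1 / 3))\<^sup>2))"
    proof (rule eventually_mono, intro allI impI)
      fix n h
      assume "norm (real (m n)) \<le> 1 / (2000000 * kappa) * norm (real n)"
      then have large: "2000000 * kappa * real (m n) \<le> real n"
        using kappa_ge_one by (simp add: field_simps)
      assume h: "\<forall>k<n. h k \<in> borel_measurable (PiM {..<m n} (\<lambda>_. borel))"
        "\<forall>k<n. integrable (exp_sample n) (\<lambda>x. \<bar>h_exp n (m n) h (int k) x\<bar> ^ 3)"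
      assume pos: "sigma_sq n (m n) h > 0"
      have "m n > 0" using m1 by (simp add: Suc_le_eq)
      then interpret spacing_statistic n "m n" h
        using large h by unfold_locales auto
      let ?\<sigma> = "sigma_sq n (m n) h"
      define q where "q = real (m n) / real n"
      define X where "X = (\<Sum>k<n. \<Sum>j\<in>neighbours n (m n) k. third k * third j)"
      define Y where "Y = (\<Sum>k<n. third k)\<^sup>2"
      \<comment> \<open>The claimed equality forces this choice; its bound is
        \<open>variance_error\<close> divided by the positive \<open>?\<sigma>\<close>.\<close>
      define r where "r = U.variance (R_stat n (m n) h) / ?\<sigma> - 1"
      have q: "0 \<le> q" "q \<le> 1" using n_ge by (auto simp: q_def)
      have XY: "X \<ge> 0" "Y \<ge> 0" by (auto simp: X_def Y_def third_nonneg intro!: sum_nonneg)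
      \<comment> \<open>As \<open>q <= 1\<close>, the square of \<open>q\<close> may be weakened to
        the exponent 3/2 of the claim.\<close>
      have "q\<^sup>2 = q powr 2" using q by (cases "q = 0") (simp_all add: powr_numeral)
      also have "\<dots> \<le> q powr (3 / 2)" using q by (intro powr_mono') auto
      also have "\<dots> = real (m n) powr (3 / 2) / real n powr (3 / 2)"
        by (simp add: q_def powr_divide)
      finally have q2: "q\<^sup>2 \<le> real (m n) powr (3 / 2) / real n powr (3 / 2)" .
      have "\<bar>r\<bar> = \<bar>U.variance (R_stat n (m n) h) - ?\<sigma>\<bar> / ?\<sigma>"
      proof -
        have "r = (U.variance (R_stat n (m n) h) - ?\<sigma>) / ?\<sigma>"
          using pos by (simp add: r_def diff_divide_distrib)
        then show ?thesis using pos by (simp add: abs_divide)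
      qed
      also have "\<dots> \<le> ((A + kappa\<^sup>2) * q * X + (2 * A + A\<^sup>2) * q\<^sup>2 * Y) / ?\<sigma>"
        using pos variance_error by (intro divide_right_mono) (auto simp: q_def X_def Y_def A_def)
      also have "\<dots> \<le> (c * (q * X) + c * (real (m n) powr (3 / 2) / real n powr (3 / 2) * Y)) / ?\<sigma>"
      proof (intro divide_right_mono add_mono)
        show "(A + kappa\<^sup>2) * q * X \<le> c * (q * X)"
          unfolding mult.assoc using A0 q XY by (intro mult_right_mono) (auto simp: c_def)
        show "(2 * A + A\<^sup>2) * q\<^sup>2 * Y \<le> c * (real (m n) powr (3 / 2) / real n powr (3 / 2) * Y)"
          unfolding mult.assoc using A0 q2 XY by (intro mult_mono mult_right_mono) (auto simp: c_def)
      qed (use pos in simp)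
      also have "\<dots> = c / ?\<sigma> * (q * X + real (m n) powr (3 / 2) / real n powr (3 / 2) * Y)"
        by (simp add: add_divide_distrib distrib_left)
      finally have r: "\<bar>r\<bar> \<le> c / ?\<sigma> * (q * X + real (m n) powr (3 / 2) / real n powr (3 / 2) * Y)" .
      have var: "U.variance (R_stat n (m n) h) = ?\<sigma> * (1 + r)"
        using pos by (simp add: r_def)
      show "integrable (unif_sample n) (\<lambda>\<omega>. (R_stat n (m n) h \<omega>)\<^sup>2) \<and>
          (\<exists>r::real.
            prob_space.variance (unif_sample n) (R_stat n (m n) h)
              = sigma_sq n (m n) h * (1 + r) \<and>
            \<bar>r\<bar> \<le> c / sigma_sq n (m n) h *
              (real (m n) / real n *
                 (\<Sum>k<n. \<Sum>j\<in>{int k - int (m n) + 1..int k + int (m n) - 1}.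
                    (abs_mom3 n (m n) h (int k) * abs_mom3 n (m n) h j) powr (1 / 3))
               + real (m n) powr (3 / 2) / real n powr (3 / 2) *
                 (\<Sum>k<n. abs_mom3 n (m n) h (int k) powr (1 / 3))\<^sup>2))"
        unfolding error_sum_eq third_eq
        using R_stat_square_integrable var r by (auto simp: q_def X_def Y_def intro!: exI[of _ r])
    qed
  qed
qed

end
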